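(* Under the standing assumptions of the context, the space $C^\infty_c(\mathcal{Q})$ is dense in $H_0=\{u\in H:\ u|_{\Gamma_\mathcal{Q}}=0\}$ (with respect to the norm of $H$).
   Context: Standing assumptions: $d\in\{2,3\}$, $\phi\in C^\infty(\mathbb{R}^d\times[t_0,T])$, $\Omega(t)=\{x:\phi(x,t)<0\}$, $\Gamma(t)=\{x:\phi(x,t)=0\}$, $\Omega(t)$ bounded, $\mathcal{Q}=\bigcup_{t\in(t_0,T)}\Omega(t)\times\{t\}$, $\Gamma_\mathcal{Q}=\bigcup_{t\in(t_0,T)}\Gamma(t)\times\{t\}$. $(0,0)$ is the unique point of $\Gamma_\mathcal{Q}$ (or its closure) with $\nabla_x\phi=0$, $\det\nabla_x^2\phi(0,0)\ne0$, $\partial_t\phi(0,0)\ne0$; for $t\ne0$, $\Omega(t)$ has smooth boundary and evolves smoothly on $(t_0,0)$ and $(0,T)$. Time interval $[t_0,T]=[-1,1]$, except if all eigenvalues of $\nabla_x^2\phi(0,0)$ are positive: $[0,1]$ if $\partial_t\phi(0,0)<0$, $[-1,0]$ if $\partial_t\phi(0,0)>0$. Spaces: $H=\{u\in L^2(\mathcal{Q}):\partial_{x_i}u\in L^2(\mathcal{Q}),1\le i\le d\}$ with norm $\|u\|_H^2=\|u\|_{L^2(\mathcal{Q})}^2+\|\nabla_x u\|_{L^2(\mathcal{Q})}^2$. On $\Gamma_\mathcal{Q}\setminus\{(0,0)\}$ let $V_\Gamma=-\frac{\partial_t\phi}{|\nabla_x\phi|}\frac{\nabla_x\phi}{|\nabla_x\phi|}$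 (normal velocity) and define the weight $\omega=|t|^{1/2}(1+|V_\Gamma|^2)^{-1/2}$ if all eigenvalues of $\nabla_x^2\phi(0,0)$ are positive, and $\omega=(1+|V_\Gamma|^2)^{-1/2}$ otherwise; $L^2_\omega(\Gamma_\mathcal{Q})$ is the corresponding weighted $L^2$ space with respect to surface measure on $\Gamma_\mathcal{Q}$. The trace $u\mapsto u|_{\Gamma_\mathcal{Q}}$ on $H$ is the unique continuous extension to $H\to L^2_\omega(\Gamma_\mathcal{Q})$ of the restriction map on $C^\infty(\overline{\mathcal{Q}})$ (which is bounded, $\|u\|_{L^2_\omega(\Gamma_\mathcal{Q})}\le C\|u\|_H$, and $C^\infty(\overline{\mathcal Q})$ is dense in $H$). *)

theory Defs
  imports "HOL-Analysis.Analysis"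
begin

definition partial :: "'a::euclidean_space \<Rightarrow> ('a \<Rightarrow> real) \<Rightarrow> 'a \<Rightarrow> real" where
  "partial v f x = deriv (\<lambda>h. f (x + h *\<^sub>R v)) 0"

definition iter_partial :: "'a::euclidean_space list \<Rightarrow> ('a \<Rightarrow> real) \<Rightarrow> 'a \<Rightarrow> real" where
  "iter_partial vs f = foldr partial vs f"

definition smooth :: "('a::euclidean_space \<Rightarrow> real) \<Rightarrow> bool" where
  "smooth f \<longleftrightarrow> (\<forall>vs. set vs \<subseteq> Basis \<longrightarrow>
      continuous_on UNIV (iter_partial vs f) \<and>
      (\<forall>x. \<forall>v\<in>Basis. (\<lambda>h. iter_partial vs f (x + h *\<^sub>R v)) differentiable (at 0)))"

definition Cc_inf :: "'a::euclidean_space set \<Rightarrow> ('a \<Rightarrow> real) set" where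
  "Cc_inf S = {f. smooth f \<and> compact (closure {z. f z \<noteq> 0}) \<and> closure {z. f z \<noteq> 0} \<subseteq> S}"

definition dx :: "'n::finite \<Rightarrow> ((real^'n) \<times> real \<Rightarrow> real) \<Rightarrow> (real^'n) \<times> real \<Rightarrow> real" where
  "dx i f = partial (axis i 1, 0) f"

definition dt :: "((real^'n::finite) \<times> real \<Rightarrow> real) \<Rightarrow> (real^'n) \<times> real \<Rightarrow> real" where
  "dt f = partial (0, 1) f"

definition grad_x :: "((real^'n::finite) \<times> real \<Rightarrow> real) \<Rightarrow> (real^'n) \<times> real \<Rightarrow> real^'n" where
  "grad_x f z = (\<chi> i. dx i f z)"

definition hess_x :: "((real^'n::finite) \<times> real \<Rightarrow> real) \<Rightarrow> (real^'n) \<times> real \<Rightarrow> real^'n^'n" where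
  "hess_x f z = (\<chi> i j. dx i (dx j f) z)"

definition all_eig_pos :: "((real^'n::finite) \<times> real \<Rightarrow> real) \<Rightarrow> bool" where
  "all_eig_pos \<phi> \<longleftrightarrow> (\<forall>(c::real) v. v \<noteq> 0 \<and> hess_x \<phi> (0,0) *v v = c *\<^sub>R v \<longrightarrow> c > 0)"

definition t0 :: "((real^'n::finite) \<times> real \<Rightarrow> real) \<Rightarrow> real" where
  "t0 \<phi> = (if all_eig_pos \<phi> \<and> dt \<phi> (0,0) < 0 then 0 else -1)"

definition tT :: "((real^'n::finite) \<times> real \<Rightarrow> real) \<Rightarrow> real" where
  "tT \<phi> = (if all_eig_pos \<phi> \<and> dt \<phi> (0,0) > 0 then 0 else 1)"

definition QQ :: "((real^'n::finite) \<times> real \<Rightarrow> real) \<Rightarrow> ((real^'n) \<times> real) set" where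
  "QQ \<phi> = {(x,t). t0 \<phi> < t \<and> t < tT \<phi> \<and> \<phi> (x,t) < 0}"

definition GammaQ :: "((real^'n::finite) \<times> real \<Rightarrow> real) \<Rightarrow> ((real^'n) \<times> real) set" where
  "GammaQ \<phi> = {(x,t). t0 \<phi> < t \<and> t < tT \<phi> \<and> \<phi> (x,t) = 0}"

section \<open>Surface measure: s-dimensional Hausdorff measure\<close>

definition hausdorff_pre :: "real \<Rightarrow> real \<Rightarrow> 'a::metric_space set \<Rightarrow> ennreal" where
  "hausdorff_pre s \<delta> A = (INF C \<in> {C :: nat \<Rightarrow> 'a set. A \<subseteq> (\<Union>i. C i) \<and>
        (\<forall>i. bounded (C i) \<and> diameter (C i) \<le> \<delta>)}.
      (\<Sum>i. ennreal (pi powr (s/2) / Gamma (s/2 + 1) * (diameter (C i) / 2) powr s)))"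

definition hausdorff_outer :: "real \<Rightarrow> 'a::metric_space set \<Rightarrow> ennreal" where
  "hausdorff_outer s A = (SUP \<delta> \<in> {0<..}. hausdorff_pre s \<delta> A)"

definition hausdorff_measure :: "real \<Rightarrow> 'a::{metric_space,topological_space} measure" where
  "hausdorff_measure s = measure_of UNIV (sets borel) (hausdorff_outer s)"

definition weight :: "((real^'n::finite) \<times> real \<Rightarrow> real) \<Rightarrow> (real^'n) \<times> real \<Rightarrow> real" where
  "weight \<phi> z = (let V2 = (dt \<phi> z / norm (grad_x \<phi> z))\<^sup>2 in
     (if all_eig_pos \<phi> then sqrt \<bar>snd z\<bar> else 1) / sqrt (1 + V2))"

definition L2w_sq :: "((real^'n::finite) \<times> real \<Rightarrow> real) \<Rightarrow> ((real^'n) \<times> real \<Rightarrow> real) \<Rightarrow> ennreal" where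
  "L2w_sq \<phi> v = (\<integral>\<^sup>+ z. indicator (GammaQ \<phi>) z * ennreal ((v z)\<^sup>2 * weight \<phi> z)
                     \<partial>(hausdorff_measure (real CARD('n))))"

definition L2 :: "'a::euclidean_space set \<Rightarrow> ('a \<Rightarrow> real) \<Rightarrow> bool" where
  "L2 S u \<longleftrightarrow> u \<in> borel_measurable (lebesgue_on S) \<and> integrable (lebesgue_on S) (\<lambda>z. (u z)\<^sup>2)"

definition weak_dx :: "((real^'n::finite) \<times> real) set \<Rightarrow> 'n \<Rightarrow> ((real^'n) \<times> real \<Rightarrow> real)
    \<Rightarrow> ((real^'n) \<times> real \<Rightarrow> real) \<Rightarrow> bool" where
  "weak_dx S i u g \<longleftrightarrow> (\<forall>\<psi> \<in> Cc_inf S.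
     (LINT z|lebesgue_on S. u z * dx i \<psi> z) = - (LINT z|lebesgue_on S. g z * \<psi> z))"

definition inH :: "((real^'n::finite) \<times> real) set \<Rightarrow> ((real^'n) \<times> real \<Rightarrow> real) \<Rightarrow> bool" where
  "inH S u \<longleftrightarrow> L2 S u \<and> (\<forall>i. \<exists>g. L2 S g \<and> weak_dx S i u g)"

definition wdx :: "((real^'n::finite) \<times> real) set \<Rightarrow> 'n \<Rightarrow> ((real^'n) \<times> real \<Rightarrow> real)
    \<Rightarrow> ((real^'n) \<times> real \<Rightarrow> real)" where
  "wdx S i u = (SOME g. L2 S g \<and> weak_dx S i u g)"

definition H_norm :: "((real^'n::finite) \<times> real) set \<Rightarrow> ((real^'n) \<times> real \<Rightarrow> real) \<Rightarrow> real" where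
  "H_norm S u = sqrt ((LINT z|lebesgue_on S. (u z)\<^sup>2) + (\<Sum>i\<in>UNIV. LINT z|lebesgue_on S. (wdx S i u z)\<^sup>2))"

text \<open>u|Gamma_Q = 0 where the trace is the continuous extension of the restriction map on
  C^inf(closure Q) (= restrictions of smooth functions on the whole space): equivalently, u is the
  H-limit of such smooth functions whose restrictions to Gamma_Q tend to 0 in L2_omega.\<close>
definition H0 :: "((real^'n::finite) \<times> real \<Rightarrow> real) \<Rightarrow> ((real^'n) \<times> real \<Rightarrow> real) set" where
  "H0 \<phi> = {u. inH (QQ \<phi>) u \<and>
     (\<exists>v :: nat \<Rightarrow> (real^'n) \<times> real \<Rightarrow> real.
        (\<forall>k. smooth (v k) \<and> inH (QQ \<phi>) (v k)) \<and>
        (\<lambda>k. H_norm (QQ \<phi>) (\<lambda>z. u z - v k z)) \<longlonglongrightarrow> 0 \<and>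
        (\<lambda>k. L2w_sq \<phi> (v k)) \<longlonglongrightarrow> 0)}"

end

theory Submission
  imports Defs
begin

text \<open>
  The norm of \<open>H\<close> contains no time derivative, so multiplying by a cutoff in \<open>t\<close> costs nothing in the
  limit. This removes neighbourhoods of the end times and of \<open>t = 0\<close>, and with it the singular point;
  a cutoff in \<open>x\<close> at scale \<open>n\<close> costs \<open>O(1/n)\<close>. On the remaining compact set the spatial gradient
  of \<open>\<phi>\<close> does not vanish on the boundary. Let \<open>v\<close> be smooth. Moving a point of the strip
  \<open>-\<epsilon> < \<phi> < 0\<close> in a coordinate direction until it meets \<open>\<phi> = 0\<close> bounds
  \<open>\<epsilon>\<^sup>-\<^sup>2 \<integral> v\<^sup>2\<close> over the strip by \<open>\<epsilon>\<^sup>-\<^sup>1\<close> times the boundary integral of \<open>v\<^sup>2\<close> plus the integral of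
  \<open>\<bar>\<nabla>v\<bar>\<^sup>2\<close> over the strip. Apply this to smooth \<open>v k\<close> converging to \<open>u\<close> in \<open>H\<close> with traces
  tending to 0. For \<open>k \<rightarrow> \<infinity>\<close> the boundary term disappears, and then for \<open>\<epsilon> \<rightarrow> 0\<close> so does the
  gradient term. Hence multiplying \<open>v k\<close> by a cutoff vanishing near the boundary gives the
  required test functions, without any mollification.
\<close>

section \<open>Hausdorff measure on Borel sets\<close>

text \<open>The trace enters only through \<open>L2w_sq\<close>, an integral over Hausdorff measure,
  so the boundary is never parametrised: sets covering the level set are thickened to boxes, which
  turns a Hausdorff bound into a Lebesgue bound. This requires that \<open>hausdorff_measure\<close>
  is a genuine measure with the expected values on Borel sets. The cutoff near the boundary has
  gradient of order \<open>1/\<epsilon>\<close>, so the squared mass of the approximation on the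
  strip must be small compared with \<open>\<epsilon>\<^sup>2\<close>; only the trace condition can
  provide this. The estimate evaluates functions along segments and at their endpoints, hence it is
  applied to the smooth \<open>v k\<close> and not to \<open>u\<close>. Its gradient term is
  controlled for all large \<open>k\<close> at once, because the gradients of \<open>v k\<close> are
  close to the weak gradient of \<open>u\<close>, whose mass on thin strips is small. Its boundary
  term, multiplied by the squared cutoff gradient, grows like \<open>1/\<epsilon>\<close>. This
  dictates the order of choices: \<open>n\<close>, then \<epsilon>, then \<open>k\<close>. The
  weight may degenerate at the critical point, but it is bounded below on the compact set selected
  by \<open>n\<close>.\<close>

text \<open>Caratheodory's criterion. The shells \<open>R k\<close> of points at distance between \<open>1/(k+2)\<close> and
  \<open>1/(k+1)\<close> from \<open>F\<close> with indices of equal parity are pairwise separated, hence their measures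
  are summable.\<close>

lemma caratheodory_closed:
  fixes f :: "'a::metric_space set \<Rightarrow> ennreal"
  assumes oms: "outer_measure_space (Pow UNIV) f"
    and metric: "\<And>A B \<rho>. \<rho> > 0 \<Longrightarrow> (\<And>x y. x \<in> A \<Longrightarrow> y \<in> B \<Longrightarrow> \<rho> \<le> dist x y) \<Longrightarrow>
                   f A + f B \<le> f (A \<union> B)"
    and "closed F"
  shows "F \<in> lambda_system UNIV (Pow UNIV) f"
proof -
  interpret sigma_algebra "UNIV :: 'a set" "Pow UNIV" by (rule sigma_algebra_Pow)
  have pos: "f {} = 0" and incr: "\<And>A B. A \<subseteq> B \<Longrightarrow> f A \<le> f B"
    and csub: "countably_subadditive (Pow UNIV) f"
    using oms by (auto simp: outer_measure_space_def positive_def increasing_def)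
  have "subadditive (Pow UNIV) f"
    using countably_subadditive_subadditive[OF _ csub] pos by (simp add: positive_def)
  then have sub_disj: "f (A \<union> B) \<le> f A + f B" if "A \<inter> B = {}" for A B
    using that by (auto simp: subadditive_def)
  have sub: "f (A \<union> B) \<le> f A + f B" for A B
    using sub_disj[of A "B - A"] incr[of "B - A" B]
    by (smt (verit, best) Diff_disjoint Diff_subset Un_Diff_cancel add_left_mono order_trans)
  have csub': "f (\<Union>i. A i) \<le> (\<Sum>i. f (A i))" for A :: "nat \<Rightarrow> 'a set"
  proof -
    have "f (\<Union>i. disjointed A i) \<le> (\<Sum>i. f (disjointed A i))"
      using csub disjoint_family_disjointed[of A] by (auto simp: countably_subadditive_def)
    also have "\<dots> \<le> (\<Sum>i. f (A i))"
      by (intro suminf_le incr disjointed_subset) auto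
    finally show ?thesis by (simp add: UN_disjointed_eq)
  qed
  show ?thesis
  proof (cases "F = {}")
    case True
    then show ?thesis by (simp add: lambda_system_def pos)
  next
    case False
    have "f (X \<inter> F) + f (X - F) \<le> f X" for X
    proof (cases "f X = \<infinity>")
      case fin: False
      define d where "d x = infdist x F" for x
      have d0: "d x = 0 \<longleftrightarrow> x \<in> F" for x
        using in_closed_iff_infdist_zero[OF \<open>closed F\<close> False] by (simp add: d_def)
      have d_nn: "0 \<le> d x" for x by (simp add: d_def infdist_nonneg)
      have d_lip: "d x - d y \<le> dist x y" for x y
        using infdist_triangle[of x F y] by (simp add: d_def)
      define G where "G n = {x\<in>X. 1 / real (Suc n) \<le> d x}" for n
      define R where "R k = G (Suc k) - G k" for k
      have G_mono: "G m \<subseteq> G n" if "m \<le> n" for m n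
        using that unfolding G_def by (auto intro: order_trans[rotated] simp: frac_le)
      have odd_even: "(\<Sum>k<n. f (R (2*k+p))) \<le> f (\<Union>k<n. R (2*k+p))" for n p
      proof (induction n)
        case (Suc n)
        have "f (\<Union>k<n. R (2*k+p)) + f (R (2*n+p)) \<le> f ((\<Union>k<n. R (2*k+p)) \<union> R (2*n+p))"
        proof (cases "n = 0")
          case n: False
          let ?m = "2*n+p"
          show ?thesis
          proof (rule metric)
            \<comment> \<open>Only shells of one parity are compared, so every earlier shell lies in
              \<open>G (?m - 1)\<close>, where the distance to \<open>F\<close> is at least
              \<open>1 / ?m\<close>, whereas on \<open>R ?m\<close> it is below
              \<open>1 / (?m + 1)\<close>. The case \<open>n = 0\<close> is treated apart because
              \<open>1 / ?m\<close> needs \<open>?m > 0\<close>.\<close>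
            show "0 < 1 / real ?m - 1 / real (Suc ?m)" using n by (simp add: frac_less2)
            fix x y assume "x \<in> (\<Union>k<n. R (2*k+p))" and y: "y \<in> R ?m"
            then obtain k where k: "k < n" "x \<in> G (Suc (2*k+p))" by (auto simp: R_def)
            have "Suc (2*k+p) \<le> ?m - 1" using k(1) by linarith
            then have "x \<in> G (?m - 1)" using G_mono k(2) by blast
            then have "1 / real ?m \<le> d x" using n by (simp add: G_def)
            moreover have "d y < 1 / real (Suc ?m)" using y by (auto simp: R_def G_def)
            ultimately show "1 / real ?m - 1 / real (Suc ?m) \<le> dist x y"
              using d_lip[of x y] by linarith
          qed
        qed (simp add: pos)
        also have "(\<Union>k<n. R (2*k+p)) \<union> R (2*n+p) = (\<Union>k<Suc n. R (2*k+p))"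
          by (auto simp: less_Suc_eq)
        finally show ?case by (simp add: order_trans[OF add_right_mono[OF Suc.IH]])
      qed (simp add: pos)
      have part: "(\<Sum>k<n. f (R (2*k+p))) \<le> f X" for n p
        using odd_even[of p n] incr[of "\<Union>k<n. R (2*k+p)" X] by (force simp: R_def G_def)
      have split: "(\<Sum>k<2*n. f (R k)) = (\<Sum>k<n. f (R (2*k+0))) + (\<Sum>k<n. f (R (2*k+1)))" for n
        by (induction n) (auto simp: ac_simps)
      have "(\<Sum>k<n. f (R k)) \<le> f X + f X" for n
      proof -
        have "(\<Sum>k<n. f (R k)) \<le> (\<Sum>k<2*n. f (R k))" by (intro sum_mono2) auto
        also have "\<dots> \<le> f X + f X" unfolding split by (intro add_mono part)
        finally show ?thesis .
      qed
      then have "(\<Sum>k. f (R k)) \<le> f X + f X"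
        by (intro suminf_le_const) auto
      then have sfin: "(\<Sum>k. f (R k)) \<noteq> \<infinity>" using fin
        by (metis ennreal_add_eq_top infinity_ennreal_def neq_top_trans)
      have bound: "f (X \<inter> F) + f (X - F) \<le> f X + (\<Sum>k. f (R (k + n)))" for n
      proof -
        \<comment> \<open>A point off the closed set \<open>F\<close> lies in some
          \<open>G m\<close>; if the first such index \<open>l\<close> exceeds \<open>n\<close>, the
          point belongs to the shell \<open>R (l - 1)\<close>. The set \<open>G n\<close> is
          separated from \<open>F\<close>, and the shells from \<open>n\<close> on contribute the
          tail of a convergent series.\<close>
        have "X - F \<subseteq> G n \<union> (\<Union>k. R (k + n))"
        proof
          fix x assume x: "x \<in> X - F"
          then have "d x > 0" using d0[of x] d_nn[of x] by auto
          then obtain m where "1 / real (Suc m) < d x"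
            using nat_approx_posE by blast
          then have "x \<in> G m" using x by (auto simp: G_def)
          then have ex: "\<exists>m. x \<in> G m" by blast
          define l where "l = (LEAST m. x \<in> G m)"
          have l: "x \<in> G l" "\<And>j. j < l \<Longrightarrow> x \<notin> G j"
            using LeastI_ex[OF ex] not_less_Least unfolding l_def by auto
          show "x \<in> G n \<union> (\<Union>k. R (k + n))"
          proof (cases "l \<le> n")
            case True then show ?thesis using G_mono l by blast
          next
            case False
            then have "x \<in> R ((l - 1 - n) + n)" using l by (auto simp: R_def)
            then show ?thesis by blast
          qed
        qed
        then have "f (X - F) \<le> f (G n) + f (\<Union>k. R (k + n))"
          using incr sub order_trans by metis
        also have "\<dots> \<le> f (G n) + (\<Sum>k. f (R (k + n)))"
          using csub'[of "\<lambda>k. R (k+n)"] by (simp add: add_left_mono)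
        finally have "f (X \<inter> F) + f (X - F) \<le> f (X \<inter> F) + f (G n) + (\<Sum>k. f (R (k + n)))"
          by (simp add: add_left_mono add.assoc)
        moreover have "f (X \<inter> F) + f (G n) \<le> f X"
        proof -
          have "f (X \<inter> F) + f (G n) \<le> f (X \<inter> F \<union> G n)"
          proof (rule metric[of "1 / real (Suc n)"])
            fix x y assume "x \<in> X \<inter> F" "y \<in> G n"
            then show "1 / real (Suc n) \<le> dist x y"
              using d_lip[of y x] d0[of x] by (auto simp: G_def dist_commute)
          qed simp
          also have "\<dots> \<le> f X" by (rule incr) (auto simp: G_def)
          finally show ?thesis .
        qed
        ultimately show ?thesis by (meson add_right_mono order_trans)
      qed
      let ?S = "\<Sum>k. f (R k)"
      have tail: "(\<Sum>k. f (R (k + n))) = ?S - (\<Sum>k<n. f (R k))" for n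
      proof -
        have "?S = (\<Sum>k. f (R (k + n))) + (\<Sum>k<n. f (R k))"
          by (rule suminf_offset) auto
        moreover have "(\<Sum>k<n. f (R k)) \<noteq> \<infinity>"
          using sfin sum_le_suminf[of "\<lambda>k. f (R k)" "{..<n}"]
          by (metis calculation ennreal_add_eq_top infinity_ennreal_def)
        ultimately show ?thesis by (simp add: ennreal_add_diff_cancel_right)
      qed
      have "(\<lambda>n. (\<Sum>k<n. f (R k))) \<longlonglongrightarrow> ?S" by (intro summable_LIMSEQ) auto
      then have "(\<lambda>n. ?S - (\<Sum>k<n. f (R k))) \<longlonglongrightarrow> ?S - ?S"
        using sfin by (intro tendsto_diff_ennreal tendsto_const) auto
      then have "(\<lambda>n. f X + (\<Sum>k. f (R (k + n)))) \<longlonglongrightarrow> f X + 0"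
        unfolding tail using sfin by (intro tendsto_add tendsto_const) auto
      then show ?thesis
        using bound by (intro LIMSEQ_le_const[of _ "f X"]) auto
    qed simp
    moreover have "f X \<le> f (X \<inter> F) + f (X - F)" for X
      using sub[of "X \<inter> F" "X - F"] by (metis Int_Diff_Un)
    ultimately show ?thesis by (simp add: lambda_system_eq[unfolded Pow_UNIV] order_antisym)
  qed
qed

section \<open>Hausdorff premeasures of fixed mesh and the outer measure they generate\<close>

lemma hausdorff_pre_mono: "A \<subseteq> B \<Longrightarrow> hausdorff_pre s \<delta> A \<le> hausdorff_pre s \<delta> B"
  unfolding hausdorff_pre_def by (intro INF_superset_mono) auto

lemma hausdorff_pre_antimono: "\<delta> \<le> \<epsilon> \<Longrightarrow> hausdorff_pre s \<epsilon> A \<le> hausdorff_pre s \<delta> A"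
  unfolding hausdorff_pre_def by (intro INF_superset_mono) (auto intro: order_trans)

lemma hausdorff_pre_le:
  assumes "A \<subseteq> (\<Union>i. C i)" "\<And>i. bounded (C i)" "\<And>i. diameter (C i) \<le> \<delta>"
  shows "hausdorff_pre s \<delta> A \<le>
    (\<Sum>i. ennreal (pi powr (s/2) / Gamma (s/2 + 1) * (diameter (C i) / 2) powr s))"
  unfolding hausdorff_pre_def by (rule INF_lower) (use assms in auto)

lemma hausdorff_pre_empty: "0 < \<delta> \<Longrightarrow> hausdorff_pre s \<delta> {} = 0"
  using hausdorff_pre_le[of "{}" "\<lambda>_. {}" \<delta> s] by (simp add: diameter_def)

lemma hausdorff_pre_UN:
  assumes "0 < \<delta>"
  shows "hausdorff_pre s \<delta> (\<Union>i. A i) \<le> (\<Sum>i::nat. hausdorff_pre s \<delta> (A i))"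
proof (rule ennreal_le_epsilon)
  fix e :: real assume fin: "(\<Sum>i. hausdorff_pre s \<delta> (A i)) < top" and e: "0 < e"
  let ?c = "\<lambda>C. ennreal (pi powr (s/2) / Gamma (s/2 + 1) * (diameter C / 2) powr s)"
  have "\<exists>C. A i \<subseteq> (\<Union>j::nat. C j) \<and> (\<forall>j. bounded (C j) \<and> diameter (C j) \<le> \<delta>) \<and>
      (\<Sum>j. ?c (C j)) \<le> hausdorff_pre s \<delta> (A i) + ennreal (e * (1/2)^Suc i)" for i
  proof -
    have "hausdorff_pre s \<delta> (A i) < top"
      using fin ennreal_suminf_lessD by blast
    then have "hausdorff_pre s \<delta> (A i) < hausdorff_pre s \<delta> (A i) + ennreal (e * (1/2)^Suc i)"
      using e by (simp add: ennreal_add_left_cancel_less[of _ 0, simplified])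
    then show ?thesis
      unfolding hausdorff_pre_def by (subst (asm) INF_less_iff) (force dest: less_imp_le)
  qed
  then obtain C where C: "\<And>i. A i \<subseteq> (\<Union>j::nat. C i j)" "\<And>i j. bounded (C i j)"
      "\<And>i j. diameter (C i j) \<le> \<delta>"
      "\<And>i. (\<Sum>j. ?c (C i j)) \<le> hausdorff_pre s \<delta> (A i) + ennreal (e * (1/2)^Suc i)"
    by metis
  define D where "D n = case_prod C (prod_decode n)" for n
  have "hausdorff_pre s \<delta> (\<Union>i. A i) \<le> (\<Sum>n. ?c (D n))"
  proof (rule hausdorff_pre_le)
    show "(\<Union>i. A i) \<subseteq> (\<Union>n. D n)"
    proof
      fix x assume "x \<in> (\<Union>i. A i)"
      then obtain i j where "x \<in> C i j" using C(1) by blast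
      then have "x \<in> D (prod_encode (i, j))" by (simp add: D_def)
      then show "x \<in> (\<Union>n. D n)" by blast
    qed
  qed (auto simp: D_def C split: prod.split)
  also have "(\<Sum>n. ?c (D n)) = (\<Sum>i. \<Sum>j. ?c (C i j))"
  proof -
    have "(\<Sum>n. (\<lambda>(i,j). ?c (C i j)) (prod_decode n)) = (\<Sum>i. \<Sum>j. ?c (C i j))"
      using suminf_ennreal_2dimen[of "\<lambda>i. \<Sum>j. ?c (C i j)" "\<lambda>(i,j). ?c (C i j)"]
      by (simp add: o_def)
    then show ?thesis by (simp add: D_def case_prod_beta)
  qed
  also have "\<dots> \<le> (\<Sum>i. hausdorff_pre s \<delta> (A i) + ennreal (e * (1/2)^Suc i))"
    by (intro suminf_le C) auto
  also have "\<dots> = (\<Sum>i. hausdorff_pre s \<delta> (A i)) + (\<Sum>i. ennreal (e * (1/2)^Suc i))"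
    by (intro suminf_add[symmetric]) auto
  also have "(\<Sum>i. ennreal (e * (1/2)^Suc i)) = ennreal e"
    using e sums_mult[OF power_half_series, of e] by (intro suminf_ennreal_eq) auto
  finally show "hausdorff_pre s \<delta> (\<Union>i. A i) \<le> (\<Sum>i. hausdorff_pre s \<delta> (A i)) + ennreal e" .
qed

text \<open>A covering set of diameter at most \<open>\<delta> < \<rho>\<close> cannot meet both
  sets, so a cover of the union splits into a cover of \<open>A\<close> and a cover of
  \<open>B\<close> without using any set twice.\<close>

lemma hausdorff_pre_separated:
  assumes "0 < s" "0 < \<rho>" and sep: "\<And>x y. x \<in> A \<Longrightarrow> y \<in> B \<Longrightarrow> \<rho> \<le> dist x y" and "\<delta> < \<rho>"
  shows "hausdorff_pre s \<delta> A + hausdorff_pre s \<delta> B \<le> hausdorff_pre s \<delta> (A \<union> B)"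
  unfolding hausdorff_pre_def[of s \<delta> "A \<union> B"]
proof (rule INF_greatest)
  let ?c = "\<lambda>C :: 'a set. ennreal (pi powr (s/2) / Gamma (s/2 + 1) * (diameter C / 2) powr s)"
  fix C assume "C \<in> {C :: nat \<Rightarrow> 'a set. A \<union> B \<subseteq> (\<Union>i. C i) \<and>
      (\<forall>i. bounded (C i) \<and> diameter (C i) \<le> \<delta>)}"
  then have C: "A \<union> B \<subseteq> (\<Union>i. C i)" "\<And>i. bounded (C i)" "\<And>i. diameter (C i) \<le> \<delta>" by auto
  \<comment> \<open>Covering sets of the wrong kind are replaced by the empty set to keep the
    indexing, and \<open>diameter {} = 0\<close> must not exceed \<delta>.\<close>
  have \<delta>0: "0 \<le> \<delta>" using C(3)[of 0] diameter_ge_0[OF C(2)[of 0]] by simp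
  define CA where "CA i = (if C i \<inter> A = {} then {} else C i)" for i
  define CB where "CB i = (if C i \<inter> B = {} then {} else C i)" for i
  have "hausdorff_pre s \<delta> A + hausdorff_pre s \<delta> B \<le> (\<Sum>i. ?c (CA i)) + (\<Sum>i. ?c (CB i))"
  proof (intro add_mono hausdorff_pre_le)
    show "A \<subseteq> (\<Union>i. CA i)" "B \<subseteq> (\<Union>i. CB i)"
      using C(1) unfolding CA_def CB_def by fastforce+
    show "bounded (CA i)" "bounded (CB i)" for i using C(2) by (auto simp: CA_def CB_def)
    show "diameter (CA i) \<le> \<delta>" "diameter (CB i) \<le> \<delta>" for i
      using C(3) \<delta>0 by (auto simp: CA_def CB_def)
  qed
  also have "\<dots> = (\<Sum>i. ?c (CA i) + ?c (CB i))" by (intro suminf_add) auto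
  also have "\<dots> \<le> (\<Sum>i. ?c (C i))"
  proof (intro suminf_le)
    fix i
    have "C i \<inter> A = {} \<or> C i \<inter> B = {}"
    proof (rule ccontr)
      assume "\<not> ?thesis"
      then obtain x y where "x \<in> C i" "x \<in> A" "y \<in> C i" "y \<in> B" by auto
      then show False
        using diameter_bounded_bound[OF C(2), of x i y] sep[of x y] C(3)[of i] \<open>\<delta> < \<rho>\<close> by auto
    qed
    then show "?c (CA i) + ?c (CB i) \<le> ?c (C i)"
      using \<open>0 < s\<close> by (auto simp: CA_def CB_def)
  qed auto
  finally show "hausdorff_pre s \<delta> A + hausdorff_pre s \<delta> B \<le> (\<Sum>i. ?c (C i))" .
qed

text \<open>The premeasure only grows as the mesh shrinks. Hence the two suprema may be taken along
  a common mesh, and this mesh may be assumed smaller than \<rho>.\<close>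

lemma hausdorff_outer_separated:
  assumes "0 < s" "0 < \<rho>" and sep: "\<And>x y. x \<in> A \<Longrightarrow> y \<in> B \<Longrightarrow> \<rho> \<le> dist x y"
  shows "hausdorff_outer s A + hausdorff_outer s B \<le> hausdorff_outer s (A \<union> B)"
proof -
  have "hausdorff_outer s A + hausdorff_outer s B
      = (SUP \<delta>\<in>{0<..}. hausdorff_pre s \<delta> A + hausdorff_pre s \<delta> B)"
    unfolding hausdorff_outer_def
  proof (rule SUP_add_directed_ennreal[symmetric])
    fix i j :: real assume "i \<in> {0<..}" "j \<in> {0<..}"
    then show "\<exists>k\<in>{0<..}. hausdorff_pre s i A + hausdorff_pre s j B \<le> hausdorff_pre s k A + hausdorff_pre s k B"
      by (intro bexI[of _ "min i j"] add_mono hausdorff_pre_antimono) auto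
  qed
  also have "\<dots> \<le> hausdorff_outer s (A \<union> B)"
  proof (rule SUP_least)
    fix \<delta> :: real assume "\<delta> \<in> {0<..}"
    let ?d = "min \<delta> (\<rho>/2)"
    have "hausdorff_pre s \<delta> A + hausdorff_pre s \<delta> B \<le> hausdorff_pre s ?d A + hausdorff_pre s ?d B"
      by (intro add_mono hausdorff_pre_antimono) auto
    also have "\<dots> \<le> hausdorff_pre s ?d (A \<union> B)"
      using assms by (intro hausdorff_pre_separated[of s \<rho>]) auto
    also have "\<dots> \<le> hausdorff_outer s (A \<union> B)"
      unfolding hausdorff_outer_def using \<open>\<delta> \<in> _\<close> \<open>0 < \<rho>\<close> by (intro SUP_upper) auto
    finally show "hausdorff_pre s \<delta> A + hausdorff_pre s \<delta> B \<le> hausdorff_outer s (A \<union> B)" .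
  qed
  finally show ?thesis .
qed

lemma outer_measure_space_hausdorff_outer:
  "outer_measure_space (Pow UNIV) (hausdorff_outer s :: 'a::metric_space set \<Rightarrow> ennreal)"
  unfolding outer_measure_space_def
proof (intro conjI)
  show "positive (Pow UNIV) (hausdorff_outer s :: 'a set \<Rightarrow> _)"
    by (simp add: positive_def hausdorff_outer_def hausdorff_pre_empty)
  show "increasing (Pow UNIV) (hausdorff_outer s :: 'a set \<Rightarrow> _)"
    unfolding increasing_def hausdorff_outer_def by (auto intro!: SUP_mono' hausdorff_pre_mono)
  show "countably_subadditive (Pow UNIV) (hausdorff_outer s :: 'a set \<Rightarrow> _)"
    unfolding countably_subadditive_def
  proof safe
    fix A :: "nat \<Rightarrow> 'a set"
    show "hausdorff_outer s (\<Union>i. A i) \<le> (\<Sum>i. hausdorff_outer s (A i))"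
      unfolding hausdorff_outer_def[of s "\<Union>i. A i"]
    proof (rule SUP_least)
      fix \<delta> :: real assume "\<delta> \<in> {0<..}"
      then have "hausdorff_pre s \<delta> (\<Union>i. A i) \<le> (\<Sum>i. hausdorff_pre s \<delta> (A i))"
        by (intro hausdorff_pre_UN) auto
      also have "\<dots> \<le> (\<Sum>i. hausdorff_outer s (A i))"
        unfolding hausdorff_outer_def using \<open>\<delta> \<in> _\<close> by (intro suminf_le SUP_upper) auto
      finally show "hausdorff_pre s \<delta> (\<Union>i. A i) \<le> (\<Sum>i. hausdorff_outer s (A i))" .
    qed
  qed
qed

lemma sets_hausdorff_measure [simp, measurable_cong]:
  "sets (hausdorff_measure s :: 'a::metric_space measure) = sets borel"
  using sets.sigma_sets_eq[of "borel :: 'a measure"] by (simp add: hausdorff_measure_def)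

text \<open>\<open>measure_of\<close> reproduces the given set function only if this is countably
  additive. Separated sets add up, so closed sets satisfy Caratheodory's condition, and the
  sigma-algebra of all sets with this property contains the Borel sets.\<close>

lemma emeasure_hausdorff_measure:
  fixes A :: "'a::metric_space set"
  assumes "0 < s" "A \<in> sets borel"
  shows "emeasure (hausdorff_measure s) A = hausdorff_outer s A"
proof -
  interpret P: sigma_algebra "UNIV :: 'a set" "Pow UNIV" by (rule sigma_algebra_Pow)
  let ?L = "lambda_system UNIV (Pow UNIV) (hausdorff_outer s :: 'a set \<Rightarrow> _)"
  have ms: "measure_space UNIV ?L (hausdorff_outer s)"
    by (rule P.caratheodory_lemma[OF outer_measure_space_hausdorff_outer])
  have cl: "F \<in> ?L" if "closed F" for F
    by (rule caratheodory_closed[OF outer_measure_space_hausdorff_outer _ that])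
       (rule hausdorff_outer_separated[OF assms(1)])
  have sa: "sigma_algebra UNIV ?L" using ms by (simp add: measure_space_def)
  have "sigma_sets UNIV (Collect closed) \<subseteq> ?L"
    using cl by (intro sigma_algebra.sigma_sets_subset[OF sa]) auto
  then have sub: "sets borel \<subseteq> ?L" by (simp add: borel_eq_closed)
  show ?thesis
    unfolding hausdorff_measure_def
  proof (rule emeasure_measure_of_sigma)
    show "sigma_algebra UNIV (sets (borel :: 'a measure))"
      using sets.sigma_algebra_axioms[of "borel :: 'a measure"] by simp
    show "positive (sets borel) (hausdorff_outer s :: 'a set \<Rightarrow> _)"
      using outer_measure_space_hausdorff_outer[where 'a='a]
      by (auto simp: outer_measure_space_def positive_def)
    show "countably_additive (sets borel) (hausdorff_outer s :: 'a set \<Rightarrow> _)"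
      using ms sub unfolding measure_space_def countably_additive_def by blast
  qed (use assms in auto)
qed

text \<open>The volume \<open>4 * h * (2 * r) ^ d\<close> of an enclosing box equals
  \<open>4 ^ Suc d * h * (r / 2) ^ d\<close>; the quotient cancels the normalising factor in
  \<open>hausdorff_pre\<close>, which is the volume of the unit ball in dimension
  \<open>d\<close>.\<close>

definition shadow_const :: "nat \<Rightarrow> real" where
  "shadow_const d = 4 ^ Suc d * (Gamma (real d/2 + 1) / pi powr (real d/2))"

text \<open>The constant is far from sharp: only the comparison of Lebesgue measure with Hausdorff
  measure matters, so every covering set is simply replaced by a box.\<close>

lemma emeasure_shadow_le_hausdorff_outer:
  fixes A T :: "'a::euclidean_space set" and b :: 'a
  assumes b: "b \<in> Basis" and d: "DIM('a) = Suc d" "0 < d" and h: "0 < h"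
    and \<sigma>: "\<bar>\<sigma>\<bar> = 1" and T: "T \<in> sets borel"
    and shadow: "\<And>y. y \<in> T \<Longrightarrow> \<exists>s\<in>{0..h}. y + (s * \<sigma>) *\<^sub>R b \<in> A"
  shows "emeasure lborel T \<le>
    ennreal (shadow_const d * h) * hausdorff_outer (real d) A"
proof -
  let ?g = "pi powr (real d/2) / Gamma (real d/2 + 1)"
  define K where "K = shadow_const d * h"
  let ?c = "\<lambda>C :: 'a set. ennreal (?g * (diameter C / 2) powr real d)"
  have Gp: "Gamma (real d/2 + 1) > 0" by (rule Gamma_real_pos) auto
  then have Kp: "0 < K" using h by (simp add: K_def shadow_const_def)
  have "emeasure lborel T \<le> ennreal K * hausdorff_pre (real d) h A"
  proof -
    have "ennreal (1 / K) * emeasure lborel T \<le> hausdorff_pre (real d) h A"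
      unfolding hausdorff_pre_def
    proof (rule INF_greatest)
      fix C assume "C \<in> {C :: nat \<Rightarrow> 'a set. A \<subseteq> (\<Union>i. C i) \<and>
          (\<forall>i. bounded (C i) \<and> diameter (C i) \<le> h)}"
      then have C: "A \<subseteq> (\<Union>i. C i)" "\<And>i. bounded (C i)" "\<And>i. diameter (C i) \<le> h" by auto
      have "\<exists>B\<in>sets borel. (\<forall>y s. s \<in> {0..h} \<longrightarrow> y + (s * \<sigma>) *\<^sub>R b \<in> C i \<longrightarrow> y \<in> B) \<and>
              emeasure lborel B \<le> ennreal K * ?c (C i)" for i
      proof (cases "C i = {}")
        case True then show ?thesis by (intro bexI[of _ "{}"]) auto
      next
        case False
        then obtain z where z: "z \<in> C i" by auto
        define r where "r = diameter (C i)"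
        have r: "0 \<le> r" "r \<le> h" using C(3)[of i] diameter_ge_0[OF C(2)[of i]] by (auto simp: r_def)
        \<comment> \<open>Transversally to \<open>b\<close> the diameter \<open>r\<close> of the
          covering set is enough as half-width. Along \<open>b\<close> a displacement of length at
          most \<open>h\<close> is added to \<open>r \<le> h\<close>, whence \<open>2 * h\<close>;
          this is why covers of mesh \<open>h\<close> are used.\<close>
        define w where "w = (\<Sum>e\<in>Basis. (if e = b then 2 * h else r) *\<^sub>R e :: 'a)"
        have we: "w \<bullet> e = (if e = b then 2 * h else r)" if "e \<in> Basis" for e
          using that by (simp add: w_def)
        let ?B = "cbox (z - w) (z + w)"
        have "y \<in> ?B" if s: "s \<in> {0..h}" and y: "y + (s * \<sigma>) *\<^sub>R b \<in> C i" for y s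
        proof -
          have le: "\<bar>(y + (s * \<sigma>) *\<^sub>R b - z) \<bullet> e\<bar> \<le> r" if "e \<in> Basis" for e
            using Basis_le_norm[OF that, of "y + (s * \<sigma>) *\<^sub>R b - z"]
              diameter_bounded_bound[OF C(2) y z] by (simp add: r_def dist_norm)
          have "\<bar>(y - z) \<bullet> e\<bar> \<le> w \<bullet> e" if e: "e \<in> Basis" for e
          proof (cases "e = b")
            case True
            have "\<bar>s * \<sigma>\<bar> \<le> h" using s \<sigma> by (simp add: abs_mult)
            then show ?thesis using le[OF b] True r b we[OF b]
              by (simp add: inner_diff_left inner_add_left)
          next
            case False
            then show ?thesis using le[OF e] we[OF e] b e
              by (simp add: inner_diff_left inner_add_left inner_Basis)
          qed
          then show ?thesis
            unfolding mem_box by (auto simp: inner_diff_left inner_add_left abs_le_iff algebra_simps)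
        qed
        moreover have "emeasure lborel ?B \<le> ennreal K * ?c (C i)"
        proof -
          have "emeasure lborel ?B = ennreal (\<Prod>e\<in>Basis. (z + w - (z - w)) \<bullet> e)"
            using r h we by (subst emeasure_lborel_cbox_eq) (auto simp: inner_diff_left inner_add_left)
          also have "(\<Prod>e\<in>Basis. (z + w - (z - w)) \<bullet> e) = (\<Prod>e\<in>Basis. (if e = b then 4 * h else 2 * r))"
            by (intro prod.cong) (auto simp: inner_diff_left inner_add_left we)
          also have "\<dots> = 4 * h * (\<Prod>e\<in>Basis - {b}. 2 * r)"
            using b by (subst prod.remove[of _ b]) (auto intro!: prod.cong)
          also have "\<dots> = 4 * h * (2 * r) ^ d" using b d by (simp add: card_Diff_singleton)
          also have "\<dots> = K * (?g * (r / 2) ^ d)"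
          proof -
            have "4 * h * (2 * r) ^ d = 4 ^ Suc d * (G / p) * h * (p / G * (r / 2) ^ d)"
              if "G > 0" "p > 0" for G p :: real
              using that power_mult_distrib[of "2::real" 2 d] by (simp add: power_mult_distrib power_divide)
            moreover have "0 < pi powr (real d/2)" by simp
            ultimately show ?thesis unfolding K_def shadow_const_def using Gp by blast
          qed
          \<comment> \<open>For \<open>r = 0\<close> both sides are 0 because
            \<open>0 < d\<close>.\<close>
          also have "(r / 2) ^ d = (r / 2) powr real d"
            using r d(2) by (cases "r = 0") (auto simp: powr_realpow)
          also have "ennreal (K * (?g * (r / 2) powr real d)) = ennreal K * ennreal (?g * (r / 2) powr real d)"
            by (rule ennreal_mult) (use Kp Gp in auto)
          finally show ?thesis unfolding r_def by (rule eq_refl)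
        qed
        ultimately show ?thesis by (intro bexI[of _ ?B]) auto
      qed
      then obtain B where B: "\<And>i. B i \<in> sets borel"
          "\<And>i y s. s \<in> {0..h} \<Longrightarrow> y + (s * \<sigma>) *\<^sub>R b \<in> C i \<Longrightarrow> y \<in> B i"
          "\<And>i. emeasure lborel (B i) \<le> ennreal K * ?c (C i)"
        by metis
      have "T \<subseteq> (\<Union>i. B i)"
      proof
        fix y assume "y \<in> T"
        then obtain s where s: "s \<in> {0..h}" "y + (s * \<sigma>) *\<^sub>R b \<in> A" using shadow by blast
        then obtain i where "y + (s * \<sigma>) *\<^sub>R b \<in> C i" using C(1) by blast
        then show "y \<in> (\<Union>i. B i)" using B(2) s by blast
      qed
      then have "emeasure lborel T \<le> emeasure lborel (\<Union>i. B i)"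
        using B(1) by (intro emeasure_mono) auto
      also have "\<dots> \<le> (\<Sum>i. emeasure lborel (B i))"
        using B(1) by (intro emeasure_subadditive_countably) auto
      also have "\<dots> \<le> (\<Sum>i. ennreal K * ?c (C i))" by (intro suminf_le B) auto
      also have "\<dots> = ennreal K * (\<Sum>i. ?c (C i))" by (rule ennreal_suminf_cmult)
      finally have "ennreal (1 / K) * emeasure lborel T \<le> ennreal (1 / K) * (ennreal K * (\<Sum>i. ?c (C i)))"
        by (rule mult_left_mono) auto
      also have "\<dots> = (\<Sum>i. ?c (C i))"
        using Kp by (simp add: mult.assoc[symmetric] flip: ennreal_mult)
      finally show "ennreal (1 / K) * emeasure lborel T \<le> (\<Sum>i. ?c (C i))" .
    qed
    then have "ennreal K * (ennreal (1 / K) * emeasure lborel T) \<le> ennreal K * hausdorff_pre (real d) h A"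
      by (rule mult_left_mono) auto
    then show ?thesis using Kp by (simp add: mult.assoc[symmetric] flip: ennreal_mult)
  qed
  also have "hausdorff_pre (real d) h A \<le> hausdorff_outer (real d) A"
    unfolding hausdorff_outer_def using h by (intro SUP_upper) auto
  finally show ?thesis by (simp add: mult_left_mono K_def)
qed

section \<open>Smooth functions and cutoffs\<close>

lemma iter_partial_Nil [simp]: "iter_partial [] f = f"
  by (simp add: iter_partial_def)

lemma iter_partial_Cons [simp]: "iter_partial (v # vs) f = partial v (iter_partial vs f)"
  by (simp add: iter_partial_def)

lemma iter_partial_snoc: "iter_partial (vs @ [v]) f = iter_partial vs (partial v f)"
  by (simp add: iter_partial_def)

text \<open>The definition of \<open>smooth\<close> speaks of all iterated partial derivatives,
  which rarely have usable closed forms. It suffices to exhibit a set of continuous functions that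
  is stable under partial derivatives; the iterates themselves stay implicit.\<close>

lemma smooth_coinduct:
  assumes "f \<in> F"
    and "\<And>f. f \<in> F \<Longrightarrow> continuous_on UNIV f"
    and "\<And>f v. f \<in> F \<Longrightarrow> v \<in> Basis \<Longrightarrow>
          \<exists>g\<in>F. \<forall>x. ((\<lambda>h. f (x + h *\<^sub>R v)) has_real_derivative g x) (at 0)"
  shows "smooth f"
proof -
  have part: "partial v f \<in> F" if "f \<in> F" "v \<in> Basis" for f v
  proof -
    obtain g where g: "g \<in> F" "\<And>x. ((\<lambda>h. f (x + h *\<^sub>R v)) has_real_derivative g x) (at 0)"
      using assms(3) \<open>f \<in> F\<close> \<open>v \<in> Basis\<close> by blast
    then have "partial v f = g" by (auto simp: partial_def fun_eq_iff intro: DERIV_imp_deriv)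
    with g show ?thesis by simp
  qed
  have "iter_partial vs f \<in> F" if "set vs \<subseteq> Basis" for vs
    using that by (induction vs) (auto intro: part \<open>f \<in> F\<close>)
  then show ?thesis
    unfolding smooth_def using assms(2,3) real_differentiable_def by blast
qed

lemma smooth_continuous_on: "smooth f \<Longrightarrow> continuous_on S f"
  unfolding smooth_def by (metis continuous_on_subset empty_subsetI iter_partial_Nil list.set(1) top_greatest)

lemma smooth_has_partial:
  assumes "smooth f" "v \<in> Basis"
  shows "((\<lambda>h. f (x + h *\<^sub>R v)) has_real_derivative partial v f x) (at 0)"
proof -
  have "(\<lambda>h. iter_partial [] f (x + h *\<^sub>R v)) differentiable (at 0)"
    using assms unfolding smooth_def by (metis empty_subsetI list.set(1))
  then show ?thesis
    unfolding partial_def by (simp add: DERIV_deriv_iff_real_differentiable)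
qed

lemma smooth_partial:
  assumes "smooth f" "v \<in> Basis"
  shows "smooth (partial v f)"
  unfolding smooth_def
proof (intro allI impI)
  fix vs :: "'a list" assume "set vs \<subseteq> Basis"
  then have "set (vs @ [v]) \<subseteq> Basis" using assms by auto
  with assms(1) show "continuous_on UNIV (iter_partial vs (partial v f)) \<and>
      (\<forall>x. \<forall>u\<in>Basis. (\<lambda>h. iter_partial vs (partial v f) (x + h *\<^sub>R u)) differentiable at 0)"
    unfolding smooth_def iter_partial_snoc[symmetric] by blast
qed

lemma partial_eqI:
  assumes "((\<lambda>h. f (x + h *\<^sub>R v)) has_real_derivative d) (at 0)"
  shows "partial v f x = d"
  using assms by (simp add: partial_def DERIV_imp_deriv)

text \<open>Closing under all operations at once keeps every derivative rule inside the set: a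
  product differentiates to a sum of products, a composition to a product with another composition.
  One induction thus verifies the hypotheses of \<open>smooth_coinduct\<close> for all of
  them.\<close>

inductive_set smooth_gen :: "('a::euclidean_space \<Rightarrow> real) set" where
  base: "smooth f \<Longrightarrow> f \<in> smooth_gen"
| add: "f \<in> smooth_gen \<Longrightarrow> g \<in> smooth_gen \<Longrightarrow> (\<lambda>x. f x + g x) \<in> smooth_gen"
| mult: "f \<in> smooth_gen \<Longrightarrow> g \<in> smooth_gen \<Longrightarrow> (\<lambda>x. f x * g x) \<in> smooth_gen"
| const: "(\<lambda>_. c) \<in> smooth_gen"
| inner: "(\<lambda>x. x \<bullet> a) \<in> smooth_gen"
| comp: "smooth h \<Longrightarrow> f \<in> smooth_gen \<Longrightarrow> (\<lambda>x. h (f x)) \<in> smooth_gen"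
| inverse: "f \<in> smooth_gen \<Longrightarrow> (\<And>x. f x \<noteq> 0) \<Longrightarrow> (\<lambda>x. inverse (f x)) \<in> smooth_gen"

lemma smooth_real_has_derivative:
  assumes "smooth (h :: real \<Rightarrow> real)"
  shows "(h has_real_derivative partial 1 h y) (at y)"
proof -
  have "((\<lambda>s. h (s + y)) has_real_derivative partial 1 h y) (at 0)"
    using smooth_has_partial[OF assms, of 1 y] by (simp add: add.commute)
  then show ?thesis using DERIV_shift[of h _ 0 y] by simp
qed

lemma smooth_gen_continuous_on: "f \<in> smooth_gen \<Longrightarrow> continuous_on UNIV f"
proof (induction rule: smooth_gen.induct)
  case (comp h f)
  then show ?case
    using continuous_on_compose2[OF smooth_continuous_on[OF comp.hyps(1), of UNIV]] by blast
next
  case (base f)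
  then show ?case by (rule smooth_continuous_on)
next
  case (inverse f)
  then show ?case by (intro continuous_on_inverse) auto
qed (intro continuous_intros; assumption)+

lemma smooth_gen_deriv:
  assumes "f \<in> smooth_gen" and v: "v \<in> Basis"
  shows "\<exists>g\<in>smooth_gen. \<forall>x. ((\<lambda>h. f (x + h *\<^sub>R v)) has_real_derivative g x) (at 0)"
  using assms(1)
proof (induction rule: smooth_gen.induct)
  case (base f)
  then show ?case
    by (intro bexI[of _ "partial v f"] allI smooth_has_partial smooth_gen.base smooth_partial v)
next
  case (add f g)
  then obtain f' g' where *: "f' \<in> smooth_gen" "g' \<in> smooth_gen"
    "\<And>x. ((\<lambda>h. f (x + h *\<^sub>R v)) has_real_derivative f' x) (at 0)"
    "\<And>x. ((\<lambda>h. g (x + h *\<^sub>R v)) has_real_derivative g' x) (at 0)" by blast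
  show ?case
    by (intro bexI[of _ "\<lambda>x. f' x + g' x"] allI DERIV_add smooth_gen.add *)
next
  case (mult f g)
  then obtain f' g' where *: "f' \<in> smooth_gen" "g' \<in> smooth_gen"
    "\<And>x. ((\<lambda>h. f (x + h *\<^sub>R v)) has_real_derivative f' x) (at 0)"
    "\<And>x. ((\<lambda>h. g (x + h *\<^sub>R v)) has_real_derivative g' x) (at 0)" by blast
  show ?case
  proof (intro bexI allI)
    fix x show "((\<lambda>h. f (x + h *\<^sub>R v) * g (x + h *\<^sub>R v)) has_real_derivative
        f' x * g x + g' x * f x) (at 0)"
      using DERIV_mult[OF *(3,4)[of x]] by simp
    show "(\<lambda>x. f' x * g x + g' x * f x) \<in> smooth_gen"
      using * mult.hyps by (intro smooth_gen.add smooth_gen.mult)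
  qed
next
  case (const c)
  show ?case by (rule bexI[OF _ smooth_gen.const[of 0]]) simp
next
  case (inner a)
  show ?case
    by (rule bexI[OF _ smooth_gen.const[of "v \<bullet> a"]])
       (auto simp: inner_add_left intro!: derivative_eq_intros)
next
  case (comp h f)
  then obtain f' where *: "f' \<in> smooth_gen"
    "\<And>x. ((\<lambda>h. f (x + h *\<^sub>R v)) has_real_derivative f' x) (at 0)" by blast
  show ?case
  proof (intro bexI allI)
    fix x show "((\<lambda>s. h (f (x + s *\<^sub>R v))) has_real_derivative partial 1 h (f x) * f' x) (at 0)"
      by (rule DERIV_chain2[where g = "\<lambda>s. f (x + s *\<^sub>R v)", OF _ *(2)])
         (simp add: smooth_real_has_derivative comp.hyps)
    show "(\<lambda>x. partial 1 h (f x) * f' x) \<in> smooth_gen"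
      by (rule smooth_gen.mult[OF smooth_gen.comp[OF smooth_partial[OF comp.hyps(1)] comp.hyps(2)] *(1)])
         simp
  qed
next
  case (inverse f)
  then obtain f' where *: "f' \<in> smooth_gen"
    "\<And>x. ((\<lambda>h. f (x + h *\<^sub>R v)) has_real_derivative f' x) (at 0)" by blast
  show ?case
  proof (intro bexI allI)
    fix x show "((\<lambda>s. inverse (f (x + s *\<^sub>R v))) has_real_derivative
        (-1) * (inverse (f x) * f' x * inverse (f x))) (at 0)"
      using DERIV_inverse'[OF *(2)[of x]] inverse.hyps(2)[of x] by simp
    show "(\<lambda>x. (-1) * (inverse (f x) * f' x * inverse (f x))) \<in> smooth_gen"
      using smooth_gen.mult[OF smooth_gen.const[of "-1"] smooth_gen.mult[OF smooth_gen.mult[OF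
            smooth_gen.inverse[OF inverse.hyps] *(1)] smooth_gen.inverse[OF inverse.hyps]]] .
  qed
qed

lemma smooth_gen_smooth: "f \<in> smooth_gen \<Longrightarrow> smooth f"
  by (rule smooth_coinduct[of f smooth_gen]) (auto intro: smooth_gen_continuous_on smooth_gen_deriv)

lemma smooth_add: "smooth f \<Longrightarrow> smooth g \<Longrightarrow> smooth (\<lambda>x. f x + g x)"
  and smooth_mult: "smooth f \<Longrightarrow> smooth g \<Longrightarrow> smooth (\<lambda>x. f x * g x)"
  and smooth_const: "smooth (\<lambda>_. c)"
  and smooth_inner: "smooth (\<lambda>x. x \<bullet> a)"
  and smooth_compose: "smooth h \<Longrightarrow> smooth f \<Longrightarrow> smooth (\<lambda>x. h (f x))"
  and smooth_inverse: "smooth f \<Longrightarrow> (\<And>x. f x \<noteq> 0) \<Longrightarrow> smooth (\<lambda>x. inverse (f x))"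
      apply (rule smooth_gen_smooth, rule smooth_gen.add; rule smooth_gen.base; assumption)
     apply (rule smooth_gen_smooth, rule smooth_gen.mult; rule smooth_gen.base; assumption)
    apply (rule smooth_gen_smooth, rule smooth_gen.const)
   apply (rule smooth_gen_smooth, rule smooth_gen.inner)
  apply (rule smooth_gen_smooth, rule smooth_gen.comp, assumption, rule smooth_gen.base, assumption)
  apply (rule smooth_gen_smooth, rule smooth_gen.inverse, rule smooth_gen.base, assumption, assumption)
  done

lemma smooth_diff: "smooth f \<Longrightarrow> smooth g \<Longrightarrow> smooth (\<lambda>x. f x - g x)"
  using smooth_add[of f "\<lambda>x. (-1) * g x"] smooth_mult[of "\<lambda>_. -1" g] by (simp add: smooth_const)

lemma smooth_sum: "(\<And>i. i \<in> I \<Longrightarrow> smooth (f i)) \<Longrightarrow> smooth (\<lambda>x. \<Sum>i\<in>I. f i x)"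
  by (induction I rule: infinite_finite_induct) (auto intro: smooth_add smooth_const)

lemma smooth_prod: "(\<And>i. i \<in> I \<Longrightarrow> smooth (f i)) \<Longrightarrow> smooth (\<lambda>x. \<Prod>i\<in>I. f i x)"
  by (induction I rule: infinite_finite_induct) (auto intro: smooth_mult smooth_const)

lemma smooth_power: "smooth f \<Longrightarrow> smooth (\<lambda>x. f x ^ n)"
  by (induction n) (auto intro: smooth_mult smooth_const)

lemma smooth_ident: "smooth (\<lambda>x :: real. x)"
  using smooth_inner[of "1::real"] by simp

lemma partial_mult:
  assumes "smooth f" "smooth g" "v \<in> Basis"
  shows "partial v (\<lambda>x. f x * g x) x = partial v f x * g x + f x * partial v g x"
  by (rule partial_eqI)
     (use DERIV_mult[OF smooth_has_partial[OF assms(1,3)] smooth_has_partial[OF assms(2,3)], of x]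
      in \<open>simp add: algebra_simps\<close>)

lemma partial_compose:
  assumes "smooth h" "smooth f" "v \<in> Basis"
  shows "partial v (\<lambda>x. h (f x)) x = partial 1 h (f x) * partial v f x"
  by (rule partial_eqI, rule DERIV_chain2[where g = "\<lambda>s. f (x + s *\<^sub>R v)"])
     (simp_all add: smooth_has_partial smooth_real_has_derivative assms)

lemma smooth_has_partial_at:
  assumes "smooth f" "v \<in> Basis"
  shows "((\<lambda>h. f (x + h *\<^sub>R v)) has_real_derivative partial v f (x + s *\<^sub>R v)) (at s)"
  using smooth_has_partial[OF assms, of "x + s *\<^sub>R v"] DERIV_shift[of "\<lambda>h. f (x + h *\<^sub>R v)" _ 0 s]
  by (simp add: algebra_simps)

lemma bounded_partial_of_compact_support:
  assumes f: "smooth f" and v: "v \<in> Basis" and "compact K" and "\<And>x. x \<notin> K \<Longrightarrow> partial v f x = 0"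
  shows "\<exists>B>0. \<forall>x. \<bar>partial v f x\<bar> \<le> B"
proof -
  have "bounded (partial v f ` K)"
    by (intro compact_imp_bounded compact_continuous_image \<open>compact K\<close>
        smooth_continuous_on smooth_partial f v)
  then obtain B where "B > 0" "\<forall>x\<in>K. \<bar>partial v f x\<bar> \<le> B"
    unfolding bounded_pos by auto
  then show ?thesis using assms(4) by (metis abs_zero less_imp_le)
qed

section \<open>The flat function \<open>exp (- 1 / x)\<close> and a smooth transition from 0 to
  1\<close>

definition expinv :: "real \<Rightarrow> real" where
  "expinv x = (if 0 < x then exp (- 1 / x) else 0)"

lemma expinv_pos: "0 < x \<Longrightarrow> 0 < expinv x" and expinv_nonneg: "0 \<le> expinv x"
  and expinv_zero: "x \<le> 0 \<Longrightarrow> expinv x = 0"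
  by (auto simp: expinv_def)

text \<open>Differentiation maps these functions to combinations of functions of the same kind, so
  this one formula yields all derivatives of \<open>expinv\<close>. It holds at 0 too: the right
  side vanishes since \<open>expinv 0 = 0\<close>, and the difference quotient from the right tends
  to 0 because \<open>y ^ Suc n / exp y\<close> does as \<open>y\<close> tends to infinity.\<close>

lemma expinv_power_deriv:
  "((\<lambda>x. (1/x)^n * expinv x) has_real_derivative
     (1/x)^(n+2) * expinv x - real n * ((1/x)^(n+1) * expinv x)) (at x)"
proof (cases x "0::real" rule: linorder_cases)
  case less
  have "\<forall>\<^sub>F y in nhds x. (1/y)^n * expinv y = 0"
    using eventually_nhds_in_open[of "{..<0}" x] less
    by (auto elim!: eventually_mono simp: expinv_def)
  from DERIV_cong_ev[OF refl this refl, of 0] show ?thesis using less by (simp add: expinv_zero)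
next
  case greater
  have "\<forall>\<^sub>F y in nhds x. (1/y)^n * expinv y = (1/y)^n * exp (- 1/y)"
    using eventually_nhds_in_open[of "{0<..}" x] greater
    by (auto elim!: eventually_mono simp: expinv_def)
  moreover have "((\<lambda>y. (1/y)^n * exp (- 1/y)) has_real_derivative
     (1/x)^(n+2) * exp (-1/x) - real n * ((1/x)^(n+1) * exp (-1/x))) (at x)"
  proof -
    have d: "((\<lambda>y. 1/y) has_real_derivative - ((1/x)^2)) (at x)"
      using greater by (auto intro!: derivative_eq_intros simp: power2_eq_square field_simps)
    have "((\<lambda>y. (1/y)^n * exp (- (1/y))) has_real_derivative
      (real n * (1/x)^(n-1) * - ((1/x)^2)) * exp (-(1/x)) + (exp (-(1/x)) * (- (- ((1/x)^2)))) * (1/x)^n) (at x)"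
      using DERIV_mult[OF DERIV_power[OF d, of n] DERIV_fun_exp[OF DERIV_minus[OF d]]]
      by (simp add: mult_ac)
    moreover have "(real n * (1/x)^(n-1) * - ((1/x)^2)) * exp (-(1/x)) + (exp (-(1/x)) * (- (- ((1/x)^2)))) * (1/x)^n
       = (1/x)^(n+2) * exp (-1/x) - real n * ((1/x)^(n+1) * exp (-1/x))"
      by (cases n) (simp_all add: algebra_simps add_divide_distrib power2_eq_square)
    ultimately show ?thesis by simp
  qed
  ultimately show ?thesis using greater
    by (subst DERIV_cong_ev[OF refl _ refl]) (auto simp: expinv_def)
next
  case equal
  have "((\<lambda>h. (1/h)^n * expinv h / h) \<longlongrightarrow> 0) (at_right 0)"
  proof -
    have "((\<lambda>y::real. y^Suc n / exp y) \<longlongrightarrow> 0) at_top" by (rule tendsto_power_div_exp_0)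
    then have "((\<lambda>h. (inverse h)^Suc n / exp (inverse h)) \<longlongrightarrow> (0::real)) (at_right 0)"
      by (rule filterlim_compose[OF _ filterlim_inverse_at_top_right])
    moreover have "\<forall>\<^sub>F h in at_right 0. (inverse h)^Suc n / exp (inverse h) = (1/h)^n * expinv h / h"
      using eventually_at_right_less[of "0::real"]
      by eventually_elim (simp add: expinv_def exp_minus field_simps)
    ultimately show ?thesis by (simp cong: tendsto_cong)
  qed
  moreover have "((\<lambda>h. (1/h)^n * expinv h / h) \<longlongrightarrow> 0) (at_left 0)"
    by (rule tendsto_eventually)
       (auto simp: eventually_at_left_field expinv_def intro!: exI[of _ "-1"])
  ultimately have "((\<lambda>h. (1/h)^n * expinv h / h) \<longlongrightarrow> 0) (at 0)"
    by (simp add: filterlim_split_at)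
  then have "((\<lambda>x. (1/x)^n * expinv x) has_real_derivative
     (1/0)^(n+2) * expinv 0 - real n * ((1/0)^(n+1) * expinv 0)) (at 0)"
    by (simp add: DERIV_def expinv_zero)
  then show ?thesis unfolding equal .
qed

lemma smooth_expinv: "smooth expinv"
proof -
  let ?F = "{\<lambda>x. \<Sum>k<m. a k * ((1/x)^k * expinv x) | m (a :: nat \<Rightarrow> real). True}"
  have der: "((\<lambda>x. \<Sum>k<m. a k * ((1/x)^k * expinv x)) has_real_derivative
      (\<Sum>k<m. a k * ((1/x)^(k+2) * expinv x - real k * ((1/x)^(k+1) * expinv x)))) (at x)" for m a x
    by (intro DERIV_sum DERIV_cmult expinv_power_deriv)
  show ?thesis
  proof (rule smooth_coinduct[of _ ?F])
    show "expinv \<in> ?F"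
      by (intro CollectI exI[of _ 1] exI[of _ "\<lambda>_. 1"]) auto
    fix f assume "f \<in> ?F"
    then obtain m a where f: "f = (\<lambda>x. \<Sum>k<m. a k * ((1/x)^k * expinv x))" by auto
    show "continuous_on UNIV f"
      unfolding f by (intro DERIV_continuous_on[OF DERIV_subset[OF der]]) auto
    \<comment> \<open>The term with \<open>a k\<close> feeds degree \<open>k + 2\<close> with factor
      1 and degree \<open>k + 1\<close> with factor \<open>- real k\<close>; re-indexing gives
      \<open>a (k - 2)\<close> and \<open>real (k - 1) * a (k - 1)\<close>. The second contribution
      ends one index earlier, which the guard \<open>k < m + 1\<close> encodes.\<close>
    define b where "b k = (if 2 \<le> k then a (k-2) else 0) * of_bool (k < m+2)
        - (if 1 \<le> k then real (k-1) * a (k-1) else 0) * of_bool (k < m+1)" for k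
    have b: "(\<Sum>k<m+2. b k * ((1/x)^k * expinv x)) =
        (\<Sum>k<m. a k * ((1/x)^(k+2) * expinv x - real k * ((1/x)^(k+1) * expinv x)))" for x
    proof -
      have "(\<Sum>k<m+2. b k * ((1/x)^k * expinv x)) =
         (\<Sum>k<m+2. (if 2 \<le> k then a (k-2) else 0) * ((1/x)^k * expinv x)) -
         (\<Sum>k<Suc (m+1). (if 1 \<le> k then real (k-1) * a (k-1) else 0) * of_bool (k < m+1) * ((1/x)^k * expinv x))"
        unfolding sum_subtractf[symmetric] b_def
        by (simp add: left_diff_distrib sum_subtractf)
      also have "(\<Sum>k<m+2. (if 2 \<le> k then a (k-2) else 0) * ((1/x)^k * expinv x)) =
          (\<Sum>k<m. a k * ((1/x)^(k+2) * expinv x))"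
        by (simp add: sum.lessThan_Suc_shift numeral_2_eq_2 del: sum.lessThan_Suc)
      also have "(\<Sum>k<Suc (m+1). (if 1 \<le> k then real (k-1) * a (k-1) else 0) * of_bool (k < m+1) * ((1/x)^k * expinv x)) =
          (\<Sum>k<m. real k * a k * ((1/x)^(k+1) * expinv x))"
        by (subst sum.lessThan_Suc_shift) (simp add: mult_ac)
      finally show ?thesis by (simp add: sum_subtractf right_diff_distrib mult_ac)
    qed
    fix v :: real assume "v \<in> Basis"
    show "\<exists>g\<in>?F. \<forall>x. ((\<lambda>h. f (x + h *\<^sub>R v)) has_real_derivative g x) (at 0)"
    proof (intro bexI allI)
      fix x
      have "((\<lambda>h. f (h + x)) has_real_derivative (\<Sum>k<m+2. b k * ((1/x)^k * expinv x))) (at 0)"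
        using der[where m=m and a=a and x=x] unfolding b f[symmetric] using DERIV_shift[of f _ 0 x] by simp
      then show "((\<lambda>h. f (x + h *\<^sub>R v)) has_real_derivative (\<Sum>k<m+2. b k * ((1/x)^k * expinv x))) (at 0)"
        using \<open>v \<in> Basis\<close> by (simp add: add.commute)
    qed blast
  qed
qed

text \<open>The usual smooth transition. The denominator is positive because \<open>x\<close> and
  \<open>1 - x\<close> are never both nonpositive; the form with \<open>inverse\<close> matches the
  closure rule for smooth functions.\<close>

definition smooth_step :: "real \<Rightarrow> real" where
  "smooth_step x = expinv x * inverse (expinv x + expinv (1 - x))"

lemma smooth_step_denom: "0 < expinv x + expinv (1 - x)"
  using expinv_pos[of x] expinv_pos[of "1 - x"] expinv_nonneg[of x] expinv_nonneg[of "1 - x"]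
  by (cases "0 < x") auto

lemma smooth_smooth_step: "smooth smooth_step"
proof -
  have "smooth (\<lambda>x. expinv x * inverse (expinv x + expinv (1 - x)))"
    using smooth_step_denom
    by (intro smooth_mult smooth_inverse smooth_add smooth_expinv smooth_compose[of expinv]
        smooth_diff smooth_const smooth_ident) (simp add: less_imp_neq[symmetric])
  then show ?thesis by (simp add: smooth_step_def[abs_def])
qed

lemma smooth_step_nonneg: "0 \<le> smooth_step x" and smooth_step_le_1: "smooth_step x \<le> 1"
  and smooth_step_zero: "x \<le> 0 \<Longrightarrow> smooth_step x = 0" and smooth_step_one: "1 \<le> x \<Longrightarrow> smooth_step x = 1"
  using smooth_step_denom[of x] expinv_nonneg[of x] expinv_nonneg[of "1-x"] expinv_pos[of x]
  by (auto simp: smooth_step_def divide_simps expinv_zero simp flip: divide_inverse)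

lemma partial_smooth_step_outside:
  assumes x: "x \<notin> {0..1}"
  shows "partial 1 smooth_step x = 0"
proof -
  let ?c = "if x < 0 then 0 else 1 :: real"
  have "\<forall>\<^sub>F y in nhds x. smooth_step y = ?c"
    using eventually_nhds_in_open[of "if x < 0 then {..<0} else {1<..}" x] x
    by (auto elim!: eventually_mono simp: smooth_step_zero smooth_step_one split: if_splits)
  then have "(smooth_step has_real_derivative 0) (at x)"
    by (subst DERIV_cong_ev[OF refl _ refl]) auto
  then show ?thesis
    using smooth_real_has_derivative[OF smooth_smooth_step] DERIV_unique by blast
qed

lemma bounded_partial_smooth_step: "\<exists>B>0. \<forall>x. \<bar>partial 1 smooth_step x\<bar> \<le> B"
  by (rule bounded_partial_of_compact_support[OF smooth_smooth_step, of _ "{0..1}"])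
     (auto simp: partial_smooth_step_outside)

section \<open>Test functions\<close>

text \<open>In each coordinate a product of two steps of steepness \<open>n\<close> vanishes outside
  the open interval and is eventually 1 at each of its points. Lying below the indicator, these
  bumps permit dominated convergence to integrals over open boxes.\<close>

lemma box_bump:
  fixes a b :: "'a::euclidean_space"
  obtains \<beta> :: "nat \<Rightarrow> 'a \<Rightarrow> real"
  where "\<And>n. smooth (\<beta> n)" "\<And>n x. 0 \<le> \<beta> n x" "\<And>n x. \<beta> n x \<le> indicator (box a b) x"
    "\<And>x. (\<lambda>n. \<beta> n x) \<longlonglongrightarrow> indicator (box a b) x"
proof -
  define \<beta> :: "nat \<Rightarrow> 'a \<Rightarrow> real" where
    "\<beta> n x = (\<Prod>e\<in>Basis. smooth_step (real n * (x \<bullet> e - a \<bullet> e)) * smooth_step (real n * (b \<bullet> e - x \<bullet> e)))" for n x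
  have "smooth (\<lambda>x. \<Prod>e\<in>Basis. smooth_step (real n * (x \<bullet> e - a \<bullet> e)) * smooth_step (real n * (b \<bullet> e - x \<bullet> e)))" for n
    by (intro smooth_prod smooth_mult smooth_compose[OF smooth_smooth_step] smooth_diff smooth_const smooth_inner)
  then have 1: "smooth (\<beta> n)" for n by (simp add: \<beta>_def[abs_def])
  have 2: "0 \<le> \<beta> n x" for n x unfolding \<beta>_def by (intro prod_nonneg ballI mult_nonneg_nonneg smooth_step_nonneg)
  have le1: "\<beta> n x \<le> 1" for n x
    unfolding \<beta>_def by (intro prod_le_1) (auto intro!: mult_nonneg_nonneg mult_le_one smooth_step_nonneg smooth_step_le_1)
  have out: "\<beta> n x = 0" if "x \<notin> box a b" for n x
  proof -
    from that obtain e where "e \<in> Basis" "x \<bullet> e \<le> a \<bullet> e \<or> b \<bullet> e \<le> x \<bullet> e" by (auto simp: mem_box not_less)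
    then have "smooth_step (real n * (x \<bullet> e - a \<bullet> e)) * smooth_step (real n * (b \<bullet> e - x \<bullet> e)) = 0"
      by (auto simp: smooth_step_zero mult_nonneg_nonpos)
    then show ?thesis unfolding \<beta>_def using \<open>e \<in> Basis\<close> by (intro prod_zero) auto
  qed
  have 3: "\<beta> n x \<le> indicator (box a b) x" for n x
    using le1 out by (auto simp: indicator_def)
  have 4: "(\<lambda>n. \<beta> n x) \<longlonglongrightarrow> indicator (box a b) x" for x
  proof (cases "x \<in> box a b")
    case True
    have ev: "\<forall>\<^sub>F n in sequentially. smooth_step (real n * c) = 1" if "0 < c" for c :: real
    proof -
      have "filterlim (\<lambda>n. c * real n) at_top sequentially"
        by (rule filterlim_tendsto_pos_mult_at_top[OF tendsto_const that filterlim_real_sequentially])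
      then have "\<forall>\<^sub>F n in sequentially. 1 \<le> real n * c"
        by (simp add: filterlim_at_top mult.commute)
      then show ?thesis by eventually_elim (rule smooth_step_one)
    qed
    have "\<forall>\<^sub>F n in sequentially. \<forall>e\<in>Basis. smooth_step (real n * (x \<bullet> e - a \<bullet> e)) * smooth_step (real n * (b \<bullet> e - x \<bullet> e)) = 1"
    proof (rule eventually_ball_finite, simp, intro ballI)
      fix e :: 'a assume "e \<in> Basis"
      with True have "0 < x \<bullet> e - a \<bullet> e" "0 < b \<bullet> e - x \<bullet> e" by (auto simp: mem_box)
      from ev[OF this(1)] ev[OF this(2)]
      show "\<forall>\<^sub>F n in sequentially. smooth_step (real n * (x \<bullet> e - a \<bullet> e)) * smooth_step (real n * (b \<bullet> e - x \<bullet> e)) = 1"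
        by eventually_elim simp
    qed
    then have "\<forall>\<^sub>F n in sequentially. \<beta> n x = 1"
      by eventually_elim (simp add: \<beta>_def)
    with True show ?thesis by (simp add: tendsto_eventually)
  qed (simp add: out)
  show ?thesis by (rule that[of \<beta>, OF 1 2 3 4])
qed

lemma Cc_inf_smooth: "\<psi> \<in> Cc_inf S \<Longrightarrow> smooth \<psi>"
  and Cc_inf_compact: "\<psi> \<in> Cc_inf S \<Longrightarrow> compact (closure {z. \<psi> z \<noteq> 0})"
  and Cc_inf_subset: "\<psi> \<in> Cc_inf S \<Longrightarrow> closure {z. \<psi> z \<noteq> 0} \<subseteq> S"
  by (auto simp: Cc_inf_def)

lemma Cc_infI:
  assumes "smooth \<psi>" "compact K" "K \<subseteq> S" "\<And>z. \<psi> z \<noteq> 0 \<Longrightarrow> z \<in> K"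
  shows "\<psi> \<in> Cc_inf S"
proof -
  have "closure {z. \<psi> z \<noteq> 0} \<subseteq> K"
    using assms by (intro closure_minimal compact_imp_closed) auto
  then show ?thesis
    using assms compact_Int_closed[OF \<open>compact K\<close> closed_closure[of "{z. \<psi> z \<noteq> 0}"]]
    unfolding Cc_inf_def by (auto simp: Int_absorb1 simp del: compact_closure)
qed

lemma partial_zero_outside_closure:
  assumes "x \<notin> closure {z. f z \<noteq> 0}"
  shows "partial v f x = 0"
proof (rule partial_eqI)
  have "open (- closure {z. f z \<noteq> 0})" by auto
  moreover have "((\<lambda>h::real. x + h *\<^sub>R v) \<longlongrightarrow> x) (nhds 0)"
    by (rule tendsto_eq_intros | simp)+ (auto intro!: tendsto_eq_intros filterlim_ident)
  ultimately have "\<forall>\<^sub>F h in nhds 0. x + h *\<^sub>R v \<in> - closure {z. f z \<noteq> 0}"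
    using assms by (intro topological_tendstoD) auto
  then have "\<forall>\<^sub>F h in nhds 0. f (x + h *\<^sub>R v) = 0"
    by eventually_elim (metis (mono_tags, lifting) ComplD closure_subset mem_Collect_eq subsetD)
  from DERIV_cong_ev[OF refl this refl, of 0]
  show "((\<lambda>h. f (x + h *\<^sub>R v)) has_real_derivative 0) (at 0)" by simp
qed

lemma partial_in_Cc_inf:
  assumes "\<psi> \<in> Cc_inf S" "v \<in> Basis"
  shows "partial v \<psi> \<in> Cc_inf S"
  using partial_zero_outside_closure[of _ \<psi> v]
  by (intro Cc_infI[of _ "closure {z. \<psi> z \<noteq> 0}"] smooth_partial Cc_inf_smooth[OF assms(1)]
      Cc_inf_compact[OF assms(1)] Cc_inf_subset[OF assms(1)] assms(2)) blast

lemma mult_in_Cc_inf: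
  assumes "\<psi> \<in> Cc_inf S" "smooth f"
  shows "(\<lambda>z. f z * \<psi> z) \<in> Cc_inf S"
proof (rule Cc_infI[of _ "closure {z. \<psi> z \<noteq> 0}"])
  show "z \<in> closure {z. \<psi> z \<noteq> 0}" if "f z * \<psi> z \<noteq> 0" for z
    using that closure_subset[of "{z. \<psi> z \<noteq> 0}"] by auto
qed (intro smooth_mult Cc_inf_smooth[OF assms(1)] Cc_inf_compact[OF assms(1)]
     Cc_inf_subset[OF assms(1)] assms(2))+

text \<open>Open boxes form an intersection-stable generator of the Borel sets, so vanishing
  integrals propagate to all Borel sets by a Dynkin argument, and a density all of whose integrals
  vanish is 0 almost everywhere. For this the function is first replaced by a Borel function equal
  to it almost everywhere.\<close>

lemma AE_zero_of_box_integrals: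
  fixes h :: "'a::euclidean_space \<Rightarrow> real"
  assumes int: "integrable lebesgue h"
    and out: "\<And>x. x \<notin> box a b \<Longrightarrow> h x = 0"
    and zero: "\<And>c d. (LINT x|lebesgue. indicator (box c d) x * h x) = 0"
  shows "AE x in lebesgue. h x = 0"
proof -
  obtain g where g: "g \<in> borel_measurable lborel" and ae: "AE x in lborel. h x = g x"
    using completion_ex_borel_measurable_real[OF borel_measurable_integrable[OF int]] by auto
  have ae': "AE x in lebesgue. h x = g x" using ae by (rule AE_completion)
  have gL: "integrable lborel g"
  proof -
    have "integrable lebesgue g"
      using integrable_cong_AE_imp[OF int measurable_completion[OF g]] ae' by (auto elim: eventually_mono)
    then show ?thesis using integrable_completion[OF g] by simp
  qed
  note [measurable] = g
  have box0: "(LINT x:box c d|lborel. g x) = 0" for c d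
  proof -
    have "(LINT x|lebesgue. indicator (box c d) x * g x) = (LINT x|lebesgue. indicator (box c d) x * h x)"
    proof (rule integral_cong_AE)
      show "(\<lambda>x. indicator (box c d) x * g x) \<in> borel_measurable lebesgue"
        by (intro measurable_completion) simp
      show "(\<lambda>x. indicator (box c d) x * h x) \<in> borel_measurable lebesgue"
        using int by (intro borel_measurable_times) (auto intro: measurable_completion)
    qed (use ae' in \<open>auto elim: eventually_mono\<close>)
    moreover have "(LINT x|lebesgue. indicator (box c d) x * g x) = (LINT x|lborel. indicator (box c d) x * g x)"
      by (rule integral_completion) simp
    ultimately show ?thesis using zero by (simp add: set_lebesgue_integral_def)
  qed
  \<comment> \<open>The complement step of the induction needs the integral over the whole space;
    vanishing outside one box reduces it to a box integral.\<close>
  have total: "(LINT x|lborel. g x) = 0"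
  proof -
    have "(LINT x|lborel. g x) = (LINT x:box a b|lborel. g x)"
      unfolding set_lebesgue_integral_def
      using ae out by (intro integral_cong_AE) (auto simp: indicator_def elim!: eventually_mono)
    then show ?thesis by (simp add: box0)
  qed
  have si: "set_integrable lborel A g" if "A \<in> sets borel" for A
    using integrable_mult_indicator[OF _ gL, of A] that by (simp add: set_integrable_def)
  have all: "(LINT x:A|lborel. g x) = 0" if A: "A \<in> sets borel" for A
  proof -
    let ?G = "range (\<lambda>(a, b). box a b :: 'a set)"
    have sig: "sigma_sets UNIV ?G = sets borel"
      using arg_cong[OF borel_eq_box[where 'a='a], of sets] by simp
    have stable: "Int_stable ?G"
      unfolding Int_stable_def by (auto simp: box_Int_box)
    have "A \<in> sigma_sets UNIV ?G" using A sig by simp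
    with stable subset_UNIV[of ?G, folded Pow_UNIV] show ?thesis
    proof (induction rule: sigma_sets_induct_disjoint)
      case (basic A) then show ?case using box0 by auto
    next
      case empty then show ?case by (simp add: set_lebesgue_integral_def)
    next
      case (compl A)
      then have "A \<in> sets borel" using sig by simp
      then have "(LINT x:A \<union> (UNIV - A)|lborel. g x) = (LINT x:A|lborel. g x) + (LINT x:UNIV - A|lborel. g x)"
        by (intro set_integral_Un si) auto
      then show ?case using compl total by (simp add: set_lebesgue_integral_def)
    next
      case (union A)
      then have "\<And>i. A i \<in> sets borel" using sig by auto
      then have "(LINT x:(\<Union>i. A i)|lborel. g x) = (\<Sum>i. (LINT x:(A i)|lborel. g x))"
        using union by (intro lebesgue_integral_countable_add si) (auto simp: disjoint_family_on_def)
      then show ?case using union by simp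
    qed
  qed
  have "AE x in lborel. g x = 0"
    using gL all by (intro density_unique_real) (auto simp: set_lebesgue_integral_def)
  then have "AE x in lebesgue. g x = 0" by (rule AE_completion)
  with ae' show ?thesis by eventually_elim simp
qed

text \<open>The bumps turn orthogonality to test functions into vanishing integrals over all open
  sub-boxes of a closed box contained in \<open>S\<close>, and countably many such closed boxes fill
  \<open>S\<close>. Local integrability fits because one closed box is considered at a time.\<close>

lemma du_Bois_Reymond:
  fixes f :: "'a::euclidean_space \<Rightarrow> real"
  assumes S: "open S"
    and int: "\<And>K. compact K \<Longrightarrow> K \<subseteq> S \<Longrightarrow> integrable lebesgue (\<lambda>z. indicator K z * f z)"
    and zero: "\<And>\<psi>. \<psi> \<in> Cc_inf S \<Longrightarrow> (LINT z|lebesgue. f z * \<psi> z) = 0"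
  shows "AE z in lebesgue. z \<in> S \<longrightarrow> f z = 0"
proof -
  have box: "AE z in lebesgue. z \<in> cbox a b \<longrightarrow> f z = 0" if sub: "cbox a b \<subseteq> S" for a b
  proof -
    let ?h = "\<lambda>z. indicator (box a b) z * f z"
    note intc = int[OF compact_cbox sub]
    have inth: "integrable lebesgue (\<lambda>z. indicator (box c d) z * f z)" if "box c d \<subseteq> box a b" for c d
    proof -
      have "integrable lebesgue (\<lambda>z. indicator (box c d) z *\<^sub>R (indicator (cbox a b) z * f z))"
        by (intro integrable_mult_indicator intc) auto
      also have "(\<lambda>z. indicator (box c d) z *\<^sub>R (indicator (cbox a b) z * f z)) = (\<lambda>z. indicator (box c d) z * f z)"
        using that box_subset_cbox[of a b] by (auto simp: fun_eq_iff indicator_def)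
      finally show ?thesis .
    qed
    have sub0: "(LINT z|lebesgue. indicator (box c d) z * f z) = 0" if cd: "box c d \<subseteq> box a b" for c d
    proof (cases "box c d = {}")
      case ne: False
      have cc: "cbox c d \<subseteq> cbox a b"
        using closure_mono[OF cd] ne closure_box[OF ne] box_subset_cbox[of a b]
        by (metis closed_cbox closure_minimal dual_order.trans cd)
      obtain \<beta> where \<beta>: "\<And>n. smooth (\<beta> n)" "\<And>n x. 0 \<le> \<beta> n x" "\<And>n x. \<beta> n x \<le> indicator (box c d) x"
        "\<And>x. (\<lambda>n. \<beta> n x) \<longlonglongrightarrow> indicator (box c d) x"
        using box_bump[of c d] by blast
      have "(LINT z|lebesgue. f z * \<beta> n z) = 0" for n
      proof (rule zero, rule Cc_infI[OF \<beta>(1) compact_cbox[of c d]])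
        show "cbox c d \<subseteq> S" using cc sub by blast
        fix z assume "\<beta> n z \<noteq> 0"
        then have "z \<in> box c d" using \<beta>(2,3)[of n z] by (cases "z \<in> box c d") auto
        then show "z \<in> cbox c d" using box_subset_cbox by blast
      qed
      moreover have "(\<lambda>n. LINT z|lebesgue. \<beta> n z * (indicator (box c d) z * f z)) \<longlonglongrightarrow>
          (LINT z|lebesgue. indicator (box c d) z * (indicator (box c d) z * f z))"
      proof (rule integral_dominated_convergence)
        show "integrable lebesgue (\<lambda>z. \<bar>indicator (box c d) z * f z\<bar>)" using inth[OF cd] by simp
        have bm: "\<beta> n \<in> borel_measurable lebesgue" for n
          by (intro measurable_completion)
             (simp add: smooth_continuous_on \<beta>(1) borel_measurable_continuous_onI)
        show "(\<lambda>z. indicator (box c d) z * (indicator (box c d) z * f z)) \<in> borel_measurable lebesgue"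
          by (rule borel_measurable_times[OF _ borel_measurable_integrable[OF inth[OF cd]]])
             (auto intro: measurable_completion)
        show "(\<lambda>z. \<beta> n z * (indicator (box c d) z * f z)) \<in> borel_measurable lebesgue" for n
          by (rule borel_measurable_times[OF bm borel_measurable_integrable[OF inth[OF cd]]])
        show "AE z in lebesgue. (\<lambda>n. \<beta> n z * (indicator (box c d) z * f z)) \<longlonglongrightarrow>
            indicator (box c d) z * (indicator (box c d) z * f z)"
          by (intro always_eventually allI tendsto_mult \<beta>(4) tendsto_const)
        have "\<beta> n z \<le> 1" for n z using \<beta>(3)[of n z] indicator_le_1[of "box c d" z, where 'a=real] by linarith
        then show "AE z in lebesgue. norm (\<beta> n z * (indicator (box c d) z * f z)) \<le> \<bar>indicator (box c d) z * f z\<bar>" for n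
          using \<beta>(2) by (intro always_eventually allI) (auto simp: abs_mult intro!: mult_left_le_one_le)
      qed
      moreover have "\<beta> n z * (indicator (box c d) z * f z) = f z * \<beta> n z" for n z
        using \<beta>(2,3)[of n z] by (cases "z \<in> box c d") auto
      ultimately have "(LINT z|lebesgue. indicator (box c d) z * (indicator (box c d) z * f z)) = 0"
        using LIMSEQ_unique by (simp add: LIMSEQ_const_iff)
      moreover have "indicator (box c d) z * (indicator (box c d) z * f z) = indicator (box c d) z * f z" for z
        by (simp add: indicator_def)
      ultimately show ?thesis by simp
    qed simp
    have "AE z in lebesgue. ?h z = 0"
    proof (rule AE_zero_of_box_integrals[where a=a and b=b])
      show "integrable lebesgue ?h" by (rule inth) simp
      fix c d
      obtain c' d' where "box c d \<inter> box a b = box c' d'" using box_Int_box[of c d a b] by blast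
      then have eq: "indicator (box c d) z * (indicator (box a b) z * f z) = indicator (box c' d') z * f z"
          and "box c' d' \<subseteq> box a b" for z
        by (auto simp: indicator_def set_eq_iff)
      then show "(LINT z|lebesgue. indicator (box c d) z * (indicator (box a b) z * f z)) = 0"
        unfolding eq by (intro sub0)
    qed auto
    \<comment> \<open>The argument yields 0 on the open box, while the countable cover consists of
      closed ones; the faces form a null set.\<close>
    moreover have "AE z in lebesgue. z \<notin> cbox a b - box a b"
      using negligible_frontier_interval[of a b] unfolding negligible_iff_null_sets by (rule AE_not_in)
    ultimately show ?thesis by eventually_elim (auto simp: indicator_def)
  qed
  obtain D where D: "countable D" "D \<subseteq> Pow S" "\<And>X. X \<in> D \<Longrightarrow> \<exists>a b. X = cbox a b" "\<Union>D = S"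
    using open_countable_Union_open_cbox[OF S] by blast
  have "AE z in lebesgue. \<forall>X\<in>D. z \<in> X \<longrightarrow> f z = 0"
    using D box by (subst AE_ball_countable) (auto, metis Pow_iff subsetD)
  then show ?thesis by eventually_elim (use D(4) in blast)
qed

section \<open>Integrals of test functions and of their derivatives\<close>

lemma compact_support_obtain_ball:
  assumes "compact (closure {z::'a::euclidean_space. f z \<noteq> (0::real)})"
  obtains R where "0 < R" "\<And>z. R < norm z \<Longrightarrow> f z = 0"
proof -
  obtain R where R: "R > 0" "\<forall>z\<in>closure {z. f z \<noteq> 0}. norm z \<le> R"
    using compact_imp_bounded[OF assms] by (auto simp: bounded_pos)
  then have "f z = 0" if "R < norm z" for z
    using that closure_subset[of "{z. f z \<noteq> 0}"] by force
  with R that show ?thesis by blast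
qed

lemma integrable_Cc_inf:
  assumes "\<psi> \<in> Cc_inf S"
  shows "integrable lborel \<psi>"
proof -
  let ?K = "closure {z. \<psi> z \<noteq> 0}"
  have "integrable lborel (\<lambda>z. indicator ?K z *\<^sub>R \<psi> z)"
    by (intro borel_integrable_compact Cc_inf_compact[OF assms] smooth_continuous_on Cc_inf_smooth[OF assms])
  also have "(\<lambda>z. indicator ?K z *\<^sub>R \<psi> z) = \<psi>"
    using closure_subset[of "{z. \<psi> z \<noteq> 0}"] by (auto simp: fun_eq_iff indicator_def)
  finally show ?thesis .
qed

lemma smooth_borel_measurable: "smooth f \<Longrightarrow> f \<in> borel_measurable borel"
  by (intro borel_measurable_continuous_onI smooth_continuous_on)

text \<open>By translation invariance each difference quotient of \<open>w\<close> has integral 0,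
  and the quotients converge boundedly, on a fixed ball, to the partial derivative.\<close>

lemma integral_partial_eq_0:
  fixes w :: "'a::euclidean_space \<Rightarrow> real"
  assumes w: "w \<in> Cc_inf S" and v: "v \<in> Basis"
  shows "(LINT z|lborel. partial v w z) = 0"
proof -
  note sm = Cc_inf_smooth[OF w]
  note [measurable] = smooth_borel_measurable[OF sm] smooth_borel_measurable[OF smooth_partial[OF sm v]]
  obtain R where R: "R > 0" "\<And>z. R < norm z \<Longrightarrow> w z = 0"
    using compact_support_obtain_ball[OF Cc_inf_compact[OF w]] by blast
  obtain B where B: "B > 0" "\<And>z. \<bar>partial v w z\<bar> \<le> B"
    using bounded_partial_of_compact_support[OF sm v Cc_inf_compact[OF w]] partial_zero_outside_closure by blast
  define q where "q n z = (w (z + (1 / real (Suc n)) *\<^sub>R v) - w z) / (1 / real (Suc n))" for n z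
  have "(\<lambda>n. LINT z|lborel. q n z) \<longlonglongrightarrow> (LINT z|lborel. partial v w z)"
  proof (rule integral_dominated_convergence)
    \<comment> \<open>\<open>B\<close> bounds the quotients by the mean value theorem; the radius
      \<open>R + 1\<close> allows for the shift by a vector of norm at most 1.\<close>
    show "integrable lborel (\<lambda>z. indicator (cball 0 (R + 1)) z * B)"
      by (intro integrable_mult_left integrable_real_indicator) (auto intro: emeasure_bounded_finite[simplified])
    show "q n \<in> borel_measurable lborel" for n unfolding q_def by measurable
    show "AE z in lborel. (\<lambda>n. q n z) \<longlonglongrightarrow> partial v w z"
    proof (intro always_eventually allI)
      fix z
      have "((\<lambda>h. (w (z + h *\<^sub>R v) - w z) / h) \<longlongrightarrow> partial v w z) (at 0)"
        using smooth_has_partial[OF sm v, of z] by (simp add: DERIV_def)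
      moreover have "filterlim (\<lambda>n. 1 / real (Suc n)) (at 0) sequentially"
        using LIMSEQ_inverse_real_of_nat by (auto simp: filterlim_at inverse_eq_divide)
      ultimately show "(\<lambda>n. q n z) \<longlonglongrightarrow> partial v w z"
        unfolding q_def by (rule filterlim_compose)
    qed
    show "AE z in lborel. norm (q n z) \<le> indicator (cball 0 (R + 1)) z * B" for n
    proof (intro always_eventually allI)
      fix z
      let ?h = "1 / real (Suc n)"
      have h: "0 < ?h" "?h \<le> 1" by auto
      show "norm (q n z) \<le> indicator (cball 0 (R + 1)) z * B"
      proof (cases "z \<in> cball 0 (R + 1)")
        case True
        obtain s where "w (z + ?h *\<^sub>R v) - w (z + 0 *\<^sub>R v) = (?h - 0) * partial v w (z + s *\<^sub>R v)"
          using MVT2[OF h(1), of "\<lambda>s. w (z + s *\<^sub>R v)" "\<lambda>s. partial v w (z + s *\<^sub>R v)"]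
            smooth_has_partial_at[OF sm v] by blast
        then have "q n z = partial v w (z + s *\<^sub>R v)" by (simp add: q_def)
        then show ?thesis using B(2) True by simp
      next
        case False
        then have "R + 1 < norm z" by simp
        moreover have "norm (?h *\<^sub>R v) \<le> 1" using h v by simp
        ultimately have "R < norm (z + ?h *\<^sub>R v)"
          using norm_triangle_ineq4[of "z + ?h *\<^sub>R v" "?h *\<^sub>R v"] by (simp only: add_diff_cancel_right')
        then show ?thesis using False R(2) \<open>R + 1 < norm z\<close> by (simp add: q_def)
      qed
    qed
  qed auto
  moreover have "(LINT z|lborel. q n z) = 0" for n
  proof -
    let ?c = "(1 / real (Suc n)) *\<^sub>R v"
    have i: "integrable lborel w" by (rule integrable_Cc_inf[OF w])
    have d: "distr lborel borel (\<lambda>z. ?c + z) = (lborel :: 'a measure)" by (rule lborel_distr_plus)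
    have "integrable (distr lborel borel (\<lambda>z. ?c + z)) w" unfolding d by (rule i)
    then have i2: "integrable lborel (\<lambda>z. w (z + ?c))"
      by (subst (asm) integrable_distr_eq) (auto simp: add.commute)
    have "(LINT z|lborel. w (z + ?c)) = (LINT z|distr lborel borel (\<lambda>z. ?c + z). w z)"
      by (subst integral_distr) (auto simp: add.commute)
    also have "\<dots> = (LINT z|lborel. w z)" unfolding d ..
    finally show ?thesis using i i2 by (simp add: q_def)
  qed
  ultimately show ?thesis using LIMSEQ_unique by (simp add: LIMSEQ_const_iff)
qed

section \<open>Weak derivatives\<close>

text \<open>Weaker than \<open>L2\<close> on purpose: the classical derivative of a smooth function
  is locally integrable by continuity, whereas its square integrability on \<open>S\<close> is
  itself deduced from the uniqueness of weak derivatives.\<close>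

definition loc_integrable :: "'a::euclidean_space set \<Rightarrow> ('a \<Rightarrow> real) \<Rightarrow> bool" where
  "loc_integrable S g \<longleftrightarrow> (\<forall>K. compact K \<and> K \<subseteq> S \<longrightarrow> integrable lebesgue (\<lambda>z. indicator K z * g z))"

text \<open>Extended-valued, so that estimates can be chained without integrability side conditions;
  for a measurable function, finiteness is exactly \<open>L2\<close>.\<close>

definition sqnorm :: "'a::euclidean_space set \<Rightarrow> ('a \<Rightarrow> real) \<Rightarrow> ennreal" where
  "sqnorm S f = (\<integral>\<^sup>+ z. ennreal ((f z)\<^sup>2) \<partial>lebesgue_on S)"

lemma smooth_lebesgue_on [measurable]: "smooth f \<Longrightarrow> f \<in> borel_measurable (lebesgue_on S)"
  by (intro measurable_restrict_space1 measurable_completion) (simp add: smooth_borel_measurable)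

lemma axis_zero_Basis: "(axis i 1, 0) \<in> (Basis :: ((real^'n) \<times> real) set)"
  by (auto simp: Basis_prod_def axis_in_Basis_iff)

lemma smooth_dx: "smooth f \<Longrightarrow> smooth (dx i f)"
  by (simp add: dx_def smooth_partial axis_zero_Basis)

lemma dx_in_Cc_inf: "\<psi> \<in> Cc_inf S \<Longrightarrow> dx i \<psi> \<in> Cc_inf S"
  by (simp add: dx_def partial_in_Cc_inf axis_zero_Basis)

lemma integrable_mult_test:
  assumes "loc_integrable S g" "\<psi> \<in> Cc_inf S"
  shows "integrable lebesgue (\<lambda>z. g z * \<psi> z)"
proof -
  let ?K = "closure {z. \<psi> z \<noteq> 0}"
  have i: "integrable lebesgue (\<lambda>z. indicator ?K z * g z)"
    using assms Cc_inf_compact[OF assms(2)] Cc_inf_subset[OF assms(2)] unfolding loc_integrable_def by blast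
  have "bounded (\<psi> ` ?K)"
    by (intro compact_imp_bounded compact_continuous_image smooth_continuous_on
        Cc_inf_smooth[OF assms(2)] Cc_inf_compact[OF assms(2)])
  then obtain B where B: "\<And>z. z \<in> ?K \<Longrightarrow> \<bar>\<psi> z\<bar> \<le> B" by (auto simp: bounded_iff)
  have eq: "g z * \<psi> z = (indicator ?K z * g z) * \<psi> z" for z
    using closure_subset[of "{z. \<psi> z \<noteq> 0}"] by (auto simp: indicator_def)
  show ?thesis
  proof (rule Bochner_Integration.integrable_bound)
    show "integrable lebesgue (\<lambda>z. B * (indicator ?K z * g z))" using i by (rule integrable_mult_right)
    have "\<psi> \<in> borel_measurable lebesgue"
      by (intro measurable_completion) (simp add: smooth_borel_measurable Cc_inf_smooth[OF assms(2)])
    then show "(\<lambda>z. g z * \<psi> z) \<in> borel_measurable lebesgue"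
      unfolding eq by (rule borel_measurable_times[OF borel_measurable_integrable[OF i]])
    show "AE z in lebesgue. norm (g z * \<psi> z) \<le> norm (B * (indicator ?K z * g z))"
    proof (intro always_eventually allI)
      fix z show "norm (g z * \<psi> z) \<le> norm (B * (indicator ?K z * g z))"
      proof (cases "z \<in> ?K")
        case True
        then have "\<bar>\<psi> z\<bar> \<le> \<bar>B\<bar>" using B by fastforce
        then show ?thesis using True by (simp add: abs_mult mult.commute[of "\<bar>g z\<bar>"] mult_right_mono)
      qed (simp add: eq)
    qed
  qed
qed

lemma integral_lebesgue_on_test:
  assumes "open S" "\<psi> \<in> Cc_inf S"
  shows "(LINT z|lebesgue_on S. g z * \<psi> z) = (LINT z|lebesgue. g z * \<psi> z)"
proof -
  have "indicator S z *\<^sub>R (g z * \<psi> z) = g z * \<psi> z" for z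
    using closure_subset[of "{z. \<psi> z \<noteq> 0}"] Cc_inf_subset[OF assms(2)] by (auto simp: indicator_def)
  then show ?thesis
    using assms(1) by (subst integral_restrict_space) (auto simp del: real_scaleR_def)
qed

text \<open>Test functions and their derivatives vanish outside \<open>S\<close>. Over the whole
  space the translation argument for integrals of derivatives applies directly.\<close>

lemma weak_dx_iff:
  assumes "open S"
  shows "weak_dx S i u g \<longleftrightarrow>
    (\<forall>\<psi>\<in>Cc_inf S. (LINT z|lebesgue. u z * dx i \<psi> z) = - (LINT z|lebesgue. g z * \<psi> z))"
  unfolding weak_dx_def
  by (rule ball_cong) (simp_all only: integral_lebesgue_on_test[OF assms] dx_in_Cc_inf)

lemma weak_dx_unique:
  assumes "open S" "loc_integrable S g" "loc_integrable S h" "weak_dx S i u g" "weak_dx S i u h"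
  shows "AE z in lebesgue_on S. g z = h z"
proof -
  have "AE z in lebesgue. z \<in> S \<longrightarrow> g z - h z = 0"
  proof (rule du_Bois_Reymond[OF assms(1)])
    fix K assume "compact K" "K \<subseteq> S"
    then have "integrable lebesgue (\<lambda>z. indicator K z * g z - indicator K z * h z)"
      using assms by (intro Bochner_Integration.integrable_diff) (auto simp: loc_integrable_def)
    then show "integrable lebesgue (\<lambda>z. indicator K z * (g z - h z))" by (simp add: right_diff_distrib)
  next
    fix \<psi> assume \<psi>: "\<psi> \<in> Cc_inf S"
    have "(LINT z|lebesgue. (g z - h z) * \<psi> z) = (LINT z|lebesgue. g z * \<psi> z) - (LINT z|lebesgue. h z * \<psi> z)"
      unfolding left_diff_distrib using assms \<psi>
      by (intro Bochner_Integration.integral_diff integrable_mult_test)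
    then show "(LINT z|lebesgue. (g z - h z) * \<psi> z) = 0"
      using assms(4,5) \<psi> unfolding weak_dx_iff[OF assms(1)] by simp
  qed
  then show ?thesis using assms(1) by (subst AE_restrict_space_iff) auto
qed

lemma weak_dx_diff:
  assumes "open S" "loc_integrable S u" "loc_integrable S v" "loc_integrable S g" "loc_integrable S h"
    "weak_dx S i u g" "weak_dx S i v h"
  shows "weak_dx S i (\<lambda>z. u z - v z) (\<lambda>z. g z - h z)"
  unfolding weak_dx_iff[OF assms(1)]
proof
  fix \<psi> assume \<psi>: "\<psi> \<in> Cc_inf S"
  note d\<psi> = dx_in_Cc_inf[OF \<psi>]
  have "(LINT z|lebesgue. (u z - v z) * dx i \<psi> z) = (LINT z|lebesgue. u z * dx i \<psi> z) - (LINT z|lebesgue. v z * dx i \<psi> z)"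
    unfolding left_diff_distrib using assms d\<psi>
    by (intro Bochner_Integration.integral_diff integrable_mult_test)
  moreover have "(LINT z|lebesgue. (g z - h z) * \<psi> z) = (LINT z|lebesgue. g z * \<psi> z) - (LINT z|lebesgue. h z * \<psi> z)"
    unfolding left_diff_distrib using assms \<psi>
    by (intro Bochner_Integration.integral_diff integrable_mult_test)
  ultimately show "(LINT z|lebesgue. (u z - v z) * dx i \<psi> z) = - (LINT z|lebesgue. (g z - h z) * \<psi> z)"
    using assms(6,7) \<psi> unfolding weak_dx_iff[OF assms(1)] by simp
qed

lemma loc_integrable_smooth: "smooth f \<Longrightarrow> loc_integrable S f"
  unfolding loc_integrable_def
proof safe
  fix K :: "'a set" assume "smooth f" "compact K"
  then have "integrable lborel (\<lambda>z. indicator K z *\<^sub>R f z)"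
    by (intro borel_integrable_compact smooth_continuous_on)
  then show "integrable lebesgue (\<lambda>z. indicator K z * f z)"
    by (simp add: integrable_completion borel_measurable_integrable)
qed

text \<open>Multiplication by \<open>v\<close> keeps the support of \<psi> compact, so the product
  is again a test function; the integral of its derivative is 0 and splits by the product
  rule.\<close>

lemma weak_dx_smooth:
  assumes "open S" "smooth v"
  shows "weak_dx S i v (dx i v)"
  unfolding weak_dx_iff[OF assms(1)]
proof
  fix \<psi> assume \<psi>: "\<psi> \<in> Cc_inf S"
  have int: "integrable lebesgue (\<lambda>z. v z * dx i \<psi> z)" "integrable lebesgue (\<lambda>z. dx i v z * \<psi> z)"
    using assms \<psi> by (auto intro!: integrable_mult_test[of S] loc_integrable_smooth smooth_dx dx_in_Cc_inf)
  let ?w = "\<lambda>z. v z * \<psi> z"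
  have w: "?w \<in> Cc_inf S" using \<psi> assms(2) by (rule mult_in_Cc_inf)
  have "dx i ?w z = dx i v z * \<psi> z + v z * dx i \<psi> z" for z
    unfolding dx_def by (rule partial_mult[OF assms(2) Cc_inf_smooth[OF \<psi>] axis_zero_Basis])
  then have "(LINT z|lebesgue. dx i ?w z) = (LINT z|lebesgue. dx i v z * \<psi> z) + (LINT z|lebesgue. v z * dx i \<psi> z)"
    using int by simp
  moreover have "(LINT z|lebesgue. dx i ?w z) = (LINT z|lborel. dx i ?w z)"
    by (rule integral_completion) (simp add: smooth_borel_measurable smooth_dx Cc_inf_smooth[OF w])
  moreover have "(LINT z|lborel. dx i ?w z) = 0"
    unfolding dx_def by (rule integral_partial_eq_0[OF w axis_zero_Basis])
  ultimately show "(LINT z|lebesgue. v z * dx i \<psi> z) = - (LINT z|lebesgue. dx i v z * \<psi> z)" by simp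
qed

section \<open>Squared \<open>L2\<close> norms and the norm of \<open>H\<close>\<close>

lemma L2_iff_sqnorm: "L2 S f \<longleftrightarrow> f \<in> borel_measurable (lebesgue_on S) \<and> sqnorm S f < \<infinity>"
  unfolding L2_def sqnorm_def by (auto simp: integrable_iff_bounded)

lemma ennreal_integral_L2: "L2 S f \<Longrightarrow> ennreal (LINT z|lebesgue_on S. (f z)\<^sup>2) = sqnorm S f"
  unfolding L2_def sqnorm_def by (subst nn_integral_eq_integral) auto

lemma sqnorm_mono: "(\<And>z. z \<in> S \<Longrightarrow> \<bar>f z\<bar> \<le> \<bar>g z\<bar>) \<Longrightarrow> sqnorm S f \<le> sqnorm S g"
  unfolding sqnorm_def
  by (intro nn_integral_mono ennreal_leI) (auto simp: space_restrict_space abs_le_square_iff)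

lemma sqnorm_cong_AE: "AE z in lebesgue_on S. f z = g z \<Longrightarrow> sqnorm S f = sqnorm S g"
  unfolding sqnorm_def by (intro nn_integral_cong_AE) (auto elim: eventually_mono)

lemma sqnorm_zero: "sqnorm S (\<lambda>_. 0) = 0"
  by (simp add: sqnorm_def)

lemma sqnorm_cmult: "f \<in> borel_measurable (lebesgue_on S) \<Longrightarrow> sqnorm S (\<lambda>z. c * f z) = ennreal (c\<^sup>2) * sqnorm S f"
  unfolding sqnorm_def by (subst nn_integral_cmult[symmetric]) (auto simp: power_mult_distrib ennreal_mult)

lemma sqnorm_add_le:
  assumes [measurable]: "f \<in> borel_measurable (lebesgue_on S)" "g \<in> borel_measurable (lebesgue_on S)"
  shows "sqnorm S (\<lambda>z. f z + g z) \<le> 2 * sqnorm S f + 2 * sqnorm S g"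
proof -
  have "(a + b)\<^sup>2 \<le> 2 * a\<^sup>2 + 2 * b\<^sup>2" for a b :: real
    using zero_le_power2[of "a - b"] by (simp add: power2_eq_square algebra_simps)
  then have "sqnorm S (\<lambda>z. f z + g z) \<le> (\<integral>\<^sup>+ z. 2 * ennreal ((f z)\<^sup>2) + 2 * ennreal ((g z)\<^sup>2) \<partial>lebesgue_on S)"
    unfolding sqnorm_def by (intro nn_integral_mono) (auto simp: ennreal_leI simp flip: ennreal_plus ennreal_mult' ennreal_numeral)
  also have "\<dots> = 2 * sqnorm S f + 2 * sqnorm S g"
    unfolding sqnorm_def by (simp add: nn_integral_add nn_integral_cmult)
  finally show ?thesis .
qed

lemma sqnorm_diff_le:
  assumes "f \<in> borel_measurable (lebesgue_on S)" "g \<in> borel_measurable (lebesgue_on S)"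
  shows "sqnorm S (\<lambda>z. f z - g z) \<le> 2 * sqnorm S f + 2 * sqnorm S g"
  using sqnorm_add_le[OF assms(1), of "\<lambda>z. - g z"] assms(2) by (simp add: sqnorm_def)

lemma L2_diff: "L2 S f \<Longrightarrow> L2 S g \<Longrightarrow> L2 S (\<lambda>z. f z - g z)"
  unfolding L2_iff_sqnorm
  by (auto intro!: le_less_trans[OF sqnorm_diff_le] simp: ennreal_mult_less_top)

lemma L2_loc_integrable:
  assumes "open S" "L2 S f"
  shows "loc_integrable S f"
  unfolding loc_integrable_def
proof safe
  fix K assume K: "compact K" "K \<subseteq> S"
  have S: "S \<inter> space lebesgue \<in> sets lebesgue" using assms(1) by auto
  have Kl: "K \<in> sets lebesgue" by (intro sets_completionI_sets) (simp add: borel_compact K(1))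
  have f2: "integrable lebesgue (\<lambda>z. indicator S z *\<^sub>R (f z)\<^sup>2)"
    using assms(2) unfolding L2_def integrable_restrict_space[OF S] by simp
  have fm: "(\<lambda>z. indicator S z *\<^sub>R f z) \<in> borel_measurable lebesgue"
    using assms(2) unfolding L2_def borel_measurable_restrict_space_iff[OF S] by simp
  show "integrable lebesgue (\<lambda>z. indicator K z * f z)"
  proof (rule Bochner_Integration.integrable_bound)
    show "integrable lebesgue (\<lambda>z. indicator K z + indicator S z *\<^sub>R (f z)\<^sup>2)"
      using f2 Kl K(1) emeasure_bounded_finite[OF compact_imp_bounded[OF K(1)]] by (intro Bochner_Integration.integrable_add integrable_real_indicator)
        (auto simp: borel_compact)
    have "(\<lambda>z. indicator K z * (indicator S z *\<^sub>R f z)) \<in> borel_measurable lebesgue"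
      using Kl by (intro borel_measurable_times fm) auto
    also have "(\<lambda>z. indicator K z * (indicator S z *\<^sub>R f z)) = (\<lambda>z. indicator K z * f z)"
      using K(2) by (auto simp: fun_eq_iff indicator_def)
    finally show "(\<lambda>z. indicator K z * f z) \<in> borel_measurable lebesgue" .
    have "\<bar>a\<bar> \<le> 1 + a\<^sup>2" for a :: real
      using zero_le_power2[of "\<bar>a\<bar> - 1"] zero_le_power2[of a] by (simp add: power2_eq_square algebra_simps)
    then show "AE z in lebesgue. norm (indicator K z * f z) \<le> norm (indicator K z + indicator S z *\<^sub>R (f z)\<^sup>2)"
      using K(2) by (intro always_eventually allI) (auto simp: indicator_def abs_of_nonneg)
  qed
qed

text \<open>\<open>H_norm\<close> refers to \<open>wdx\<close>, a derivative picked by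
  \<open>SOME\<close>. Weak derivatives agree almost everywhere, so any square integrable choice
  \<open>g\<close> computes the same norm; every \<open>H\<close> norm below is evaluated in this
  way.\<close>

lemma H_norm_sq:
  assumes S: "open S" and w: "L2 S w" and g: "\<And>i. L2 S (g i)" "\<And>i. weak_dx S i w (g i)"
  shows "ennreal ((H_norm S w)\<^sup>2) = sqnorm S w + (\<Sum>i\<in>UNIV. sqnorm S (g i))"
proof -
  have wd: "L2 S (wdx S i w)" "weak_dx S i w (wdx S i w)" for i
    using someI[of "\<lambda>g. L2 S g \<and> weak_dx S i w g" "g i"] g unfolding wdx_def by auto
  have "sqnorm S (wdx S i w) = sqnorm S (g i)" for i
    by (rule sqnorm_cong_AE, rule weak_dx_unique[OF S L2_loc_integrable[OF S] L2_loc_integrable[OF S]]) (use wd g in auto)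
  moreover have "ennreal ((H_norm S w)\<^sup>2) = sqnorm S w + (\<Sum>i\<in>UNIV. sqnorm S (wdx S i w))"
    unfolding H_norm_def using w wd
    by (simp add: ennreal_plus sum_nonneg flip: ennreal_integral_L2)
  ultimately show ?thesis by simp
qed

text \<open>\<open>inH\<close> supplies some square integrable weak derivative; uniqueness
  identifies it with the classical derivative, which is a priori only locally integrable on
  \<open>S\<close>.\<close>

lemma L2_dx_smooth:
  assumes S: "open S" and v: "smooth v" "inH S v"
  shows "L2 S (dx i v)"
proof -
  obtain g where g: "L2 S g" "weak_dx S i v g" using v(2) unfolding inH_def by blast
  have "AE z in lebesgue_on S. dx i v z = g z"
    by (rule weak_dx_unique[OF S loc_integrable_smooth L2_loc_integrable[OF S g(1)] weak_dx_smooth[OF S v(1)] g(2)])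
       (rule smooth_dx[OF v(1)])
  then have "sqnorm S (dx i v) = sqnorm S g" by (rule sqnorm_cong_AE)
  then show ?thesis using g(1) v(1) by (simp add: L2_iff_sqnorm smooth_lebesgue_on smooth_dx)
qed

lemma Cc_inf_L2: "\<psi> \<in> Cc_inf S \<Longrightarrow> open S \<Longrightarrow> L2 S \<psi>"
proof -
  assume \<psi>: "\<psi> \<in> Cc_inf S" and S: "open S"
  have "integrable lebesgue (\<lambda>z. \<psi> z * \<psi> z)"
    by (rule integrable_mult_test[OF loc_integrable_smooth \<psi>]) (rule Cc_inf_smooth[OF \<psi>])
  then have "integrable lebesgue (\<lambda>z. indicator S z *\<^sub>R (\<psi> z * \<psi> z))"
    using S by (intro integrable_mult_indicator) auto
  then show "L2 S \<psi>" using S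
    by (simp add: L2_def integrable_restrict_space power2_eq_square smooth_lebesgue_on Cc_inf_smooth[OF \<psi>])
qed

lemma Cc_inf_inH: "\<psi> \<in> Cc_inf S \<Longrightarrow> open S \<Longrightarrow> inH S \<psi>"
  unfolding inH_def by (blast intro: Cc_inf_L2 dx_in_Cc_inf weak_dx_smooth Cc_inf_smooth)

section \<open>Level sets and energy\<close>

text \<open>Fundamental theorem of calculus and Cauchy-Schwarz on the segment, after \<open>(f
  0)\<^sup>2 \<le> 2 * (f \<tau>)\<^sup>2 + 2 * (f \<tau> - f 0)\<^sup>2\<close>. The factor is
  uniform in \<tau>, but the integral stays on the actual segment.\<close>

lemma sq_le_endpoint_plus_energy:
  fixes f f' :: "real \<Rightarrow> real"
  assumes \<tau>: "0 \<le> \<tau>" "\<tau> \<le> h"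
    and deriv: "\<And>s. (f has_real_derivative f' s) (at s)" and cont: "continuous_on UNIV f'"
  shows "ennreal ((f 0)\<^sup>2) \<le> 2 * ennreal ((f \<tau>)\<^sup>2) +
    ennreal (2 * h) * (\<integral>\<^sup>+ s. ennreal ((f' s)\<^sup>2) * indicator {0..<\<tau>} s \<partial>lborel)"
proof -
  let ?I = "{0..\<tau>}"
  have contI: "continuous_on ?I f'" using cont by (rule continuous_on_subset) simp
  define J where "J = (LINT s|lborel. indicator ?I s *\<^sub>R (f' s)\<^sup>2)"
  have i1: "integrable lborel (\<lambda>s. indicator ?I s *\<^sub>R f' s)"
    by (intro borel_integrable_compact contI) simp
  have i2: "integrable lborel (\<lambda>s. indicator ?I s *\<^sub>R (f' s)\<^sup>2)"
    by (intro borel_integrable_compact continuous_intros contI) simp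
  have i0: "integrable lborel (\<lambda>s. indicator ?I s :: real)"
    by (intro integrable_real_indicator) (auto simp: \<tau>)
  have ftc: "(LINT s|lborel. indicator ?I s *\<^sub>R f' s) = f \<tau> - f 0"
    by (rule integral_FTC_atLeastAtMost[OF \<tau>(1) _ contI])
       (simp add: has_real_derivative_iff_has_vector_derivative[symmetric] has_field_derivative_at_within deriv)
  have cs: "(f \<tau> - f 0)\<^sup>2 \<le> \<tau> * J"
  proof (cases "\<tau> = 0")
    case False
    \<comment> \<open>The mean of \<open>f'\<close>: expanding the nonnegative integral of
      \<open>(f' - m)\<^sup>2\<close> gives Cauchy-Schwarz directly.\<close>
    define m where "m = (f \<tau> - f 0) / \<tau>"
    have "0 \<le> (LINT s|lborel. indicator ?I s * (f' s - m)\<^sup>2)"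
      by (intro integral_nonneg_AE) auto
    also have "(\<lambda>s. indicator ?I s * (f' s - m)\<^sup>2) =
        (\<lambda>s. indicator ?I s *\<^sub>R (f' s)\<^sup>2 - 2 * m * (indicator ?I s *\<^sub>R f' s) + m\<^sup>2 * indicator ?I s)"
      by (auto simp: fun_eq_iff power2_eq_square algebra_simps)
    also have "(LINT s|lborel. indicator ?I s *\<^sub>R (f' s)\<^sup>2 - 2 * m * (indicator ?I s *\<^sub>R f' s) + m\<^sup>2 * indicator ?I s)
        = J - 2 * m * (f \<tau> - f 0) + m\<^sup>2 * \<tau>"
      using i0 i1 i2 \<tau>(1) ftc[unfolded real_scaleR_def] by (simp add: J_def)
    finally have "0 \<le> \<tau> * (J - 2 * m * (f \<tau> - f 0) + m\<^sup>2 * \<tau>)" using \<tau>(1) by simp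
    also have "\<dots> = \<tau> * J - (f \<tau> - f 0)\<^sup>2"
      using False by (simp add: m_def power2_eq_square field_simps)
    finally show ?thesis by simp
  qed simp
  have J0: "0 \<le> J" unfolding J_def by (intro integral_nonneg_AE) auto
  have "(f 0)\<^sup>2 \<le> 2 * (f \<tau>)\<^sup>2 + 2 * (f \<tau> - f 0)\<^sup>2"
    using zero_le_power2[of "2 * f \<tau> - f 0"] by (simp add: power2_eq_square algebra_simps)
  also have "\<dots> \<le> 2 * (f \<tau>)\<^sup>2 + 2 * h * J"
    using cs mult_right_mono[OF \<tau>(2) J0] by simp
  finally have "ennreal ((f 0)\<^sup>2) \<le> ennreal (2 * (f \<tau>)\<^sup>2 + 2 * h * J)" by (rule ennreal_leI)
  also have "\<dots> = 2 * ennreal ((f \<tau>)\<^sup>2) + ennreal (2 * h) * ennreal J"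
    using \<tau> J0 by (simp add: ennreal_plus ennreal_mult)
  also have "ennreal J = (\<integral>\<^sup>+ s. ennreal (indicator ?I s *\<^sub>R (f' s)\<^sup>2) \<partial>lborel)"
    unfolding J_def by (rule nn_integral_eq_integral[symmetric, OF i2]) auto
  \<comment> \<open>The endpoint is a null set. It is removed because in the application it lies on
    the level set, outside the open strip.\<close>
  also have "\<dots> = (\<integral>\<^sup>+ s. ennreal ((f' s)\<^sup>2) * indicator {0..<\<tau>} s \<partial>lborel)"
    by (rule nn_integral_cong_AE) (use AE_lborel_singleton[of \<tau>] in
      \<open>auto simp: indicator_def elim!: eventually_mono\<close>)
  finally show ?thesis .
qed

lemma nn_integral_lborel_translate:
  fixes f :: "'a::euclidean_space \<Rightarrow> ennreal"
  assumes [measurable]: "f \<in> borel_measurable borel"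
  shows "(\<integral>\<^sup>+ y. f (y + c) \<partial>lborel) = (\<integral>\<^sup>+ y. f y \<partial>lborel)"
proof -
  have "(\<integral>\<^sup>+ y. f y \<partial>lborel) = (\<integral>\<^sup>+ y. f y \<partial>distr lborel borel ((+) c))"
    by (simp add: lborel_distr_plus)
  also have "\<dots> = (\<integral>\<^sup>+ y. f (y + c) \<partial>lborel)"
    by (subst nn_integral_distr) (auto simp: add.commute)
  finally show ?thesis by simp
qed

text \<open>After exchanging the integrals, each \<open>s\<close> contributes the same value by
  translation invariance. This supplies the second factor \<open>h\<close> in front of the energy
  term of the strip estimate.\<close>

lemma nn_integral_segment_translates:
  fixes f :: "'a::euclidean_space \<Rightarrow> ennreal"
  assumes [measurable]: "f \<in> borel_measurable borel" and "0 \<le> h"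
  shows "(\<integral>\<^sup>+ y. (\<integral>\<^sup>+ s. f (y + s *\<^sub>R w) * indicator {0..h} s \<partial>lborel) \<partial>lborel)
    = ennreal h * (\<integral>\<^sup>+ z. f z \<partial>lborel)"
proof -
  have "(\<integral>\<^sup>+ y. (\<integral>\<^sup>+ s. f (y + s *\<^sub>R w) * indicator {0..h} s \<partial>lborel) \<partial>lborel)
      = (\<integral>\<^sup>+ s. (\<integral>\<^sup>+ y. f (y + s *\<^sub>R w) * indicator {0..h} s \<partial>lborel) \<partial>lborel)"
    by (rule lborel_pair.Fubini') measurable
  also have "\<dots> = (\<integral>\<^sup>+ s. (\<integral>\<^sup>+ z. f z \<partial>lborel) * indicator {0..h} s \<partial>lborel)"
    by (intro nn_integral_cong) (simp add: nn_integral_multc nn_integral_lborel_translate)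
  also have "\<dots> = ennreal h * (\<integral>\<^sup>+ z. f z \<partial>lborel)"
    using assms(2) by (simp add: nn_integral_cmult_indicator mult.commute)
  finally show ?thesis .
qed

text \<open>Every point \<open>y\<close> of \<open>E\<close> reaches the level set \<open>\<phi> = 0\<close> after a time \<open>\<tau> y \<le> h\<close> in
  direction \<open>w\<close>, at the point \<open>\<gamma> y\<close>. The image of Lebesgue measure on \<open>E\<close> under \<open>\<gamma>\<close> is at most
  \<open>h\<close> times a multiple of Hausdorff measure, because preimages under \<open>\<gamma>\<close> are shadows of length \<open>h\<close>.\<close>

lemma strip_estimate:
  fixes \<phi> v :: "'a::euclidean_space \<Rightarrow> real" and F :: "'a \<Rightarrow> ennreal"
  assumes b: "b \<in> Basis" and d: "DIM('a) = Suc d" "0 < d" and \<sigma>: "\<bar>\<sigma>\<bar> = 1"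
    and w: "w = \<sigma> *\<^sub>R b"
    and c: "0 < c" and h: "0 < h"
    and \<phi>: "continuous_on UNIV \<phi>"
    and d\<phi>: "\<And>y s. ((\<lambda>s. \<phi> (y + s *\<^sub>R w)) has_real_derivative \<phi>' (y + s *\<^sub>R w)) (at s)"
    and v: "continuous_on UNIV v"
    and dv: "\<And>y s. ((\<lambda>s. v (y + s *\<^sub>R w)) has_real_derivative v' (y + s *\<^sub>R w)) (at s)"
    and v': "continuous_on UNIV v'"
    and E [measurable]: "E \<in> sets borel" and W [measurable]: "W \<in> sets borel"
    and F [measurable]: "F \<in> borel_measurable borel"
    and E\<phi>: "\<And>y. y \<in> E \<Longrightarrow> - (c * h) < \<phi> y \<and> \<phi> y < 0"
    and slope: "\<And>y s. y \<in> E \<Longrightarrow> 0 \<le> s \<Longrightarrow> s \<le> h \<Longrightarrow> c \<le> \<phi>' (y + s *\<^sub>R w)"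
    and EW: "\<And>y s. y \<in> E \<Longrightarrow> 0 \<le> s \<Longrightarrow> s \<le> h \<Longrightarrow> - (c * h) < \<phi> (y + s *\<^sub>R w) \<Longrightarrow>
               \<phi> (y + s *\<^sub>R w) < 0 \<Longrightarrow> y + s *\<^sub>R w \<in> W"
    and EF: "\<And>y s. y \<in> E \<Longrightarrow> 0 \<le> s \<Longrightarrow> s \<le> h \<Longrightarrow> \<phi> (y + s *\<^sub>R w) = 0 \<Longrightarrow>
               ennreal ((v (y + s *\<^sub>R w))\<^sup>2) \<le> M * F (y + s *\<^sub>R w)"
  shows "(\<integral>\<^sup>+ y. ennreal ((v y)\<^sup>2) * indicator E y \<partial>lborel) \<le>
    2 * M * ennreal (shadow_const d * h) * (\<integral>\<^sup>+ z. F z \<partial>hausdorff_measure (real d)) +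
    ennreal (2 * h * h) * (\<integral>\<^sup>+ z. ennreal ((v' z)\<^sup>2) * indicator W z \<partial>lborel)"
proof -
  note [measurable] = borel_measurable_continuous_onI[OF \<phi>] borel_measurable_continuous_onI[OF v]
    borel_measurable_continuous_onI[OF v']
  have grow: "c * (s' - s) \<le> \<phi> (y + s' *\<^sub>R w) - \<phi> (y + s *\<^sub>R w)"
    if y: "y \<in> E" and s: "0 \<le> s" "s \<le> s'" "s' \<le> h" for y s s'
  proof (cases "s = s'")
    case False
    then have "s < s'" using s by simp
    then obtain z where z: "s < z" "z < s'"
        "\<phi> (y + s' *\<^sub>R w) - \<phi> (y + s *\<^sub>R w) = (s' - s) * \<phi>' (y + z *\<^sub>R w)"
      using MVT2[of s s' "\<lambda>s. \<phi> (y + s *\<^sub>R w)" "\<lambda>s. \<phi>' (y + s *\<^sub>R w)"] d\<phi> by blast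
    have "c \<le> \<phi>' (y + z *\<^sub>R w)" using slope[OF y, of z] s z by simp
    then show ?thesis using z s by (simp add: mult.commute mult_left_mono)
  qed simp
  \<comment> \<open>The value at \<open>y\<close> is above \<open>- (c * h)\<close> and grows at
    rate at least \<open>c\<close>, so the level set is reached within length
    \<open>h\<close>.\<close>
  have "\<exists>s. 0 \<le> s \<and> s \<le> h \<and> \<phi> (y + s *\<^sub>R w) = 0" if y: "y \<in> E" for y
  proof -
    have "0 \<le> \<phi> (y + h *\<^sub>R w)" using grow[OF y, of 0 h] E\<phi>[OF y] h by simp
    moreover have "\<phi> (y + 0 *\<^sub>R w) \<le> 0" using E\<phi>[OF y] by simp
    moreover have "continuous_on {0..h} (\<lambda>s. \<phi> (y + s *\<^sub>R w))"
      by (intro continuous_on_compose2[OF \<phi>] continuous_intros) auto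
    ultimately show ?thesis using IVT'[of "\<lambda>s. \<phi> (y + s *\<^sub>R w)" 0 0 h] h by auto
  qed
  then obtain \<tau>0 where \<tau>0: "\<And>y. y \<in> E \<Longrightarrow> 0 \<le> \<tau>0 y \<and> \<tau>0 y \<le> h \<and> \<phi> (y + \<tau>0 y *\<^sub>R w) = 0"
    by metis
  define \<tau> where "\<tau> y = (if y \<in> E then \<tau>0 y else 0)" for y
  define \<gamma> where "\<gamma> y = y + \<tau> y *\<^sub>R w" for y
  have \<tau>: "0 \<le> \<tau> y" "\<tau> y \<le> h" "\<phi> (\<gamma> y) = 0" if "y \<in> E" for y
    using \<tau>0[OF that] that by (auto simp: \<tau>_def \<gamma>_def)
  have less_\<tau>: "s < \<tau> y \<longleftrightarrow> \<phi> (y + s *\<^sub>R w) < 0" if y: "y \<in> E" and s: "0 \<le> s" "s \<le> h" for y s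
  proof
    assume "s < \<tau> y"
    then have "0 < c * (\<tau> y - s)" using c by simp
    then show "\<phi> (y + s *\<^sub>R w) < 0"
      using grow[OF y s(1), of "\<tau> y"] \<tau>[OF y] \<open>s < \<tau> y\<close> by (simp add: \<gamma>_def)
  next
    assume neg: "\<phi> (y + s *\<^sub>R w) < 0"
    show "s < \<tau> y"
    proof (rule ccontr)
      assume "\<not> s < \<tau> y"
      then have "0 \<le> c * (s - \<tau> y)" "\<tau> y \<le> s" using c by auto
      then show False using grow[OF y \<tau>(1)[OF y], of s] \<tau>[OF y] s neg by (simp add: \<gamma>_def)
    qed
  qed
  \<comment> \<open>\<tau> arises from a choice, but on \<open>E\<close> the level set is crossed
    only once. Hence \<open>less_\<tau>\<close> describes each superlevel set by the sign of \<phi>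
    at a fixed displacement.\<close>
  have [measurable]: "\<tau> \<in> borel_measurable borel"
  proof (rule borel_measurableI_greater)
    fix a :: real
    consider "a < 0" | "0 \<le> a" "a \<le> h" | "h < a" by linarith
    then show "{y \<in> space borel. a < \<tau> y} \<in> sets borel"
    proof cases
      case 1
      then have "{y \<in> space borel. a < \<tau> y} = UNIV"
        using \<tau>(1) by (auto simp: \<tau>_def intro: less_le_trans)
      then show ?thesis by simp
    next
      case 2
      then have "{y \<in> space borel. a < \<tau> y} = {y \<in> E. \<phi> (y + a *\<^sub>R w) < 0}"
        using less_\<tau> by (auto simp: \<tau>_def split: if_splits)
      also have "\<dots> = E \<inter> {y \<in> space borel. \<phi> (y + a *\<^sub>R w) < 0}" by auto
      also have "\<dots> \<in> sets borel" by measurable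
      finally show ?thesis .
    next
      case 3
      then have "{y \<in> space borel. a < \<tau> y} = {}"
        using \<tau>(2) h by (force simp: \<tau>_def split: if_splits)
      then show ?thesis by simp
    qed
  qed
  have [measurable]: "\<gamma> \<in> borel_measurable borel" unfolding \<gamma>_def[abs_def] by measurable
  define g where "g z = ennreal ((v' z)\<^sup>2) * indicator W z" for z
  have [measurable]: "g \<in> borel_measurable borel" unfolding g_def[abs_def] by measurable
  have pointwise: "ennreal ((v y)\<^sup>2) * indicator E y \<le> 2 * M * (F (\<gamma> y) * indicator E y) +
      ennreal (2 * h) * (\<integral>\<^sup>+ s. g (y + s *\<^sub>R w) * indicator {0..h} s \<partial>lborel)" for y
  proof (cases "y \<in> E")
    case y: True
    have "ennreal ((v (y + 0 *\<^sub>R w))\<^sup>2) \<le> 2 * ennreal ((v (y + \<tau> y *\<^sub>R w))\<^sup>2) +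
        ennreal (2 * h) * (\<integral>\<^sup>+ s. ennreal ((v' (y + s *\<^sub>R w))\<^sup>2) * indicator {0..<\<tau> y} s \<partial>lborel)"
      by (rule sq_le_endpoint_plus_energy[OF \<tau>(1,2)[OF y] dv])
         (intro continuous_on_compose2[OF v'] continuous_intros, auto)
    also have "\<dots> \<le> 2 * (M * F (\<gamma> y)) + ennreal (2 * h) * (\<integral>\<^sup>+ s. g (y + s *\<^sub>R w) * indicator {0..h} s \<partial>lborel)"
    proof (intro add_mono mult_left_mono nn_integral_mono)
      show "ennreal ((v (y + \<tau> y *\<^sub>R w))\<^sup>2) \<le> M * F (\<gamma> y)"
        using EF[OF y \<tau>(1,2)[OF y]] \<tau>(3)[OF y] by (simp add: \<gamma>_def)
      fix s
      show "ennreal ((v' (y + s *\<^sub>R w))\<^sup>2) * indicator {0..<\<tau> y} s \<le> g (y + s *\<^sub>R w) * indicator {0..h} s"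
      proof (cases "s \<in> {0..<\<tau> y}")
        case True
        then have s: "0 \<le> s" "s \<le> h" using \<tau>(2)[OF y] by auto
        \<comment> \<open>Before the hitting time \<phi> is still negative and, growing along the
          segment, stays above \<open>- (c * h)\<close>; the segment therefore runs inside
          \<open>W\<close>.\<close>
        have "0 \<le> c * (s - 0)" using c s by simp
        then have "- (c * h) < \<phi> (y + s *\<^sub>R w)"
          using grow[OF y order_refl s] E\<phi>[OF y] by simp
        then have "y + s *\<^sub>R w \<in> W" using EW[OF y s] less_\<tau>[OF y s] True by simp
        then show ?thesis using s by (simp add: g_def indicator_def)
      qed simp
    qed auto
    finally show ?thesis using y by (simp add: mult.assoc)
  qed simp
  have shadow: "(\<integral>\<^sup>+ y. F (\<gamma> y) * indicator E y \<partial>lborel) \<le>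
      ennreal (shadow_const d * h) * (\<integral>\<^sup>+ z. F z \<partial>hausdorff_measure (real d))"
  proof -
    let ?D = "density lborel (indicator E)"
    let ?N = "scale_measure (ennreal (shadow_const d * h)) (hausdorff_measure (real d) :: 'a measure)"
    have "(\<integral>\<^sup>+ y. F (\<gamma> y) * indicator E y \<partial>lborel) = (\<integral>\<^sup>+ y. F (\<gamma> y) \<partial>?D)"
      by (subst nn_integral_density) (auto simp: mult.commute)
    also have "\<dots> = (\<integral>\<^sup>+ z. F z \<partial>distr ?D borel \<gamma>)"
      by (subst nn_integral_distr) auto
    also have "\<dots> \<le> (\<integral>\<^sup>+ z. F z \<partial>?N)"
    proof (rule nn_integral_mono_measure)
      show "sets (distr ?D borel \<gamma>) = sets ?N" by simp
      show "distr ?D borel \<gamma> \<le> ?N"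
        unfolding le_measure[OF \<open>sets (distr ?D borel \<gamma>) = sets ?N\<close>]
      proof
        fix A assume "A \<in> sets (distr ?D borel \<gamma>)"
        then have [measurable]: "A \<in> sets borel" by simp
        have T: "E \<inter> \<gamma> -` A \<in> sets borel"
          using measurable_sets[of \<gamma> borel borel A] E by auto
        have "emeasure (distr ?D borel \<gamma>) A = emeasure ?D (\<gamma> -` A)"
          by (subst emeasure_distr) auto
        also have "\<dots> = emeasure lborel (E \<inter> \<gamma> -` A)"
        proof -
          have "\<gamma> -` A \<in> sets borel" using measurable_sets[of \<gamma> borel borel A] by simp
          then show ?thesis by (subst emeasure_density) (auto simp flip: indicator_inter_arith)
        qed
        also have "\<dots> \<le> ennreal (shadow_const d * h) * hausdorff_outer (real d) A"
        proof (rule emeasure_shadow_le_hausdorff_outer[OF b d h \<sigma> T])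
          fix y assume y: "y \<in> E \<inter> \<gamma> -` A"
          then show "\<exists>s\<in>{0..h}. y + (s * \<sigma>) *\<^sub>R b \<in> A"
            using \<tau>(1,2)[of y] by (intro bexI[of _ "\<tau> y"]) (auto simp: \<gamma>_def w)
        qed
        also have "\<dots> = emeasure ?N A"
          using d(2) by (simp add: emeasure_hausdorff_measure)
        finally show "emeasure (distr ?D borel \<gamma>) A \<le> emeasure ?N A" .
      qed
    qed
    also have "\<dots> = ennreal (shadow_const d * h) * (\<integral>\<^sup>+ z. F z \<partial>hausdorff_measure (real d))"
      by (rule nn_integral_scale_measure) measurable
    finally show ?thesis .
  qed
  have "(\<integral>\<^sup>+ y. ennreal ((v y)\<^sup>2) * indicator E y \<partial>lborel) \<le>
      (\<integral>\<^sup>+ y. 2 * M * (F (\<gamma> y) * indicator E y) +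
        ennreal (2 * h) * (\<integral>\<^sup>+ s. g (y + s *\<^sub>R w) * indicator {0..h} s \<partial>lborel) \<partial>lborel)"
    by (intro nn_integral_mono pointwise)
  also have "\<dots> = 2 * M * (\<integral>\<^sup>+ y. F (\<gamma> y) * indicator E y \<partial>lborel) +
      ennreal (2 * h) * (\<integral>\<^sup>+ y. (\<integral>\<^sup>+ s. g (y + s *\<^sub>R w) * indicator {0..h} s \<partial>lborel) \<partial>lborel)"
    by (subst nn_integral_add) (auto simp: nn_integral_cmult)
  also have "\<dots> = 2 * M * (\<integral>\<^sup>+ y. F (\<gamma> y) * indicator E y \<partial>lborel) +
      ennreal (2 * h * h) * (\<integral>\<^sup>+ z. g z \<partial>lborel)"
    using h by (subst nn_integral_segment_translates) (auto simp: ennreal_mult mult.assoc)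
  also have "\<dots> \<le> 2 * M * (ennreal (shadow_const d * h) * (\<integral>\<^sup>+ z. F z \<partial>hausdorff_measure (real d))) +
      ennreal (2 * h * h) * (\<integral>\<^sup>+ z. g z \<partial>lborel)"
    by (intro add_mono mult_left_mono shadow) auto
  finally show ?thesis by (simp add: g_def mult.assoc)
qed

section \<open>The strip along the boundary\<close>

text \<open>A polynomial that is positive exactly at the interior times different from 0. The square
  keeps it positive on both sides of 0 when the interval is \<open>(-1, 1)\<close>.\<close>

definition time_profile :: "((real^'n::finite) \<times> real \<Rightarrow> real) \<Rightarrow> real \<Rightarrow> real" where
  "time_profile \<phi> t = t\<^sup>2 * ((t - t0 \<phi>) * (tT \<phi> - t))"

text \<open>The non-strict inequalities make the set compact, away from the end times and from time
  0. No condition on \<phi> is imposed, because segments are followed up to the level set.\<close>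

definition bulk :: "((real^'n::finite) \<times> real \<Rightarrow> real) \<Rightarrow> nat \<Rightarrow> real \<Rightarrow> ((real^'n) \<times> real) set" where
  "bulk \<phi> n r = {z. 1 \<le> real n * time_profile \<phi> (snd z) \<and> norm (fst z) \<le> r}"

definition strip :: "((real^'n::finite) \<times> real \<Rightarrow> real) \<Rightarrow> nat \<Rightarrow> real \<Rightarrow> real \<Rightarrow> ((real^'n) \<times> real) set" where
  "strip \<phi> n r \<epsilon> = {z \<in> bulk \<phi> n r. - \<epsilon> < \<phi> z \<and> \<phi> z < 0}"

lemma t0_less_tT: "t0 \<phi> < tT \<phi>" and t0_ge: "-1 \<le> t0 \<phi>" and tT_le: "tT \<phi> \<le> 1"
  by (auto simp: t0_def tT_def)

lemma time_profile_pos_iff: "0 < time_profile \<phi> t \<longleftrightarrow> t \<noteq> 0 \<and> t0 \<phi> < t \<and> t < tT \<phi>"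
  using t0_less_tT[of \<phi>] by (auto simp: time_profile_def zero_less_mult_iff)

lemma bulk_time:
  assumes "z \<in> bulk \<phi> n r"
  shows "snd z \<noteq> 0" "t0 \<phi> < snd z" "snd z < tT \<phi>"
proof -
  have "1 \<le> real n * time_profile \<phi> (snd z)" using assms by (simp add: bulk_def)
  then have "0 < time_profile \<phi> (snd z)"
    by (metis less_le_trans not_less of_nat_0_le_iff zero_less_one mult_nonneg_nonpos)
  then show "snd z \<noteq> 0" "t0 \<phi> < snd z" "snd z < tT \<phi>" by (auto simp: time_profile_pos_iff)
qed

lemma compact_bulk: "compact (bulk \<phi> n r)"
proof -
  have "closed (bulk \<phi> n r)"
    unfolding bulk_def time_profile_def by (intro closed_Collect_conj closed_Collect_le continuous_intros)
  moreover have "bounded (bulk \<phi> n r)"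
  proof (rule boundedI)
    fix z assume z: "z \<in> bulk \<phi> n r"
    have "\<bar>snd z\<bar> \<le> 1" using bulk_time[OF z] t0_ge[of \<phi>] tT_le[of \<phi>] by linarith
    then show "norm z \<le> r + 1"
      using z norm_Pair_le[of "fst z" "snd z"] by (simp add: bulk_def)
  qed
  ultimately show ?thesis by (simp add: compact_eq_bounded_closed)
qed

lemma open_QQ:
  assumes "smooth \<phi>"
  shows "open (QQ \<phi>)"
proof -
  have "QQ \<phi> = {z. t0 \<phi> < snd z} \<inter> {z. snd z < tT \<phi>} \<inter> {z. \<phi> z < 0}"
    by (auto simp: QQ_def)
  then show ?thesis
    using smooth_continuous_on[OF assms]
    by (auto intro!: open_Collect_less continuous_intros)
qed

lemma strip_subset_QQ: "strip \<phi> n r \<epsilon> \<subseteq> QQ \<phi>"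
  using bulk_time by (fastforce simp: strip_def QQ_def)

lemma GammaQ_iff: "z \<in> GammaQ \<phi> \<longleftrightarrow> t0 \<phi> < snd z \<and> snd z < tT \<phi> \<and> \<phi> z = 0"
  by (cases z) (simp add: GammaQ_def)

lemma strip_borel: "smooth \<phi> \<Longrightarrow> strip \<phi> n r \<epsilon> \<in> sets borel"
proof -
  assume "smooth \<phi>"
  then have [measurable]: "\<phi> \<in> borel_measurable borel" by (rule smooth_borel_measurable)
  have "strip \<phi> n r \<epsilon> = bulk \<phi> n r \<inter> {z \<in> space borel. - \<epsilon> < \<phi> z \<and> \<phi> z < 0}"
    by (auto simp: strip_def)
  also have "\<dots> \<in> sets borel"
    using borel_compact[OF compact_bulk[of \<phi> n r]] by measurable
  finally show ?thesis .
qed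

section \<open>Squared norms over Borel subsets\<close>

lemma sqnorm_eq_lborel:
  assumes "A \<in> sets borel"
  shows "sqnorm A f = (\<integral>\<^sup>+ z. ennreal ((f z)\<^sup>2) * indicator A z \<partial>lborel)"
  unfolding sqnorm_def using assms
  by (subst nn_integral_restrict_space) (auto simp: nn_integral_completion)

lemma sqnorm_eq_indicator:
  assumes "A \<in> sets borel" "S \<in> sets borel" "A \<subseteq> S"
  shows "sqnorm A f = (\<integral>\<^sup>+ z. ennreal ((f z)\<^sup>2) * indicator A z \<partial>lebesgue_on S)"
proof -
  have "(\<integral>\<^sup>+ z. ennreal ((f z)\<^sup>2) * indicator A z \<partial>lebesgue_on S)
      = (\<integral>\<^sup>+ z. ennreal ((f z)\<^sup>2) * indicator A z * indicator S z \<partial>lborel)"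
    using assms by (subst nn_integral_restrict_space) (auto simp: nn_integral_completion)
  also have "\<dots> = sqnorm A f"
    unfolding sqnorm_eq_lborel[OF assms(1)] using assms(3)
    by (intro nn_integral_cong) (auto simp: indicator_def)
  finally show ?thesis by simp
qed

lemma sqnorm_subset: "A \<in> sets borel \<Longrightarrow> S \<in> sets borel \<Longrightarrow> A \<subseteq> S \<Longrightarrow> sqnorm A f \<le> sqnorm S f"
  unfolding sqnorm_eq_lborel by (intro nn_integral_mono mult_left_mono) (auto simp: indicator_def)

lemma sqnorm_UN_le:
  assumes "finite I" "\<And>i. i \<in> I \<Longrightarrow> E i \<in> sets borel" "A \<in> sets borel" "A \<subseteq> (\<Union>i\<in>I. E i)"
    and [measurable]: "f \<in> borel_measurable borel"
  shows "sqnorm A f \<le> (\<Sum>i\<in>I. sqnorm (E i) f)"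
proof -
  have "sqnorm A f \<le> (\<integral>\<^sup>+ z. (\<Sum>i\<in>I. ennreal ((f z)\<^sup>2) * indicator (E i) z) \<partial>lborel)"
    unfolding sqnorm_eq_lborel[OF assms(3)]
  proof (intro nn_integral_mono)
    fix z
    show "ennreal ((f z)\<^sup>2) * indicator A z \<le> (\<Sum>i\<in>I. ennreal ((f z)\<^sup>2) * indicator (E i) z)"
    proof (cases "z \<in> A")
      case True
      then obtain i where i: "i \<in> I" "z \<in> E i" using assms(4) by blast
      then show ?thesis
        using member_le_sum[of i I "\<lambda>i. ennreal ((f z)\<^sup>2) * indicator (E i) z"] assms(1) True by simp
    qed simp
  qed
  also have "\<dots> = (\<Sum>i\<in>I. sqnorm (E i) f)"
    using assms(2) by (subst nn_integral_sum) (auto simp: sqnorm_eq_lborel)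
  finally show ?thesis .
qed

lemma continuous_on_grad_x: "smooth \<phi> \<Longrightarrow> continuous_on S (grad_x \<phi>)"
  unfolding grad_x_def[abs_def]
  by (intro continuous_on_vec_lambda smooth_continuous_on smooth_dx)

lemma continuous_on_dt: "smooth \<phi> \<Longrightarrow> continuous_on S (dt \<phi>)"
  unfolding dt_def by (intro smooth_continuous_on smooth_partial) (auto simp: Basis_prod_def)

lemma dx_has_derivative:
  assumes "smooth f"
  shows "((\<lambda>s. f (y + s *\<^sub>R (\<sigma> *\<^sub>R (axis i 1, 0)))) has_real_derivative \<sigma> * dx i f (y + s *\<^sub>R (\<sigma> *\<^sub>R (axis i 1, 0)))) (at s)"
proof -
  have "((\<lambda>s. f (y + (s * \<sigma>) *\<^sub>R (axis i 1, 0))) has_real_derivative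
      dx i f (y + (s * \<sigma>) *\<^sub>R (axis i 1, 0)) * \<sigma>) (at s)"
    unfolding dx_def
    by (rule DERIV_chain2[where f = "\<lambda>h. f (y + h *\<^sub>R (axis i 1, 0))" and g = "\<lambda>s. s * \<sigma>",
          OF smooth_has_partial_at[OF assms axis_zero_Basis]]) (auto intro!: derivative_eq_intros)
  then show ?thesis by (simp add: mult.commute)
qed

text \<open>On the compact part of the level set the weight is continuous and positive: the gradient
  does not vanish there, and \<open>snd z \<noteq> 0\<close> keeps
  \<open>sqrt \<bar>snd z\<bar>\<close> positive.\<close>

lemma weight_bounded_below:
  assumes sm: "smooth \<phi>"
    and crit: "\<forall>z\<in>closure (GammaQ \<phi>). grad_x \<phi> z = 0 \<longrightarrow> z = (0,0)"
  obtains m where "0 < m" "\<And>z. z \<in> bulk \<phi> n r \<Longrightarrow> \<phi> z = 0 \<Longrightarrow> m \<le> weight \<phi> z"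
proof -
  let ?S = "bulk \<phi> n r \<inter> {z. \<phi> z = 0}"
  have "compact ?S"
    by (intro compact_Int_closed compact_bulk closed_Collect_eq smooth_continuous_on sm continuous_intros)
  have grad: "grad_x \<phi> z \<noteq> 0" if "z \<in> ?S" for z
  proof -
    have "z \<in> GammaQ \<phi>" using that bulk_time[of z \<phi> n r] by (auto simp: GammaQ_iff)
    then show ?thesis using crit bulk_time(1)[of z \<phi> n r] that closure_subset by fastforce
  qed
  have cont: "continuous_on ?S (weight \<phi>)"
    unfolding weight_def[abs_def] Let_def
    by (cases "all_eig_pos \<phi>"; simp only: if_True if_False;
        intro continuous_intros continuous_on_grad_x[OF sm] continuous_on_dt[OF sm])
       (use grad in \<open>auto simp: add_nonneg_eq_0_iff\<close>)
  have pos: "0 < weight \<phi> z" if "z \<in> ?S" for z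
    using bulk_time(1)[of z \<phi> n r] that
    by (auto simp: weight_def Let_def intro!: divide_pos_pos add_pos_nonneg)
  show ?thesis
  proof (cases "?S = {}")
    case True then show ?thesis by (intro that[of 1]) auto
  next
    case False
    obtain z where z: "z \<in> ?S" "\<And>y. y \<in> ?S \<Longrightarrow> weight \<phi> z \<le> weight \<phi> y"
      using continuous_attains_inf[OF \<open>compact ?S\<close> False cont] by blast
    then show ?thesis using pos by (intro that[of "weight \<phi> z"]) auto
  qed
qed

lemma borel_measurable_weighted_trace:
  fixes \<phi> v :: "(real^'n::finite) \<times> real \<Rightarrow> real"
  assumes "smooth \<phi>" "smooth v"
  shows "(\<lambda>z. indicator (GammaQ \<phi>) z * ennreal ((v z)\<^sup>2 * weight \<phi> z)) \<in> borel_measurable borel"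
proof -
  have [measurable]: "\<phi> \<in> borel_measurable borel" "v \<in> borel_measurable borel"
    using assms by (auto intro: smooth_borel_measurable)
  have [measurable]: "(snd :: (real^'n) \<times> real \<Rightarrow> real) \<in> borel_measurable borel"
    by (intro borel_measurable_continuous_onI continuous_intros)
  have [measurable]: "grad_x \<phi> \<in> borel_measurable borel" "dt \<phi> \<in> borel_measurable borel"
    using assms by (auto intro!: borel_measurable_continuous_onI continuous_on_grad_x continuous_on_dt)
  have [measurable]: "weight \<phi> \<in> borel_measurable borel"
    unfolding weight_def[abs_def] Let_def by (cases "all_eig_pos \<phi>"; simp only: if_True if_False; measurable)
  have "GammaQ \<phi> = {z \<in> space borel. t0 \<phi> < snd z \<and> snd z < tT \<phi> \<and> \<phi> z = 0}"
    by (auto simp: GammaQ_iff)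
  also have "\<dots> \<in> sets borel" by measurable
  finally have [measurable]: "GammaQ \<phi> \<in> sets borel" .
  show ?thesis by measurable
qed

text \<open>Where \<open>\<bar>\<phi>\<bar>\<close> is small, some \<open>\<plusminus>dx i \<phi>\<close> is at least \<open>2 * c\<close>, so the strip splits into
  finitely many pieces on which \<open>strip_estimate\<close> applies in a coordinate direction.\<close>

lemma strip_bound:
  fixes \<phi> :: "(real^'n::finite) \<times> real \<Rightarrow> real"
  assumes sm: "smooth \<phi>"
    and crit: "\<forall>z\<in>closure (GammaQ \<phi>). grad_x \<phi> z = 0 \<longrightarrow> z = (0,0)"
  shows "\<exists>C D \<epsilon>0. 0 < C \<and> 0 < D \<and> 0 < \<epsilon>0 \<and> (\<forall>\<epsilon> v. 0 < \<epsilon> \<and> \<epsilon> < \<epsilon>0 \<and> smooth v \<longrightarrow>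
    sqnorm (strip \<phi> n r \<epsilon>) v \<le> ennreal (C * \<epsilon>) * L2w_sq \<phi> v +
      ennreal (D * \<epsilon>\<^sup>2) * (\<Sum>i\<in>UNIV. sqnorm (strip \<phi> n (r+1) \<epsilon>) (dx i v)))"
proof -
  let ?K = "bulk \<phi> n r" and ?K1 = "bulk \<phi> n (r+1)"
  let ?d = "real CARD('n)"
  have d0: "0 < ?d" by simp
  have KK1: "?K \<subseteq> ?K1" by (auto simp: bulk_def)
  \<comment> \<open>Zeros of \<phi> in this compact set are boundary points with nonzero time, hence
    not critical. So \<phi> and its gradient have no common zero, and compactness makes this
    quantitative.\<close>
  obtain m0 where m0: "0 < m0" "\<And>z. z \<in> ?K \<Longrightarrow> m0 \<le> \<bar>\<phi> z\<bar> + norm (grad_x \<phi> z)"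
  proof (cases "?K = {}")
    case True then show ?thesis by (intro that[of 1]) auto
  next
    case False
    have "continuous_on ?K (\<lambda>z. \<bar>\<phi> z\<bar> + norm (grad_x \<phi> z))"
      by (intro continuous_intros continuous_on_grad_x smooth_continuous_on sm)
    from continuous_attains_inf[OF compact_bulk False this]
    obtain z where z: "z \<in> ?K" "\<And>y. y \<in> ?K \<Longrightarrow> \<bar>\<phi> z\<bar> + norm (grad_x \<phi> z) \<le> \<bar>\<phi> y\<bar> + norm (grad_x \<phi> y)"
      by blast
    have "0 < \<bar>\<phi> z\<bar> + norm (grad_x \<phi> z)"
    proof (cases "\<phi> z = 0")
      case True
      then have "z \<in> GammaQ \<phi>" using z(1) bulk_time[of z \<phi> n r] by (auto simp: GammaQ_iff)
      then have "grad_x \<phi> z \<noteq> 0" using crit bulk_time(1)[OF z(1)] closure_subset by fastforce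
      then show ?thesis by (simp add: add_nonneg_pos)
    qed (simp add: add_pos_nonneg)
    then show ?thesis using z(2) that by blast
  qed
  \<comment> \<open>Where \<open>\<bar>\<phi> z\<bar> < m0/2\<close>, the absolute partial
    derivatives sum to more than \<open>m0/2\<close>, so one of the \<open>?d\<close> terms is at
    least \<open>m0 / (2 * ?d) = 2 * c\<close>. Half of this may be lost along a segment.\<close>
  define c where "c = m0 / (4 * ?d)"
  have c: "0 < c" using m0(1) d0 by (simp add: c_def)
  have "uniformly_continuous_on ?K1 (grad_x \<phi>)"
    by (intro compact_uniformly_continuous continuous_on_grad_x compact_bulk sm)
  then obtain \<delta> where \<delta>: "0 < \<delta>" "\<And>y z. y \<in> ?K1 \<Longrightarrow> z \<in> ?K1 \<Longrightarrow> dist z y < \<delta> \<Longrightarrow> dist (grad_x \<phi> z) (grad_x \<phi> y) < c"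
    using c unfolding uniformly_continuous_on_def by blast
  obtain m where m: "0 < m" "\<And>z. z \<in> ?K1 \<Longrightarrow> \<phi> z = 0 \<Longrightarrow> m \<le> weight \<phi> z"
    using weight_bounded_below[OF sm crit, where n=n and r="r+1"] by blast
  \<comment> \<open>\<open>m0/2\<close> secures the gradient bound. The other term makes the length
    \<open>h = \<epsilon> / c\<close> smaller than 1, so that radius \<open>r + 1\<close> suffices,
    and smaller than \<delta>, so that the gradient changes by less than \<open>c\<close>.\<close>
  define \<epsilon>0 where "\<epsilon>0 = min (m0/2) (c * min 1 \<delta>)"
  \<comment> \<open>The factor \<open>4 * ?d\<close> is 2 from the strip estimate times the
    \<open>2 * ?d\<close> pieces of the cover; \<open>h = \<epsilon> / c\<close> accounts for the
    powers of \<open>c\<close>.\<close>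
  define C where "C = 4 * ?d * (1/m) * (shadow_const CARD('n) / c)"
  define D where "D = 4 * ?d / c\<^sup>2"
  have sc: "0 < shadow_const CARD('n)"
    unfolding shadow_const_def by (intro mult_pos_pos divide_pos_pos Gamma_real_pos) auto
  have "0 < C" "0 < D" "0 < \<epsilon>0"
    using d0 c m0(1) m(1) \<delta>(1) sc by (auto simp: C_def D_def \<epsilon>0_def)
  moreover have "sqnorm (strip \<phi> n r \<epsilon>) v \<le> ennreal (C * \<epsilon>) * L2w_sq \<phi> v +
      ennreal (D * \<epsilon>\<^sup>2) * (\<Sum>i\<in>UNIV. sqnorm (strip \<phi> n (r+1) \<epsilon>) (dx i v))"
    if \<epsilon>: "0 < \<epsilon>" "\<epsilon> < \<epsilon>0" and v: "smooth v" for \<epsilon> v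
  proof -
    define h where "h = \<epsilon> / c"
    have "c * min 1 \<delta> \<le> c * 1" "c * min 1 \<delta> \<le> c * \<delta>"
      using c by (intro mult_left_mono; simp)+
    then have "\<epsilon> < c" "\<epsilon> < c * \<delta>" using \<epsilon>(2) unfolding \<epsilon>0_def by linarith+
    then have h: "0 < h" "h < 1" "h < \<delta>" "c * h = \<epsilon>"
      using \<epsilon>(1) c by (auto simp: h_def field_simps)
    define E where "E = (\<lambda>(i, \<sigma>). {z \<in> strip \<phi> n r \<epsilon>. 2 * c \<le> \<sigma> * dx i \<phi> z})"
    let ?I = "UNIV \<times> {-1, 1} :: ('n \<times> real) set"
    let ?W = "strip \<phi> n (r+1) \<epsilon>"
    have Eb: "E p \<in> sets borel" for p
    proof -
      obtain i \<sigma> where p: "p = (i, \<sigma>)" by fastforce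
      have [measurable]: "dx i \<phi> \<in> borel_measurable borel" by (intro smooth_borel_measurable smooth_dx sm)
      have "E p = strip \<phi> n r \<epsilon> \<inter> {z \<in> space borel. 2 * c \<le> \<sigma> * dx i \<phi> z}"
        by (auto simp: E_def p)
      also have "\<dots> \<in> sets borel" using strip_borel[OF sm, of n r \<epsilon>] by measurable
      finally show ?thesis .
    qed
    have cover: "strip \<phi> n r \<epsilon> \<subseteq> (\<Union>p\<in>?I. E p)"
    proof
      fix z assume z: "z \<in> strip \<phi> n r \<epsilon>"
      then have "\<bar>\<phi> z\<bar> < m0/2" "z \<in> ?K" using \<epsilon> by (auto simp: strip_def \<epsilon>0_def)
      then have "m0/2 < norm (grad_x \<phi> z)" using m0(2)[of z] by linarith
      also have "\<dots> \<le> (\<Sum>i\<in>UNIV. \<bar>dx i \<phi> z\<bar>)"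
        using norm_le_l1_cart[of "grad_x \<phi> z"] by (simp add: grad_x_def)
      finally have "m0/2 < (\<Sum>i\<in>UNIV. \<bar>dx i \<phi> z\<bar>)" .
      then obtain i where "2 * c \<le> \<bar>dx i \<phi> z\<bar>"
      proof (rule_tac ccontr)
        assume "m0/2 < (\<Sum>i\<in>UNIV. \<bar>dx i \<phi> z\<bar>)" and "\<not> thesis"
        then have "\<bar>dx i \<phi> z\<bar> \<le> 2 * c" for i using that by (meson linear)
        then have "(\<Sum>i\<in>UNIV. \<bar>dx i \<phi> z\<bar>) \<le> ?d * (2 * c)"
          using sum_bounded_above[of UNIV "\<lambda>i. \<bar>dx i \<phi> z\<bar>" "2 * c"] by simp
        also have "\<dots> = m0/2" using d0 by (simp add: c_def)
        finally show False using \<open>m0/2 < (\<Sum>i\<in>UNIV. \<bar>dx i \<phi> z\<bar>)\<close> by simp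
      qed
      then have "z \<in> E (i, if 0 \<le> dx i \<phi> z then 1 else -1)" using z by (auto simp: E_def)
      then show "z \<in> (\<Union>p\<in>?I. E p)" by (intro UN_I[of "(i, if 0 \<le> dx i \<phi> z then 1 else -1)"]) auto
    qed
    have one: "sqnorm (E (i, \<sigma>)) v \<le> ennreal (2 * (1/m) * (shadow_const CARD('n) * h)) * L2w_sq \<phi> v +
        ennreal (2 * h * h) * sqnorm ?W (dx i v)" if \<sigma>: "\<sigma> \<in> {-1, 1}" for i \<sigma>
    proof -
      let ?w = "\<sigma> *\<^sub>R (axis i 1, 0) :: (real^'n) \<times> real"
      have \<sigma>1: "\<bar>\<sigma>\<bar> = 1" using \<sigma> by auto
      have nw: "norm ?w = 1" using \<sigma>1 by (simp add: norm_Pair)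
      have inK1: "y + s *\<^sub>R ?w \<in> ?K1" if "y \<in> E (i, \<sigma>)" "0 \<le> s" "s \<le> h" for y s
      proof -
        have "norm (fst y + (s * \<sigma>) *\<^sub>R axis i 1) \<le> norm (fst y) + \<bar>s * \<sigma>\<bar>"
          using norm_triangle_ineq[of "fst y" "(s * \<sigma>) *\<^sub>R axis i 1"] by simp
        moreover have "\<bar>s * \<sigma>\<bar> \<le> 1" using that h \<sigma>1 by (simp add: abs_mult)
        ultimately show ?thesis using that by (auto simp: E_def strip_def bulk_def)
      qed
      let ?F = "\<lambda>z. indicator (GammaQ \<phi>) z * ennreal ((v z)\<^sup>2 * weight \<phi> z)"
      have "(\<integral>\<^sup>+ y. ennreal ((v y)\<^sup>2) * indicator (E (i, \<sigma>)) y \<partial>lborel) \<le>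
        2 * ennreal (1/m) * ennreal (shadow_const CARD('n) * h) * (\<integral>\<^sup>+ z. ?F z \<partial>hausdorff_measure (real CARD('n))) +
        ennreal (2 * h * h) * (\<integral>\<^sup>+ z. ennreal ((\<sigma> * dx i v z)\<^sup>2) * indicator ?W z \<partial>lborel)"
      proof (rule strip_estimate[OF axis_zero_Basis _ _ \<sigma>1 refl c h(1) smooth_continuous_on[OF sm]
            dx_has_derivative[OF sm] smooth_continuous_on[OF v] dx_has_derivative[OF v] _ Eb
            strip_borel[OF sm] borel_measurable_weighted_trace[OF sm v]])
        show "DIM((real^'n) \<times> real) = Suc CARD('n)" by simp
        show "0 < CARD('n)" by simp
        show "continuous_on UNIV (\<lambda>z. \<sigma> * dx i v z)"
          by (intro continuous_intros smooth_continuous_on smooth_dx v)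
        show "- (c * h) < \<phi> y \<and> \<phi> y < 0" if "y \<in> E (i, \<sigma>)" for y
          using that h(4) by (auto simp: E_def strip_def)
        fix y s assume y: "y \<in> E (i, \<sigma>)" and s: "0 \<le> s" "s \<le> h"
        show "c \<le> \<sigma> * dx i \<phi> (y + s *\<^sub>R ?w)"
        proof -
          have "dist (y + s *\<^sub>R ?w) y < \<delta>"
            using s h nw \<sigma>1 by (simp add: dist_norm norm_Pair abs_mult)
          moreover have "y \<in> ?K1" using y KK1 by (auto simp: E_def strip_def)
          ultimately have "dist (grad_x \<phi> (y + s *\<^sub>R ?w)) (grad_x \<phi> y) < c"
            using \<delta>(2) inK1[OF y s] by blast
          then have "\<bar>(grad_x \<phi> (y + s *\<^sub>R ?w) - grad_x \<phi> y) $ i\<bar> < c"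
            using component_le_norm_cart[of "grad_x \<phi> (y + s *\<^sub>R ?w) - grad_x \<phi> y" i]
            unfolding dist_norm by linarith
          then have "\<bar>dx i \<phi> (y + s *\<^sub>R ?w) - dx i \<phi> y\<bar> < c" by (simp add: grad_x_def)
          moreover have "2 * c \<le> \<sigma> * dx i \<phi> y" using y by (simp add: E_def)
          ultimately show ?thesis using \<sigma> by auto
        qed
        show "y + s *\<^sub>R ?w \<in> ?W" if "- (c * h) < \<phi> (y + s *\<^sub>R ?w)" "\<phi> (y + s *\<^sub>R ?w) < 0"
          using that inK1[OF y s] h(4) by (simp add: strip_def)
        assume zero: "\<phi> (y + s *\<^sub>R ?w) = 0"
        let ?z = "y + s *\<^sub>R ?w"
        have "?z \<in> GammaQ \<phi>" using zero bulk_time[OF inK1[OF y s]] unfolding GammaQ_iff by blast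
        moreover have "(v ?z)\<^sup>2 \<le> 1/m * ((v ?z)\<^sup>2 * weight \<phi> ?z)"
          using mult_left_mono[OF m(2)[OF inK1[OF y s] zero], of "(v ?z)\<^sup>2"] m(1) by (simp add: field_simps)
        moreover have "0 \<le> weight \<phi> ?z" using m(1) m(2)[OF inK1[OF y s] zero] by simp
        ultimately show "ennreal ((v ?z)\<^sup>2) \<le> ennreal (1/m) * ?F ?z"
          using m(1) by (simp add: ennreal_leI flip: ennreal_mult)
      qed
      moreover have sq: "(\<sigma> * dx i v z)\<^sup>2 = (dx i v z)\<^sup>2" for z using \<sigma> by auto
      moreover have "ennreal (2 * (1/m) * (shadow_const CARD('n) * h)) = 2 * ennreal (1/m) * ennreal (shadow_const CARD('n) * h)"
      proof -
        have "ennreal (2 * (1/m) * (shadow_const CARD('n) * h)) = ennreal (2 * (1/m)) * ennreal (shadow_const CARD('n) * h)"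
          by (rule ennreal_mult') (use m(1) in simp)
        also have "ennreal (2 * (1/m)) = ennreal 2 * ennreal (1/m)" by (rule ennreal_mult') simp
        finally show ?thesis by simp
      qed
      ultimately show ?thesis
        unfolding sqnorm_eq_lborel[OF Eb] sqnorm_eq_lborel[OF strip_borel[OF sm]] L2w_sq_def by simp
    qed
    let ?R = "ennreal (2 * (1/m) * (shadow_const CARD('n) * h)) * L2w_sq \<phi> v +
        ennreal (2 * h * h) * (\<Sum>i\<in>UNIV. sqnorm ?W (dx i v))"
    have "sqnorm (strip \<phi> n r \<epsilon>) v \<le> (\<Sum>p\<in>?I. sqnorm (E p) v)"
      by (rule sqnorm_UN_le[OF _ Eb strip_borel[OF sm] cover smooth_borel_measurable[OF v]]) simp
    also have "\<dots> \<le> (\<Sum>p\<in>?I. ?R)"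
    proof (rule sum_mono)
      fix p assume "p \<in> ?I"
      then obtain i \<sigma> where p: "p = (i, \<sigma>)" "\<sigma> \<in> {-1,1}" by auto
      have "sqnorm ?W (dx i v) \<le> (\<Sum>i\<in>UNIV. sqnorm ?W (dx i v))" by (rule member_le_sum) auto
      then show "sqnorm (E p) v \<le> ?R"
        unfolding p(1) by (intro order_trans[OF one[OF p(2)]] add_left_mono mult_left_mono) auto
    qed
    also have "\<dots> = ennreal (2 * ?d) * ?R"
      by (simp add: ennreal_mult ennreal_of_nat_eq_real_of_nat mult.commute)
    also have "\<dots> = ennreal (C * \<epsilon>) * L2w_sq \<phi> v + ennreal (D * \<epsilon>\<^sup>2) * (\<Sum>i\<in>UNIV. sqnorm ?W (dx i v))"
    proof -
      have "2 * ?d * (2 * (1/m) * (shadow_const CARD('n) * h)) = C * \<epsilon>" "2 * ?d * (2 * h * h) = D * \<epsilon>\<^sup>2"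
        by (auto simp: C_def D_def h_def power2_eq_square)
      then show ?thesis
        using m(1) sc h(1)
        by (simp add: distrib_left mult.assoc[symmetric] flip: ennreal_mult)
    qed
    finally show ?thesis .
  qed
  ultimately show ?thesis by blast
qed

section \<open>Cutting off in time and at infinity\<close>

text \<open>For positive \<open>n\<close> the time factor is 0 where
  \<open>real n * time_profile \<phi> (snd z)\<close> is at most 1, and 1 where it is at least 2.
  The space factor is 1 for \<open>norm (fst z) \<le> real n\<close> and 0 beyond
  \<open>sqrt 2 * real n\<close>; the squared norm is used because it is a polynomial.\<close>

definition bulk_cutoff :: "((real^'n::finite) \<times> real \<Rightarrow> real) \<Rightarrow> nat \<Rightarrow> (real^'n) \<times> real \<Rightarrow> real" where
  "bulk_cutoff \<phi> n z = smooth_step (real n * time_profile \<phi> (snd z) - 1) * smooth_step (2 - (fst z \<bullet> fst z) / (real n)\<^sup>2)"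

lemma smooth_snd: "smooth (\<lambda>z :: (real^'n::finite) \<times> real. snd z)"
  using smooth_inner[of "(0, 1) :: (real^'n) \<times> real"] by (simp add: inner_prod_def)

lemma smooth_sq_fst: "smooth (\<lambda>z :: (real^'n::finite) \<times> real. fst z \<bullet> fst z)"
proof -
  have "smooth (\<lambda>z :: (real^'n) \<times> real. \<Sum>i\<in>UNIV. (z \<bullet> (axis i 1, 0)) * (z \<bullet> (axis i 1, 0)))"
    by (intro smooth_sum smooth_mult smooth_inner)
  then show ?thesis by (simp add: inner_prod_def inner_axis inner_vec_def[of "fst _" "fst _"])
qed

lemma smooth_time_factor:
  fixes \<phi> :: "(real^'n::finite) \<times> real \<Rightarrow> real"
  shows "smooth (\<lambda>z :: (real^'n) \<times> real. smooth_step (real n * time_profile \<phi> (snd z) - 1))"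
  unfolding time_profile_def
  by (intro smooth_compose[OF smooth_smooth_step] smooth_diff smooth_mult smooth_const smooth_power smooth_snd)

lemma smooth_space_factor: "smooth (\<lambda>z :: (real^'n::finite) \<times> real. smooth_step (2 - (fst z \<bullet> fst z) / (real n)\<^sup>2))"
  unfolding divide_inverse
  by (intro smooth_compose[OF smooth_smooth_step] smooth_diff smooth_mult smooth_const smooth_sq_fst)

lemma smooth_bulk_cutoff: "smooth (bulk_cutoff \<phi> n)"
  unfolding bulk_cutoff_def[abs_def] by (intro smooth_mult smooth_time_factor smooth_space_factor)

lemma bulk_cutoff_nonneg: "0 \<le> bulk_cutoff \<phi> n z" and bulk_cutoff_le_1: "bulk_cutoff \<phi> n z \<le> 1"
  unfolding bulk_cutoff_def by (intro mult_nonneg_nonneg mult_le_one smooth_step_nonneg smooth_step_le_1)+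

lemma bulk_cutoff_support:
  assumes "bulk_cutoff \<phi> n z \<noteq> 0"
  shows "z \<in> bulk \<phi> n (2 * real n)"
proof -
  from assms have a: "smooth_step (real n * time_profile \<phi> (snd z) - 1) \<noteq> 0" "smooth_step (2 - (fst z \<bullet> fst z) / (real n)\<^sup>2) \<noteq> 0"
    by (auto simp: bulk_cutoff_def)
  then have 1: "1 < real n * time_profile \<phi> (snd z)" using smooth_step_zero[of "real n * time_profile \<phi> (snd z) - 1"] by force
  have "n \<noteq> 0" using 1 by (intro notI) simp
  moreover have "(fst z \<bullet> fst z) / (real n)\<^sup>2 < 2"
    using a smooth_step_zero[of "2 - (fst z \<bullet> fst z) / (real n)\<^sup>2"] by force
  ultimately have "(norm (fst z))\<^sup>2 < 2 * (real n)\<^sup>2"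
    by (simp add: power2_norm_eq_inner divide_less_eq)
  also have "\<dots> \<le> (2 * real n)\<^sup>2" by (simp add: power_mult_distrib)
  finally have "norm (fst z) < 2 * real n" by (rule power2_less_imp_less) simp
  with 1 show ?thesis by (simp add: bulk_def)
qed

text \<open>The time factor is constant in \<open>x\<close>. The chain rule for the space factor
  produces \<open>2 * fst z $ i / (real n)\<^sup>2\<close>, and
  \<open>norm (fst z) \<le> 2 * real n\<close> wherever the derivative of the step is
  nonzero.\<close>

lemma dx_bulk_cutoff_bound:
  fixes \<phi> :: "(real^'n::finite) \<times> real \<Rightarrow> real"
  assumes B: "\<And>x. \<bar>partial 1 smooth_step x\<bar> \<le> B" and n: "0 < n"
  shows "\<bar>dx i (bulk_cutoff \<phi> n) z\<bar> \<le> 4 * B / real n"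
proof -
  let ?e = "(axis i 1, 0) :: (real^'n) \<times> real"
  let ?a = "\<lambda>z. smooth_step (real n * time_profile \<phi> (snd z) - 1)"
  let ?g = "\<lambda>z :: (real^'n) \<times> real. 2 - (fst z \<bullet> fst z) / (real n)\<^sup>2"
  have sg: "smooth ?g" unfolding divide_inverse by (intro smooth_diff smooth_mult smooth_const smooth_sq_fst)
  have pa: "partial ?e ?a z = 0" by (rule partial_eqI) simp
  have pg: "partial ?e ?g z = - (2 * fst z $ i / (real n)\<^sup>2)"
  proof (rule partial_eqI)
    have "(fst z + h *\<^sub>R axis i 1) \<bullet> (fst z + h *\<^sub>R axis i 1) = fst z \<bullet> fst z + 2 * h * fst z $ i + h * h" for h
      by (simp add: inner_add_left inner_add_right inner_axis inner_commute[of "axis i 1" "fst z"] inner_axis_axis algebra_simps)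
    moreover have "((\<lambda>h. 2 - (fst z \<bullet> fst z + 2 * h * fst z $ i + h * h) * inverse ((real n)\<^sup>2))
        has_real_derivative - (2 * fst z $ i * inverse ((real n)\<^sup>2))) (at 0)"
      by (rule derivative_eq_intros refl | simp)+
    ultimately show "((\<lambda>h. ?g (z + h *\<^sub>R ?e)) has_real_derivative - (2 * fst z $ i / (real n)\<^sup>2)) (at 0)"
      by (simp add: divide_inverse)
  qed
  have B0: "0 \<le> B" using B[of 0] by linarith
  have "dx i (bulk_cutoff \<phi> n) z = partial ?e ?a z * smooth_step (?g z) + ?a z * partial ?e (\<lambda>z. smooth_step (?g z)) z"
    unfolding dx_def bulk_cutoff_def[abs_def]
    by (rule partial_mult[OF smooth_time_factor smooth_space_factor axis_zero_Basis])
  also have "partial ?e (\<lambda>z. smooth_step (?g z)) z = partial 1 smooth_step (?g z) * partial ?e ?g z"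
    by (rule partial_compose[OF smooth_smooth_step sg axis_zero_Basis])
  finally have eq: "dx i (bulk_cutoff \<phi> n) z = ?a z * (partial 1 smooth_step (?g z) * - (2 * fst z $ i / (real n)\<^sup>2))"
    unfolding pa pg by simp
  have "\<bar>partial 1 smooth_step (?g z) * - (2 * fst z $ i / (real n)\<^sup>2)\<bar> \<le> 4 * B / real n"
  proof (cases "?g z \<in> {0..1}")
    case True
    then have "(norm (fst z))\<^sup>2 \<le> 2 * (real n)\<^sup>2"
      using n by (simp add: power2_norm_eq_inner divide_le_eq)
    also have "\<dots> \<le> (2 * real n)\<^sup>2" by (simp add: power_mult_distrib)
    finally have "norm (fst z) \<le> 2 * real n" by (rule power2_le_imp_le) simp
    then have "\<bar>fst z $ i\<bar> \<le> 2 * real n" using component_le_norm_cart[of "fst z" i] by linarith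
    then have "\<bar>2 * fst z $ i / (real n)\<^sup>2\<bar> \<le> 2 * (2 * real n) / (real n)\<^sup>2"
      using n by (simp add: abs_mult divide_right_mono)
    also have "\<dots> = 4 / real n" using n by (simp add: power2_eq_square)
    finally have "\<bar>partial 1 smooth_step (?g z)\<bar> * \<bar>2 * fst z $ i / (real n)\<^sup>2\<bar> \<le> B * (4 / real n)"
      using B B0 by (intro mult_mono) auto
    then show ?thesis by (simp add: abs_mult mult.commute)
  next
    case False
    then show ?thesis using B0 by (simp add: partial_smooth_step_outside)
  qed
  moreover have "\<bar>?a z\<bar> \<le> 1" using smooth_step_nonneg smooth_step_le_1 by (simp add: abs_of_nonneg)
  ultimately have "\<bar>?a z\<bar> * \<bar>partial 1 smooth_step (?g z) * - (2 * fst z $ i / (real n)\<^sup>2)\<bar> \<le> 1 * (4 * B / real n)"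
    by (intro mult_mono) auto
  then show ?thesis unfolding eq abs_mult[of "?a z"] by simp
qed

lemma eventually_smooth_step_one:
  assumes "filterlim f at_top sequentially"
  shows "\<forall>\<^sub>F n in sequentially. smooth_step (f n) = 1"
proof -
  have "\<forall>\<^sub>F n in sequentially. 1 \<le> f n" using assms by (simp add: filterlim_at_top)
  then show ?thesis by eventually_elim (rule smooth_step_one)
qed

lemma bulk_cutoff_eventually_1:
  assumes "0 < time_profile \<phi> (snd z)"
  shows "\<forall>\<^sub>F n in sequentially. bulk_cutoff \<phi> n z = 1"
proof -
  have "filterlim (\<lambda>n. - 1 + real n * time_profile \<phi> (snd z)) at_top sequentially"
    by (intro filterlim_tendsto_add_at_top[OF tendsto_const] filterlim_at_top_mult_tendsto_pos[OF tendsto_const assms]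
        filterlim_real_sequentially)
  from eventually_smooth_step_one[OF this]
  have 1: "\<forall>\<^sub>F n in sequentially. smooth_step (real n * time_profile \<phi> (snd z) - 1) = 1" by simp
  have "\<forall>\<^sub>F n in sequentially. norm (fst z) \<le> real n \<and> 0 < n"
    using filterlim_real_sequentially eventually_gt_at_top[of 0] by (auto simp: filterlim_at_top eventually_conj_iff)
  then have 2: "\<forall>\<^sub>F n in sequentially. smooth_step (2 - (fst z \<bullet> fst z) / (real n)\<^sup>2) = 1"
  proof eventually_elim
    case (elim n)
    then have "(norm (fst z))\<^sup>2 \<le> (real n)\<^sup>2" by (intro power_mono) auto
    then have "(fst z \<bullet> fst z) / (real n)\<^sup>2 \<le> 1" using elim by (simp add: power2_norm_eq_inner divide_le_eq)
    then show ?case by (intro smooth_step_one) simp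
  qed
  from 1 2 show ?thesis by eventually_elim (simp add: bulk_cutoff_def)
qed

text \<open>The slice at time 0 lies in a null hyperplane; within \<open>QQ \<phi>\<close> it is the
  only place where the cutoffs fail to become 1 eventually.\<close>

lemma AE_time_nonzero: "AE z in lebesgue_on S. snd (z :: (real^'n::finite) \<times> real) \<noteq> 0" if "S \<in> sets borel" for S
proof -
  have "negligible {z :: (real^'n) \<times> real. (0, 1) \<bullet> z = 0}"
    by (rule negligible_hyperplane) (simp add: zero_prod_def)
  then have "AE z in lebesgue. z \<notin> {z :: (real^'n) \<times> real. (0, 1) \<bullet> z = 0}"
    unfolding negligible_iff_null_sets by (rule AE_not_in)
  then show ?thesis using that
    by (subst AE_restrict_space_iff) (auto simp: inner_prod_def elim!: eventually_mono)
qed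

lemma sqnorm_bulk_cutoff_tendsto:
  assumes sm: "smooth \<phi>" and f: "L2 (QQ \<phi>) f"
  shows "(\<lambda>n. sqnorm (QQ \<phi>) (\<lambda>z. (1 - bulk_cutoff \<phi> n z) * f z)) \<longlonglongrightarrow> 0"
proof -
  have f': "f \<in> borel_measurable (lebesgue_on (QQ \<phi>))" "sqnorm (QQ \<phi>) f < \<infinity>" using f by (auto simp: L2_iff_sqnorm)
  have "(\<lambda>n. \<integral>\<^sup>+ z. ennreal (((1 - bulk_cutoff \<phi> n z) * f z)\<^sup>2) \<partial>lebesgue_on (QQ \<phi>)) \<longlonglongrightarrow>
      (\<integral>\<^sup>+ z. 0 \<partial>lebesgue_on (QQ \<phi>))"
  proof (rule nn_integral_dominated_convergence)
    show "(\<lambda>z. ennreal ((f z)\<^sup>2)) \<in> borel_measurable (lebesgue_on (QQ \<phi>))" using f'(1) by measurable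
    show "(\<lambda>z. ennreal (((1 - bulk_cutoff \<phi> n z) * f z)\<^sup>2)) \<in> borel_measurable (lebesgue_on (QQ \<phi>))" for n
      using f'(1) smooth_lebesgue_on[OF smooth_bulk_cutoff[of \<phi> n]] by measurable
    show "(\<integral>\<^sup>+ z. ennreal ((f z)\<^sup>2) \<partial>lebesgue_on (QQ \<phi>)) < \<infinity>" using f'(2) by (simp add: sqnorm_def)
    show "AE z in lebesgue_on (QQ \<phi>). ennreal (((1 - bulk_cutoff \<phi> n z) * f z)\<^sup>2) \<le> ennreal ((f z)\<^sup>2)" for n
    proof (intro always_eventually allI ennreal_leI)
      fix z
      have "\<bar>(1 - bulk_cutoff \<phi> n z) * f z\<bar> \<le> 1 * \<bar>f z\<bar>"
        unfolding abs_mult using bulk_cutoff_nonneg[of \<phi> n z] bulk_cutoff_le_1[of \<phi> n z] by (intro mult_right_mono) auto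
      then show "((1 - bulk_cutoff \<phi> n z) * f z)\<^sup>2 \<le> (f z)\<^sup>2" by (simp add: abs_le_square_iff)
    qed
    have "AE z in lebesgue_on (QQ \<phi>). z \<in> QQ \<phi>" by (intro AE_I2) (auto simp: space_restrict_space)
    moreover have "AE z in lebesgue_on (QQ \<phi>). snd z \<noteq> 0"
      by (rule AE_time_nonzero) (simp add: open_QQ[OF sm])
    ultimately show "AE z in lebesgue_on (QQ \<phi>). (\<lambda>n. ennreal (((1 - bulk_cutoff \<phi> n z) * f z)\<^sup>2)) \<longlonglongrightarrow> 0"
    proof eventually_elim
      case (elim z)
      then have "0 < time_profile \<phi> (snd z)" by (auto simp: time_profile_pos_iff QQ_def)
      from bulk_cutoff_eventually_1[OF this]
      have "\<forall>\<^sub>F n in sequentially. ennreal (((1 - bulk_cutoff \<phi> n z) * f z)\<^sup>2) = 0"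
        by eventually_elim simp
      then show ?case by (rule tendsto_eventually)
    qed
  qed measurable
  then show ?thesis by (simp add: sqnorm_def)
qed

text \<open>Dominated convergence: each point of \<open>QQ \<phi>\<close> leaves the strips once
  their width drops below \<open>- \<phi> z\<close>.\<close>

lemma sqnorm_strip_tendsto:
  assumes sm: "smooth \<phi>" and f: "L2 (QQ \<phi>) f"
  shows "(\<lambda>m. sqnorm (strip \<phi> n r (1 / real (Suc m))) f) \<longlonglongrightarrow> 0"
proof -
  have f': "f \<in> borel_measurable (lebesgue_on (QQ \<phi>))" "sqnorm (QQ \<phi>) f < \<infinity>" using f by (auto simp: L2_iff_sqnorm)
  have Q: "QQ \<phi> \<in> sets borel" by (simp add: open_QQ[OF sm])
  let ?S = "\<lambda>m. strip \<phi> n r (1 / real (Suc m))"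
  have Sm: "?S m \<in> sets (lebesgue_on (QQ \<phi>))" for m
    using strip_borel[OF sm] strip_subset_QQ Q by (simp add: sets_restrict_space_iff)
  have "(\<lambda>m. \<integral>\<^sup>+ z. ennreal ((f z)\<^sup>2) * indicator (?S m) z \<partial>lebesgue_on (QQ \<phi>)) \<longlonglongrightarrow>
      (\<integral>\<^sup>+ z. 0 \<partial>lebesgue_on (QQ \<phi>))"
  proof (rule nn_integral_dominated_convergence)
    show "(\<lambda>z. ennreal ((f z)\<^sup>2)) \<in> borel_measurable (lebesgue_on (QQ \<phi>))" using f'(1) by measurable
    show "(\<lambda>z. ennreal ((f z)\<^sup>2) * indicator (?S m) z) \<in> borel_measurable (lebesgue_on (QQ \<phi>))" for m
      using f'(1) Sm[of m] by measurable
    show "(\<integral>\<^sup>+ z. ennreal ((f z)\<^sup>2) \<partial>lebesgue_on (QQ \<phi>)) < \<infinity>" using f'(2) by (simp add: sqnorm_def)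
    show "AE z in lebesgue_on (QQ \<phi>). ennreal ((f z)\<^sup>2) * indicator (?S m) z \<le> ennreal ((f z)\<^sup>2)" for m
      by (intro always_eventually allI) (auto simp: indicator_def)
    show "AE z in lebesgue_on (QQ \<phi>). (\<lambda>m. ennreal ((f z)\<^sup>2) * indicator (?S m) z) \<longlonglongrightarrow> 0"
    proof (intro AE_I2)
      fix z assume "z \<in> space (lebesgue_on (QQ \<phi>))"
      then have "0 < - \<phi> z" by (auto simp: space_restrict_space QQ_def)
      then have "\<forall>\<^sub>F m in sequentially. 1 / real (Suc m) < - \<phi> z"
        using order_tendstoD(2)[OF LIMSEQ_inverse_real_of_nat] by (simp add: inverse_eq_divide)
      then have "\<forall>\<^sub>F m in sequentially. ennreal ((f z)\<^sup>2) * indicator (?S m) z = 0"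
        by eventually_elim (auto simp: strip_def indicator_def)
      then show "(\<lambda>m. ennreal ((f z)\<^sup>2) * indicator (?S m) z) \<longlonglongrightarrow> 0" by (rule tendsto_eventually)
    qed
  qed measurable
  then show ?thesis
    unfolding sqnorm_eq_indicator[OF strip_borel[OF sm] Q strip_subset_QQ] by simp
qed

section \<open>Density\<close>

lemma sqnorm_indicator:
  assumes "A \<in> sets borel" "S \<in> sets borel" "A \<subseteq> S"
  shows "sqnorm S (\<lambda>z. indicator A z * f z) = sqnorm A f"
  unfolding sqnorm_eq_indicator[OF assms] unfolding sqnorm_def
  by (intro nn_integral_cong) (simp add: indicator_def)

lemma sqnorm_le_sqnorm_subset:
  assumes "A \<in> sets borel" "S \<in> sets borel" "A \<subseteq> S"
    and "f \<in> borel_measurable (lebesgue_on S)"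
    and "\<And>z. z \<in> S \<Longrightarrow> \<bar>g z\<bar> \<le> c * (indicator A z * \<bar>f z\<bar>)"
    and "0 \<le> c"
  shows "sqnorm S g \<le> ennreal (c\<^sup>2) * sqnorm A f"
proof -
  have "sqnorm S g \<le> sqnorm S (\<lambda>z. c * (indicator A z * f z))"
    using assms(5,6) by (intro sqnorm_mono) (simp add: abs_mult)
  also have "\<dots> = ennreal (c\<^sup>2) * sqnorm S (\<lambda>z. indicator A z * f z)"
  proof (rule sqnorm_cmult)
    have "A \<in> sets (lebesgue_on S)" using assms by (simp add: sets_restrict_space_iff)
    then show "(\<lambda>z. indicator A z * f z) \<in> borel_measurable (lebesgue_on S)"
      using assms(4) by measurable
  qed
  finally show ?thesis by (simp add: sqnorm_indicator assms)
qed

lemma sqnorm_add_bound: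
  assumes "f \<in> borel_measurable (lebesgue_on S)" "g \<in> borel_measurable (lebesgue_on S)"
    and "sqnorm S f \<le> ennreal a" "sqnorm S g \<le> ennreal b" "0 \<le> a" "0 \<le> b"
  shows "sqnorm S (\<lambda>z. f z + g z) \<le> ennreal (2 * a + 2 * b)"
proof -
  have "sqnorm S (\<lambda>z. f z + g z) \<le> 2 * ennreal a + 2 * ennreal b"
    by (intro order_trans[OF sqnorm_add_le[OF assms(1,2)]] add_mono mult_left_mono assms(3,4)) auto
  also have "\<dots> = ennreal (2 * a + 2 * b)" using assms(5,6) by (simp add: ennreal_plus ennreal_mult)
  finally show ?thesis .
qed

lemma sqnorm_diff_bound:
  assumes "f \<in> borel_measurable (lebesgue_on S)" "g \<in> borel_measurable (lebesgue_on S)"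
    and "sqnorm S f \<le> ennreal a" "sqnorm S g \<le> ennreal b" "0 \<le> a" "0 \<le> b"
  shows "sqnorm S (\<lambda>z. f z - g z) \<le> ennreal (2 * a + 2 * b)"
  using sqnorm_add_bound[of f S "\<lambda>z. - g z" a b] assms by (simp add: sqnorm_def)

text \<open>The constant sequence at \<psi> is admissible: a test function vanishes off
  \<open>QQ \<phi>\<close>, in particular on \<open>GammaQ \<phi>\<close>.\<close>

lemma Cc_inf_subset_H0:
  assumes "smooth \<phi>"
  shows "Cc_inf (QQ \<phi>) \<subseteq> H0 \<phi>"
proof
  fix \<psi> assume \<psi>: "\<psi> \<in> Cc_inf (QQ \<phi>)"
  note oQ = open_QQ[OF assms]
  have L0: "L2 (QQ \<phi>) (\<lambda>_. 0)" by (simp add: L2_def)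
  have "weak_dx (QQ \<phi>) i (\<lambda>_. 0) (\<lambda>_. 0)" for i by (simp add: weak_dx_def)
  from H_norm_sq[OF oQ L0 L0 this] have "H_norm (QQ \<phi>) (\<lambda>_. 0) = 0"
    by (simp add: sqnorm_zero)
  moreover have "L2w_sq \<phi> \<psi> = 0"
  proof -
    have zero: "indicator (GammaQ \<phi>) z * ennreal ((\<psi> z)\<^sup>2 * weight \<phi> z) = 0" for z
    proof (cases "z \<in> GammaQ \<phi>")
      case True
      then have "z \<notin> QQ \<phi>" by (auto simp: GammaQ_def QQ_def)
      then have "\<psi> z = 0" using Cc_inf_subset[OF \<psi>] closure_subset[of "{z. \<psi> z \<noteq> 0}"] by auto
      then show ?thesis by simp
    qed simp
    show ?thesis unfolding L2w_sq_def zero by simp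
  qed
  ultimately show "\<psi> \<in> H0 \<phi>"
    unfolding H0_def using Cc_inf_inH[OF \<psi> oQ] Cc_inf_smooth[OF \<psi>]
    by (intro CollectI conjI exI[of _ "\<lambda>_. \<psi>"]) auto
qed

text \<open>Vanishes for \<open>\<phi> z \<ge> - \<epsilon> / 4\<close>, which keeps supports away
  from the boundary, and equals 1 for \<open>\<phi> z \<le> - \<epsilon> / 2\<close>; the transition
  lies inside the strip of width \<epsilon>.\<close>

definition boundary_cutoff :: "((real^'n::finite) \<times> real \<Rightarrow> real) \<Rightarrow> real \<Rightarrow> (real^'n) \<times> real \<Rightarrow> real" where
  "boundary_cutoff \<phi> \<epsilon> z = smooth_step (- 4 / \<epsilon> * \<phi> z - 1)"

lemma smooth_boundary_cutoff: "smooth \<phi> \<Longrightarrow> smooth (boundary_cutoff \<phi> \<epsilon>)"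
  unfolding boundary_cutoff_def[abs_def]
  by (intro smooth_compose[OF smooth_smooth_step] smooth_diff smooth_mult smooth_const)

lemma boundary_cutoff_nonneg: "0 \<le> boundary_cutoff \<phi> \<epsilon> z" and boundary_cutoff_le_1: "boundary_cutoff \<phi> \<epsilon> z \<le> 1"
  by (simp_all add: boundary_cutoff_def smooth_step_nonneg smooth_step_le_1)

lemma boundary_cutoff_support: "0 < \<epsilon> \<Longrightarrow> boundary_cutoff \<phi> \<epsilon> z \<noteq> 0 \<Longrightarrow> \<phi> z \<le> - \<epsilon> / 4"
  using smooth_step_zero[of "- 4 / \<epsilon> * \<phi> z - 1"] by (force simp: boundary_cutoff_def field_simps)

lemma boundary_cutoff_eq_1: "0 < \<epsilon> \<Longrightarrow> \<phi> z \<le> - \<epsilon> / 2 \<Longrightarrow> boundary_cutoff \<phi> \<epsilon> z = 1"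
  unfolding boundary_cutoff_def by (rule smooth_step_one) (simp add: field_simps)

lemma dx_boundary_cutoff:
  assumes "smooth \<phi>"
  shows "dx i (boundary_cutoff \<phi> \<epsilon>) z = partial 1 smooth_step (- 4 / \<epsilon> * \<phi> z - 1) * (- 4 / \<epsilon> * dx i \<phi> z)"
proof -
  have s: "smooth (\<lambda>z. - 4 / \<epsilon> * \<phi> z - 1)" by (intro smooth_diff smooth_mult smooth_const assms)
  have "partial (axis i 1, 0) (\<lambda>z. - 4 / \<epsilon> * \<phi> z - 1) z = - 4 / \<epsilon> * dx i \<phi> z"
    unfolding dx_def
    by (rule partial_eqI) (rule derivative_eq_intros refl smooth_has_partial[OF assms axis_zero_Basis] | simp)+
  then show ?thesis
    unfolding dx_def boundary_cutoff_def[abs_def] partial_compose[OF smooth_smooth_step s axis_zero_Basis] by simp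
qed

text \<open>The slope \<open>4 / \<epsilon>\<close> comes from the chain rule. For
  \<open>\<phi> z \<le> - \<epsilon>\<close> the argument of the step is at least 3, where the step
  is constant.\<close>

lemma dx_boundary_cutoff_bound:
  assumes "smooth \<phi>" "0 < \<epsilon>" and B: "\<And>x. \<bar>partial 1 smooth_step x\<bar> \<le> B"
    and L: "\<bar>dx i \<phi> z\<bar> \<le> L"
  shows "\<bar>dx i (boundary_cutoff \<phi> \<epsilon>) z\<bar> \<le> 4 * B * L / \<epsilon> * of_bool (- \<epsilon> < \<phi> z)"
proof -
  have B0: "0 \<le> B" using B[of 0] by linarith
  show ?thesis
  proof (cases "- \<epsilon> < \<phi> z")
    case True
    have "\<bar>dx i (boundary_cutoff \<phi> \<epsilon>) z\<bar> = \<bar>partial 1 smooth_step (- 4 / \<epsilon> * \<phi> z - 1)\<bar> * (4 / \<epsilon> * \<bar>dx i \<phi> z\<bar>)"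
      using assms(2) by (simp add: dx_boundary_cutoff[OF assms(1)] abs_mult)
    also have "\<dots> \<le> B * (4 / \<epsilon> * L)"
      using assms(2) B0 by (intro mult_mono B L mult_left_mono) auto
    finally show ?thesis using True by (simp add: mult_ac)
  next
    case False
    then have "- 4 / \<epsilon> * \<phi> z - 1 \<notin> {0..1}" using assms(2) by (simp add: field_simps)
    then show ?thesis using False by (simp add: dx_boundary_cutoff[OF assms(1)] partial_smooth_step_outside)
  qed
qed

theorem theorem3p2:
  fixes \<phi> :: "(real^'n::finite) \<times> real \<Rightarrow> real"
  assumes dim: "CARD('n) = 2 \<or> CARD('n) = 3"
    and smooth_phi: "smooth \<phi>"
    and bounded_Omega: "\<forall>t\<in>{t0 \<phi>..tT \<phi>}. bounded {x. \<phi> (x,t) < 0}"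
    and crit_in: "(0,0) \<in> closure (GammaQ \<phi>)" "grad_x \<phi> (0,0) = 0"
    and crit_unique: "\<forall>z\<in>closure (GammaQ \<phi>). grad_x \<phi> z = 0 \<longrightarrow> z = (0,0)"
    and nondeg: "det (hess_x \<phi> (0,0)) \<noteq> 0"
    and dt_nz: "dt \<phi> (0,0) \<noteq> 0"
  shows "Cc_inf (QQ \<phi>) \<subseteq> H0 \<phi> \<and>
         (\<forall>u\<in>H0 \<phi>. \<forall>\<epsilon>>0. \<exists>\<psi>\<in>Cc_inf (QQ \<phi>). H_norm (QQ \<phi>) (\<lambda>z. u z - \<psi> z) < \<epsilon>)"
proof (intro conjI ballI allI impI)
  show "Cc_inf (QQ \<phi>) \<subseteq> H0 \<phi>" by (rule Cc_inf_subset_H0[OF smooth_phi])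
next
  fix u and e :: real
  assume u: "u \<in> H0 \<phi>" and e: "0 < e"
  let ?Q = "QQ \<phi>" and ?d = "real CARD('n)"
  note oQ = open_QQ[OF smooth_phi]
  have bQ: "?Q \<in> sets borel" using oQ by simp
  have d0: "0 < ?d" by simp
  obtain v where inH_u: "inH ?Q u" and v: "\<And>k. smooth (v k)" "\<And>k. inH ?Q (v k)"
    and vH: "(\<lambda>k. H_norm ?Q (\<lambda>z. u z - v k z)) \<longlonglongrightarrow> 0"
    and vT: "(\<lambda>k. L2w_sq \<phi> (v k)) \<longlonglongrightarrow> 0"
    using u unfolding H0_def by blast
  have uL: "L2 ?Q u" using inH_u by (simp add: inH_def)
  obtain G where G: "\<And>i. L2 ?Q (G i)" "\<And>i. weak_dx ?Q i u (G i)"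
    using inH_u unfolding inH_def by metis
  have vL: "L2 ?Q (v k)" "L2 ?Q (dx i (v k))" for k i
    using v L2_dx_smooth[OF oQ] by (auto simp: inH_def)
  have meas: "f \<in> borel_measurable (lebesgue_on ?Q)" if "L2 ?Q f" for f
    using that by (simp add: L2_def)
  have normk: "ennreal ((H_norm ?Q (\<lambda>z. u z - v k z))\<^sup>2) =
      sqnorm ?Q (\<lambda>z. u z - v k z) + (\<Sum>i\<in>UNIV. sqnorm ?Q (\<lambda>z. G i z - dx i (v k) z))" for k
  proof (rule H_norm_sq[OF oQ])
    show "L2 ?Q (\<lambda>z. u z - v k z)" by (rule L2_diff[OF uL vL(1)])
    show "L2 ?Q (\<lambda>z. G i z - dx i (v k) z)" for i by (rule L2_diff[OF G(1) vL(2)])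
    show "weak_dx ?Q i (\<lambda>z. u z - v k z) (\<lambda>z. G i z - dx i (v k) z)" for i
      by (rule weak_dx_diff[OF oQ L2_loc_integrable[OF oQ uL] L2_loc_integrable[OF oQ vL(1)] L2_loc_integrable[OF oQ G(1)]
            L2_loc_integrable[OF oQ vL(2)] G(2) weak_dx_smooth[OF oQ v(1)]])
  qed
  \<comment> \<open>The final sum is \<open>10 * \<delta>\<close> for the function and
    \<open>28 * \<delta>\<close> for each of the \<open>?d\<close> derivatives; 11 in place of 10
    makes the inequality strict.\<close>
  define \<delta> where "\<delta> = e\<^sup>2 / (11 + 28 * ?d)"
  have \<delta>: "0 < \<delta>" using e d0 by (simp add: \<delta>_def)
  \<comment> \<open>\<open>2 * Ru + 2 * \<delta>\<close> will bound the squared norm of the chosen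
    \<open>v k\<close>, so \<open>n\<close> can be fixed before \<open>k\<close> is known.\<close>
  define Ru where "Ru = (LINT z|lebesgue_on ?Q. (u z)\<^sup>2)"
  have Ru: "sqnorm ?Q u = ennreal Ru" "0 \<le> Ru"
    using ennreal_integral_L2[OF uL] by (auto simp: Ru_def)
  obtain B where B: "0 < B" "\<And>x. \<bar>partial 1 smooth_step x\<bar> \<le> B" using bounded_partial_smooth_step by blast
  have ev_le: "\<forall>\<^sub>F n in sequentially. X n \<le> ennreal c" if "X \<longlonglongrightarrow> 0" "0 < c" for X c
    using order_tendstoD(2)[OF that(1), of "ennreal c"] that(2)
    by (auto elim!: eventually_mono)
  have "(\<lambda>n. (4 * B / real n)\<^sup>2 * (2 * Ru + 2 * \<delta>)) \<longlonglongrightarrow> 0\<^sup>2 * (2 * Ru + 2 * \<delta>)"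
    by (intro tendsto_intros lim_const_over_n)
  then have "\<forall>\<^sub>F n in sequentially. (4 * B / real n)\<^sup>2 * (2 * Ru + 2 * \<delta>) < \<delta>"
    using \<delta> by (intro order_tendstoD(2)) auto
  moreover have "\<forall>\<^sub>F n in sequentially. sqnorm ?Q (\<lambda>z. (1 - bulk_cutoff \<phi> n z) * u z) \<le> ennreal \<delta>"
    by (rule ev_le[OF sqnorm_bulk_cutoff_tendsto[OF smooth_phi uL] \<delta>])
  moreover have "\<forall>\<^sub>F n in sequentially. \<forall>i. sqnorm ?Q (\<lambda>z. (1 - bulk_cutoff \<phi> n z) * G i z) \<le> ennreal \<delta>"
    by (intro eventually_all_finite ev_le[OF sqnorm_bulk_cutoff_tendsto[OF smooth_phi G(1)] \<delta>])
  ultimately have "\<forall>\<^sub>F n in sequentially. (4 * B / real n)\<^sup>2 * (2 * Ru + 2 * \<delta>) < \<delta> \<and>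
      sqnorm ?Q (\<lambda>z. (1 - bulk_cutoff \<phi> n z) * u z) \<le> ennreal \<delta> \<and>
      (\<forall>i. sqnorm ?Q (\<lambda>z. (1 - bulk_cutoff \<phi> n z) * G i z) \<le> ennreal \<delta>) \<and> 0 < n"
    using eventually_gt_at_top[of 0] by eventually_elim blast
  then obtain n where n: "(4 * B / real n)\<^sup>2 * (2 * Ru + 2 * \<delta>) < \<delta>"
      "sqnorm ?Q (\<lambda>z. (1 - bulk_cutoff \<phi> n z) * u z) \<le> ennreal \<delta>"
      "\<And>i. sqnorm ?Q (\<lambda>z. (1 - bulk_cutoff \<phi> n z) * G i z) \<le> ennreal \<delta>" "0 < n"
    using eventually_happens'[OF sequentially_bot] by blast
  define r where "r = 2 * real n"
  obtain C D \<epsilon>0 where C: "0 < C" and D: "0 < D" and \<epsilon>0: "0 < \<epsilon>0"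
    and bound: "\<And>\<epsilon> v. 0 < \<epsilon> \<Longrightarrow> \<epsilon> < \<epsilon>0 \<Longrightarrow> smooth v \<Longrightarrow>
      sqnorm (strip \<phi> n r \<epsilon>) v \<le> ennreal (C * \<epsilon>) * L2w_sq \<phi> v +
      ennreal (D * \<epsilon>\<^sup>2) * (\<Sum>i\<in>UNIV. sqnorm (strip \<phi> n (r+1) \<epsilon>) (dx i v))"
    using strip_bound[OF smooth_phi crit_unique, of n r] by blast
  obtain L where L: "0 < L" "\<And>z i. z \<in> bulk \<phi> n r \<Longrightarrow> \<bar>dx i \<phi> z\<bar> \<le> L"
  proof -
    have "bounded (grad_x \<phi> ` bulk \<phi> n r)"
      by (intro compact_imp_bounded compact_continuous_image continuous_on_grad_x compact_bulk smooth_phi)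
    then obtain L where "0 < L" "\<forall>z\<in>bulk \<phi> n r. norm (grad_x \<phi> z) \<le> L" by (auto simp: bounded_pos)
    moreover have "\<bar>dx i \<phi> z\<bar> \<le> norm (grad_x \<phi> z)" for z i
      using component_le_norm_cart[of "grad_x \<phi> z" i] by (simp add: grad_x_def)
    ultimately show ?thesis using that by (meson order_trans)
  qed
  \<comment> \<open>\<open>A / \<epsilon>\<^sup>2\<close> bounds the squared partial derivatives of
    the boundary cutoff at the points of the bulk inside \<open>?Q\<close>.\<close>
  define A where "A = (4 * B * L)\<^sup>2"
  have A: "0 < A" using B L by (simp add: A_def)
  \<comment> \<open>Multiplied by \<open>A / \<epsilon>\<^sup>2\<close>, the gradient term of the
    strip estimate becomes \<open>4 * ?d * A * D * \<delta>2\<close>, from which \<epsilon> has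
    cancelled. It is at most \<open>\<delta> / 2\<close> by this choice, made before
    \<epsilon>.\<close>
  define \<delta>2 where "\<delta>2 = min \<delta> (\<delta> / (8 * ?d * A * D))"
  have a: "0 < 8 * ?d * A * D" using d0 A D by simp
  have "\<delta>2 \<le> \<delta> / (8 * ?d * A * D)" unfolding \<delta>2_def by (rule min.cobounded2)
  then have \<delta>2: "8 * ?d * A * D * \<delta>2 \<le> \<delta>" "0 < \<delta>2" "\<delta>2 \<le> \<delta>"
    using \<delta> a unfolding pos_le_divide_eq[OF a] by (auto simp: \<delta>2_def mult.commute)
  let ?eps = "\<lambda>m. 1 / real (Suc m)"
  have "\<forall>\<^sub>F m in sequentially. ?eps m < \<epsilon>0"
    using order_tendstoD(2)[OF LIMSEQ_inverse_real_of_nat \<epsilon>0] by (simp add: inverse_eq_divide)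
  moreover have "\<forall>\<^sub>F m in sequentially. sqnorm (strip \<phi> n (r+1) (?eps m)) u \<le> ennreal \<delta>2"
    by (rule ev_le[OF sqnorm_strip_tendsto[OF smooth_phi uL] \<delta>2(2)])
  moreover have "\<forall>\<^sub>F m in sequentially. \<forall>i. sqnorm (strip \<phi> n (r+1) (?eps m)) (G i) \<le> ennreal \<delta>2"
    by (intro eventually_all_finite ev_le[OF sqnorm_strip_tendsto[OF smooth_phi G(1)] \<delta>2(2)])
  ultimately have "\<forall>\<^sub>F m in sequentially. ?eps m < \<epsilon>0 \<and> sqnorm (strip \<phi> n (r+1) (?eps m)) u \<le> ennreal \<delta>2 \<and>
      (\<forall>i. sqnorm (strip \<phi> n (r+1) (?eps m)) (G i) \<le> ennreal \<delta>2)"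
    by eventually_elim blast
  then obtain m where m: "?eps m < \<epsilon>0" "sqnorm (strip \<phi> n (r+1) (?eps m)) u \<le> ennreal \<delta>2"
      "\<And>i. sqnorm (strip \<phi> n (r+1) (?eps m)) (G i) \<le> ennreal \<delta>2"
    using eventually_happens'[OF sequentially_bot] by blast
  define \<epsilon> where "\<epsilon> = ?eps m"
  have \<epsilon>: "0 < \<epsilon>" "\<epsilon> < \<epsilon>0" using m(1) by (auto simp: \<epsilon>_def)
  let ?S = "strip \<phi> n r \<epsilon>" and ?W = "strip \<phi> n (r+1) \<epsilon>"
  have SW: "?S \<subseteq> ?W" by (auto simp: strip_def bulk_def)
  note bS = strip_borel[OF smooth_phi]
  have smallW: "sqnorm ?W f \<le> ennreal \<delta>2" if "f = u \<or> (\<exists>i. f = G i)" for f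
    using m(2,3) that unfolding \<epsilon>_def by blast
  \<comment> \<open>Multiplied by \<open>A / \<epsilon>\<^sup>2\<close>, the boundary term becomes
    \<open>A * C * \<beta> / \<epsilon> = \<delta> / 2\<close>. Since \<beta> depends on \<epsilon>,
    the index \<open>k\<close> is fixed last.\<close>
  define \<beta> where "\<beta> = \<delta> * \<epsilon> / (2 * A * C)"
  have \<beta>: "0 < \<beta>" using \<delta> \<epsilon> A C by (simp add: \<beta>_def)
  have "(\<lambda>k. ennreal ((H_norm ?Q (\<lambda>z. u z - v k z))\<^sup>2)) \<longlonglongrightarrow> ennreal (0\<^sup>2)"
    by (intro tendsto_ennrealI tendsto_power vH)
  then have "\<forall>\<^sub>F k in sequentially. ennreal ((H_norm ?Q (\<lambda>z. u z - v k z))\<^sup>2) \<le> ennreal \<delta>2"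
    using \<delta>2(2) by (intro ev_le) auto
  moreover have "\<forall>\<^sub>F k in sequentially. L2w_sq \<phi> (v k) \<le> ennreal \<beta>"
    by (rule ev_le[OF vT \<beta>])
  ultimately have "\<forall>\<^sub>F k in sequentially. ennreal ((H_norm ?Q (\<lambda>z. u z - v k z))\<^sup>2) \<le> ennreal \<delta>2 \<and>
      L2w_sq \<phi> (v k) \<le> ennreal \<beta>" by eventually_elim blast
  then obtain k where k: "ennreal ((H_norm ?Q (\<lambda>z. u z - v k z))\<^sup>2) \<le> ennreal \<delta>2"
      "L2w_sq \<phi> (v k) \<le> ennreal \<beta>"
    using eventually_happens'[OF sequentially_bot] by blast
  define p where "p = v k"
  note p = v[of k, folded p_def]
  have up: "sqnorm ?Q (\<lambda>z. u z - p z) \<le> ennreal \<delta>2"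
    using k(1) unfolding normk p_def by (meson add_increasing2 order_refl order_trans zero_le)
  have Gp: "sqnorm ?Q (\<lambda>z. G i z - dx i p z) \<le> ennreal \<delta>2" for i
  proof -
    have "sqnorm ?Q (\<lambda>z. G i z - dx i p z) \<le> (\<Sum>i\<in>UNIV. sqnorm ?Q (\<lambda>z. G i z - dx i p z))"
      by (rule member_le_sum) auto
    also have "\<dots> \<le> ennreal \<delta>2"
      using k(1) unfolding normk p_def by (meson add_increasing order_refl order_trans zero_le)
    finally show ?thesis .
  qed
  define \<zeta> where "\<zeta> = bulk_cutoff \<phi> n"
  define \<xi> where "\<xi> = boundary_cutoff \<phi> \<epsilon>"
  define \<psi> where "\<psi> z = \<zeta> z * \<xi> z * p z" for z
  have \<zeta>: "smooth \<zeta>" "\<And>z. 0 \<le> \<zeta> z" "\<And>z. \<zeta> z \<le> 1" "\<And>z. \<zeta> z \<noteq> 0 \<Longrightarrow> z \<in> bulk \<phi> n r"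
    by (auto simp: \<zeta>_def r_def smooth_bulk_cutoff bulk_cutoff_nonneg bulk_cutoff_le_1 bulk_cutoff_support)
  have \<xi>: "smooth \<xi>" "\<And>z. 0 \<le> \<xi> z" "\<And>z. \<xi> z \<le> 1"
    by (auto simp: \<xi>_def smooth_boundary_cutoff[OF smooth_phi] boundary_cutoff_nonneg boundary_cutoff_le_1)
  have \<psi>: "\<psi> \<in> Cc_inf ?Q"
  proof (rule Cc_infI[of _ "bulk \<phi> n r \<inter> {z. \<phi> z \<le> - \<epsilon> / 4}"])
    show "smooth \<psi>" unfolding \<psi>_def[abs_def] by (intro smooth_mult \<zeta> \<xi> p)
    show "compact (bulk \<phi> n r \<inter> {z. \<phi> z \<le> - \<epsilon> / 4})"
      by (intro compact_Int_closed compact_bulk closed_Collect_le smooth_continuous_on smooth_phi continuous_intros)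
    show "bulk \<phi> n r \<inter> {z. \<phi> z \<le> - \<epsilon> / 4} \<subseteq> ?Q"
      using \<epsilon>(1) bulk_time[of _ \<phi> n r] by (force simp: QQ_def)
    show "z \<in> bulk \<phi> n r \<inter> {z. \<phi> z \<le> - \<epsilon> / 4}" if "\<psi> z \<noteq> 0" for z
      using that \<zeta>(4)[of z] boundary_cutoff_support[OF \<epsilon>(1), of \<phi> z] by (auto simp: \<psi>_def \<xi>_def)
  qed
  have dx\<psi>: "dx i \<psi> z = (dx i \<zeta> z * \<xi> z + \<zeta> z * dx i \<xi> z) * p z + \<zeta> z * \<xi> z * dx i p z" for i z
    unfolding \<psi>_def[abs_def] dx_def
    by (simp add: partial_mult[OF smooth_mult[OF \<zeta>(1) \<xi>(1)] p(1) axis_zero_Basis]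
        partial_mult[OF \<zeta>(1) \<xi>(1) axis_zero_Basis])
  have [measurable]: "\<zeta> \<in> borel_measurable (lebesgue_on ?Q)" "\<xi> \<in> borel_measurable (lebesgue_on ?Q)"
      "p \<in> borel_measurable (lebesgue_on ?Q)" "\<And>i. dx i \<zeta> \<in> borel_measurable (lebesgue_on ?Q)"
      "\<And>i. dx i \<xi> \<in> borel_measurable (lebesgue_on ?Q)" "\<And>i. dx i p \<in> borel_measurable (lebesgue_on ?Q)"
      "u \<in> borel_measurable (lebesgue_on ?Q)" "\<And>i. G i \<in> borel_measurable (lebesgue_on ?Q)"
    by (simp_all add: smooth_lebesgue_on smooth_dx \<zeta>(1) \<xi>(1) p(1) meas[OF uL] meas[OF G(1)])
  have cutoff: "sqnorm ?Q (\<lambda>z. (1 - \<zeta> z * \<xi> z) * f z) \<le> ennreal (4 * \<delta>)"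
    if f: "f = u \<or> (\<exists>i. f = G i)" for f
  proof -
    have [measurable]: "f \<in> borel_measurable (lebesgue_on ?Q)" using f by (auto intro: meas uL G)
    \<comment> \<open>The factor \<open>1 - \<zeta> z * \<xi> z\<close> is split into
      \<open>1 - \<zeta> z\<close>, small by the choice of \<open>n\<close>, and
      \<open>\<zeta> z * (1 - \<xi> z)\<close>, which is supported in the strip.\<close>
    have "sqnorm ?Q (\<lambda>z. (1 - \<zeta> z) * f z + \<zeta> z * (1 - \<xi> z) * f z) \<le> ennreal (2 * \<delta> + 2 * \<delta>)"
    proof (rule sqnorm_add_bound)
      show "sqnorm ?Q (\<lambda>z. (1 - \<zeta> z) * f z) \<le> ennreal \<delta>" using n(2,3) f by (auto simp: \<zeta>_def)
      have "sqnorm ?Q (\<lambda>z. \<zeta> z * (1 - \<xi> z) * f z) \<le> ennreal (1\<^sup>2) * sqnorm ?W f"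
      proof (rule sqnorm_le_sqnorm_subset[OF bS bQ strip_subset_QQ])
        fix z assume z: "z \<in> ?Q"
        show "\<bar>\<zeta> z * (1 - \<xi> z) * f z\<bar> \<le> 1 * (indicator ?W z * \<bar>f z\<bar>)"
        proof (cases "z \<in> ?W")
          case True
          have "\<bar>\<zeta> z * (1 - \<xi> z)\<bar> \<le> 1"
            using \<zeta>(2,3)[of z] \<xi>(2,3)[of z] by (simp add: abs_mult mult_le_one)
          then show ?thesis using True by (simp add: abs_mult[of _ "f z"] mult_left_le_one_le)
        next
          case False
          have "\<zeta> z = 0 \<or> \<xi> z = 1"
          proof (rule ccontr)
            assume "\<not> ?thesis"
            then have "z \<in> bulk \<phi> n r" "\<not> \<phi> z \<le> - \<epsilon> / 2"
              using \<zeta>(4)[of z] boundary_cutoff_eq_1[OF \<epsilon>(1), of \<phi> z] by (auto simp: \<xi>_def)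
            then have "z \<in> ?S" using z \<epsilon>(1) by (auto simp: strip_def QQ_def)
            then show False using SW False by blast
          qed
          then show ?thesis by auto
        qed
      qed auto
      also have "\<dots> \<le> ennreal \<delta>" using order_trans[OF smallW[OF f] ennreal_leI[OF \<delta>2(3)]] by simp
      finally show "sqnorm ?Q (\<lambda>z. \<zeta> z * (1 - \<xi> z) * f z) \<le> ennreal \<delta>" .
    qed (use \<delta> in \<open>measurable, auto\<close>)
    then show ?thesis by (simp add: algebra_simps)
  qed
  have damp: "sqnorm ?Q (\<lambda>z. \<zeta> z * \<xi> z * f z) \<le> sqnorm ?Q f" for f
  proof (rule sqnorm_mono)
    fix z
    have "\<bar>\<zeta> z * \<xi> z\<bar> \<le> 1" using \<zeta>(2,3)[of z] \<xi>(2,3)[of z] by (simp add: abs_mult mult_le_one)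
    then show "\<bar>\<zeta> z * \<xi> z * f z\<bar> \<le> \<bar>f z\<bar>" by (simp add: abs_mult[of _ "f z"] mult_left_le_one_le)
  qed
  have T0: "sqnorm ?Q (\<lambda>z. u z - \<psi> z) \<le> ennreal (10 * \<delta>)"
  proof -
    have "sqnorm ?Q (\<lambda>z. (1 - \<zeta> z * \<xi> z) * u z + \<zeta> z * \<xi> z * (u z - p z)) \<le> ennreal (2 * (4 * \<delta>) + 2 * \<delta>)"
    proof (rule sqnorm_add_bound)
      show "sqnorm ?Q (\<lambda>z. (1 - \<zeta> z * \<xi> z) * u z) \<le> ennreal (4 * \<delta>)" by (rule cutoff) simp
      show "sqnorm ?Q (\<lambda>z. \<zeta> z * \<xi> z * (u z - p z)) \<le> ennreal \<delta>"
        by (rule order_trans[OF order_trans[OF damp up] ennreal_leI[OF \<delta>2(3)]])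
    qed (use \<delta> in \<open>measurable, auto\<close>)
    then show ?thesis by (simp add: \<psi>_def algebra_simps)
  qed
  have strip_p: "sqnorm ?S p \<le> ennreal (C * \<epsilon> * \<beta> + D * \<epsilon>\<^sup>2 * (?d * (4 * \<delta>2)))"
  proof -
    have "sqnorm ?W (dx i p) \<le> ennreal (4 * \<delta>2)" for i
    proof -
      have mW: "f \<in> borel_measurable (lebesgue_on ?W)" if "f \<in> borel_measurable (lebesgue_on ?Q)" for f :: "(real^'n) \<times> real \<Rightarrow> real"
        by (rule measurable_restrict_mono[OF that strip_subset_QQ])
      \<comment> \<open>The derivative of \<open>p\<close> inherits smallness on the strip from
        \<open>G i\<close>: the strip was chosen for \<open>G i\<close> before \<open>p\<close>, and
        \<open>p\<close> is close to \<open>u\<close> in \<open>H\<close>.\<close>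
      have "sqnorm ?W (\<lambda>z. G i z - (G i z - dx i p z)) \<le> ennreal (2 * \<delta>2 + 2 * \<delta>2)"
      proof (rule sqnorm_diff_bound)
        show "sqnorm ?W (G i) \<le> ennreal \<delta>2" by (rule smallW) blast
        show "sqnorm ?W (\<lambda>z. G i z - dx i p z) \<le> ennreal \<delta>2"
          by (rule order_trans[OF sqnorm_subset[OF bS bQ strip_subset_QQ] Gp])
        show "G i \<in> borel_measurable (lebesgue_on ?W)" "(\<lambda>z. G i z - dx i p z) \<in> borel_measurable (lebesgue_on ?W)"
          by (intro mW; measurable)+
      qed (use \<delta>2 in auto)
      then show ?thesis by simp
    qed
    then have "(\<Sum>i\<in>UNIV. sqnorm ?W (dx i p)) \<le> (\<Sum>i\<in>(UNIV::'n set). ennreal (4 * \<delta>2))"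
      by (intro sum_mono)
    also have "\<dots> = ennreal (?d * (4 * \<delta>2))"
      using \<delta>2(2) by (simp add: ennreal_mult ennreal_of_nat_eq_real_of_nat)
    finally have s: "(\<Sum>i\<in>UNIV. sqnorm ?W (dx i p)) \<le> ennreal (?d * (4 * \<delta>2))" .
    have "sqnorm ?S p \<le> ennreal (C * \<epsilon>) * ennreal \<beta> + ennreal (D * \<epsilon>\<^sup>2) * ennreal (?d * (4 * \<delta>2))"
      by (intro order_trans[OF bound[OF \<epsilon> p(1)]] add_mono mult_left_mono s k(2)[folded p_def]) auto
    also have "\<dots> = ennreal (C * \<epsilon> * \<beta> + D * \<epsilon>\<^sup>2 * (?d * (4 * \<delta>2)))"
      using C D \<epsilon>(1) \<beta> \<delta>2(2) by (simp add: ennreal_plus flip: ennreal_mult)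
    finally show ?thesis .
  qed
  have pN: "sqnorm ?Q p \<le> ennreal (2 * Ru + 2 * \<delta>)"
  proof -
    have "sqnorm ?Q (\<lambda>z. u z - (u z - p z)) \<le> ennreal (2 * Ru + 2 * \<delta>)"
    proof (rule sqnorm_diff_bound)
      show "sqnorm ?Q (\<lambda>z. u z - p z) \<le> ennreal \<delta>" by (rule order_trans[OF up ennreal_leI[OF \<delta>2(3)]])
    qed (use \<delta> Ru in \<open>measurable, auto\<close>)
    then show ?thesis by simp
  qed
  have Ti: "sqnorm ?Q (\<lambda>z. G i z - dx i \<psi> z) \<le> ennreal (28 * \<delta>)" for i
  proof -
    \<comment> \<open>By the product rule \<open>G i z - dx i \<psi> z\<close> is this sum minus
      \<open>p z\<close> times the derivative of the product of the cutoffs, which is bounded in the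
      second claim; \<open>28 = 2 * 10 + 2 * 4\<close>.\<close>
    have 1: "sqnorm ?Q (\<lambda>z. (1 - \<zeta> z * \<xi> z) * G i z + \<zeta> z * \<xi> z * (G i z - dx i p z)) \<le> ennreal (2 * (4 * \<delta>) + 2 * \<delta>)"
    proof (rule sqnorm_add_bound)
      show "sqnorm ?Q (\<lambda>z. (1 - \<zeta> z * \<xi> z) * G i z) \<le> ennreal (4 * \<delta>)" by (rule cutoff) blast
      show "sqnorm ?Q (\<lambda>z. \<zeta> z * \<xi> z * (G i z - dx i p z)) \<le> ennreal \<delta>"
        by (rule order_trans[OF order_trans[OF damp Gp] ennreal_leI[OF \<delta>2(3)]])
    qed (use \<delta> in \<open>measurable, auto\<close>)
    have 2: "sqnorm ?Q (\<lambda>z. dx i \<zeta> z * \<xi> z * p z + \<zeta> z * dx i \<xi> z * p z) \<le> ennreal (2 * \<delta> + 2 * \<delta>)"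
    proof (rule sqnorm_add_bound)
      have "sqnorm ?Q (\<lambda>z. dx i \<zeta> z * \<xi> z * p z) \<le> sqnorm ?Q (\<lambda>z. 4 * B / real n * p z)"
      proof (rule sqnorm_mono)
        fix z
        have "\<bar>dx i \<zeta> z\<bar> * \<bar>\<xi> z\<bar> \<le> (4 * B / real n) * 1"
          unfolding \<zeta>_def using dx_bulk_cutoff_bound[OF B(2) n(4), of i \<phi> z] \<xi>(2,3)[of z] B(1) by (intro mult_mono) auto
        from mult_right_mono[OF this, of "\<bar>p z\<bar>"]
        show "\<bar>dx i \<zeta> z * \<xi> z * p z\<bar> \<le> \<bar>4 * B / real n * p z\<bar>"
          using B(1) by (simp add: abs_mult)
      qed
      also have "\<dots> = ennreal ((4 * B / real n)\<^sup>2) * sqnorm ?Q p" by (rule sqnorm_cmult) measurable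
      also have "\<dots> \<le> ennreal ((4 * B / real n)\<^sup>2) * ennreal (2 * Ru + 2 * \<delta>)"
        by (intro mult_left_mono pN) auto
      also have "\<dots> = ennreal ((4 * B / real n)\<^sup>2 * (2 * Ru + 2 * \<delta>))" using Ru \<delta> by (simp add: ennreal_mult)
      also have "\<dots> \<le> ennreal \<delta>" using n(1) by (intro ennreal_leI) simp
      finally show "sqnorm ?Q (\<lambda>z. dx i \<zeta> z * \<xi> z * p z) \<le> ennreal \<delta>" .
      \<comment> \<open>The critical term: its coefficient is of order \<open>1/\<epsilon>\<close>,
        but it is confined to the strip, where the trace condition has entered through
        \<open>strip_p\<close>.\<close>
      have "sqnorm ?Q (\<lambda>z. \<zeta> z * dx i \<xi> z * p z) \<le> ennreal ((4 * B * L / \<epsilon>)\<^sup>2) * sqnorm ?S p"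
      proof (rule sqnorm_le_sqnorm_subset[OF bS bQ strip_subset_QQ])
        fix z assume z: "z \<in> ?Q"
        show "\<bar>\<zeta> z * dx i \<xi> z * p z\<bar> \<le> 4 * B * L / \<epsilon> * (indicator ?S z * \<bar>p z\<bar>)"
        proof (cases "\<zeta> z = 0")
          case False
          then have K: "z \<in> bulk \<phi> n r" by (rule \<zeta>(4))
          have "\<bar>dx i \<xi> z\<bar> \<le> 4 * B * L / \<epsilon> * of_bool (- \<epsilon> < \<phi> z)"
            unfolding \<xi>_def by (rule dx_boundary_cutoff_bound[OF smooth_phi \<epsilon>(1) B(2) L(2)[OF K]])
          also have "of_bool (- \<epsilon> < \<phi> z) = (indicator ?S z :: real)"
            using K z by (auto simp: strip_def QQ_def indicator_def)
          finally have "\<bar>\<zeta> z\<bar> * \<bar>dx i \<xi> z\<bar> \<le> 1 * (4 * B * L / \<epsilon> * indicator ?S z)"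
            using \<zeta>(2,3)[of z] by (intro mult_mono) auto
          from mult_right_mono[OF this, of "\<bar>p z\<bar>"] show ?thesis by (simp add: abs_mult mult.assoc)
        qed (use B L \<epsilon> in simp)
      qed (use B L \<epsilon> in auto)
      also have "\<dots> \<le> ennreal ((4 * B * L / \<epsilon>)\<^sup>2) * ennreal (C * \<epsilon> * \<beta> + D * \<epsilon>\<^sup>2 * (?d * (4 * \<delta>2)))"
        by (intro mult_left_mono strip_p) auto
      also have "\<dots> = ennreal ((4 * B * L / \<epsilon>)\<^sup>2 * (C * \<epsilon> * \<beta> + D * \<epsilon>\<^sup>2 * (?d * (4 * \<delta>2))))"
        using C D \<epsilon>(1) \<beta> \<delta>2(2) by (simp add: ennreal_mult)
      also have "(4 * B * L / \<epsilon>)\<^sup>2 * (C * \<epsilon> * \<beta> + D * \<epsilon>\<^sup>2 * (?d * (4 * \<delta>2))) = A * C * \<beta> / \<epsilon> + (8 * ?d * A * D * \<delta>2) / 2"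
        using \<epsilon>(1) by (simp add: power_divide A_def[symmetric]) (simp add: field_simps power2_eq_square)
      also have "A * C * \<beta> / \<epsilon> = \<delta> / 2" using A C \<epsilon>(1) by (simp add: \<beta>_def)
      also have "ennreal (\<delta> / 2 + (8 * ?d * A * D * \<delta>2) / 2) \<le> ennreal \<delta>"
        using \<delta>2(1) by (intro ennreal_leI) linarith
      finally show "sqnorm ?Q (\<lambda>z. \<zeta> z * dx i \<xi> z * p z) \<le> ennreal \<delta>" .
    qed (use \<delta> in \<open>measurable, auto\<close>)
    have "sqnorm ?Q (\<lambda>z. ((1 - \<zeta> z * \<xi> z) * G i z + \<zeta> z * \<xi> z * (G i z - dx i p z)) -
        (dx i \<zeta> z * \<xi> z * p z + \<zeta> z * dx i \<xi> z * p z)) \<le> ennreal (2 * (2 * (4 * \<delta>) + 2 * \<delta>) + 2 * (2 * \<delta> + 2 * \<delta>))"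
      by (rule sqnorm_diff_bound[OF _ _ 1 2]) (use \<delta> in \<open>measurable, auto\<close>)
    then show ?thesis by (simp add: dx\<psi> algebra_simps)
  qed
  have "ennreal ((H_norm ?Q (\<lambda>z. u z - \<psi> z))\<^sup>2) = sqnorm ?Q (\<lambda>z. u z - \<psi> z) + (\<Sum>i\<in>UNIV. sqnorm ?Q (\<lambda>z. G i z - dx i \<psi> z))"
  proof (rule H_norm_sq[OF oQ])
    note L\<psi> = Cc_inf_L2[OF \<psi> oQ] and Ldx\<psi> = Cc_inf_L2[OF dx_in_Cc_inf[OF \<psi>] oQ]
    show "L2 ?Q (\<lambda>z. u z - \<psi> z)" by (rule L2_diff[OF uL L\<psi>])
    show "L2 ?Q (\<lambda>z. G i z - dx i \<psi> z)" for i by (rule L2_diff[OF G(1) Ldx\<psi>])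
    show "weak_dx ?Q i (\<lambda>z. u z - \<psi> z) (\<lambda>z. G i z - dx i \<psi> z)" for i
      by (rule weak_dx_diff[OF oQ L2_loc_integrable[OF oQ uL] L2_loc_integrable[OF oQ L\<psi>] L2_loc_integrable[OF oQ G(1)]
            L2_loc_integrable[OF oQ Ldx\<psi>] G(2) weak_dx_smooth[OF oQ Cc_inf_smooth[OF \<psi>]]])
  qed
  also have "\<dots> \<le> ennreal (10 * \<delta>) + (\<Sum>i\<in>(UNIV::'n set). ennreal (28 * \<delta>))"
    by (intro add_mono sum_mono T0 Ti)
  also have "\<dots> = ennreal (10 * \<delta> + ?d * (28 * \<delta>))"
    using \<delta> by (simp add: ennreal_mult ennreal_of_nat_eq_real_of_nat)
  finally have "(H_norm ?Q (\<lambda>z. u z - \<psi> z))\<^sup>2 \<le> 10 * \<delta> + ?d * (28 * \<delta>)"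
    using \<delta> by (subst (asm) ennreal_le_iff) auto
  also have "\<dots> < (11 + 28 * ?d) * \<delta>" using \<delta> by (simp add: algebra_simps)
  also have "\<dots> = e\<^sup>2" using d0 by (simp add: \<delta>_def)
  finally have "H_norm ?Q (\<lambda>z. u z - \<psi> z) < e" by (rule power2_less_imp_less) (use e in simp)
  then show "\<exists>\<psi>\<in>Cc_inf ?Q. H_norm ?Q (\<lambda>z. u z - \<psi> z) < e" using \<psi> by blast
qed

end
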